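(* Let $j \ge 2$ and $0 \le i \le j$ be integers. Let $X$ be a transitive subshift which is the orbit closure $X=\overline{\mathcal O(x)}$ of a recurrent point $x$, and suppose that $X$ has exactly $j$ proper minimal subsystems, exactly $i$ of which are infinite. Then the following bounds hold: (1) $\limsup_{n \to \infty} (c_X(n) - (j+i+1)n) = \infty$, and (2) $\liminf_{n \to \infty} (c_X(n) - (j+i)n) = \infty$. Moreover, these bounds are sharp in the following sense. For all integers $j\ge 2$, $0\le i\le j$, and every nondecreasing unbounded function $g:\mathbb N\to\mathbb N$: there exists a transitive subshift $X$ which is the orbit closure of a recurrent point and has exactly $j$ proper minimal subsystems, exactly $i$ of which are infinite, for which $\limsup_{n \to \infty} \big(c_X(n) - ((j+i+1)n+g(n))\big) = \infty$ is false; and there exists a transitive subshift $X$ which is the orbit closure of a recurrent point and has exactly $j$ proper minimal subsystems, exactly $i$ of which are infinite, for which $\liminf_{n \to \infty} \big(c_X(n) - ((j+i)n+g(n))\big) = \infty$ is false.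
   Context: A subshift is a closed, $\sigma$-invariant subset $X\subset\mathcal A^{\mathbb Z}$, where $\mathcal A$ is a finite alphabet, $\mathcal A^{\mathbb Z}$ carries the product topology, and $\sigma(x)_k=x_{k+1}$ is the left shift. A word of length $n$ in $X$ is a block $x_k x_{k+1}\cdots x_{k+n-1}$ occurring in some $x\in X$; $c_X(n)$ is the number of words of length $n$ in $X$. The orbit of $x$ is $\mathcal O(x)=\{\sigma^n(x):n\in\mathbb Z\}$; $X$ is transitive if $X=\overline{\mathcal O(x)}$ for some $x\in X$, and minimal if $X=\overline{\mathcal O(x)}$ for every $x\in X$. A minimal subsystem of $X$ is a subshift contained in $X$ that is minimal. A point $x$ is recurrent if every word in $x$ occurs at least twice (equivalently, infinitely often) in $x$. *)

theory Defs
  imports "HOL-Analysis.Analysis"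
begin

definition full_shift :: "'a set \<Rightarrow> (int \<Rightarrow> 'a) topology" where
  "full_shift A = product_topology (\<lambda>_. discrete_topology A) UNIV"

definition shift :: "(int \<Rightarrow> 'a) \<Rightarrow> (int \<Rightarrow> 'a)" where
  "shift x = (\<lambda>k. x (k + 1))"

definition subshift :: "'a set \<Rightarrow> (int \<Rightarrow> 'a) set \<Rightarrow> bool" where
  "subshift A X \<longleftrightarrow> finite A \<and> closedin (full_shift A) X \<and> shift ` X = X"

definition word :: "(int \<Rightarrow> 'a) \<Rightarrow> int \<Rightarrow> nat \<Rightarrow> 'a list" where
  "word x k n = map (\<lambda>l. x (k + int l)) [0..<n]"

definition words :: "(int \<Rightarrow> 'a) set \<Rightarrow> nat \<Rightarrow> 'a list set" where
  "words X n = {word x k n | x k. x \<in> X}"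

definition complexity :: "(int \<Rightarrow> 'a) set \<Rightarrow> nat \<Rightarrow> nat" where
  "complexity X n = card (words X n)"

text \<open>The two-sided orbit: the point \<open>\<lambda>k. x (k + n)\<close> is the \<open>n\<close>-th iterate of the bijection
  \<^const>\<open>shift\<close> at \<open>x\<close>, for every integer \<open>n\<close> (see the two lemmas below).\<close>

definition orbit :: "(int \<Rightarrow> 'a) \<Rightarrow> (int \<Rightarrow> 'a) set" where
  "orbit x = {(\<lambda>k. x (k + n)) | n :: int. True}"

lemma shift_funpow: "(shift ^^ n) x = (\<lambda>k. x (k + int n))"
  by (induction n) (auto simp: shift_def algebra_simps)

lemma shift_funpow_backward: "(shift ^^ n) (\<lambda>k. x (k + - int n)) = x"
  by (simp add: shift_funpow)

definition orbit_closure :: "'a set \<Rightarrow> (int \<Rightarrow> 'a) \<Rightarrow> (int \<Rightarrow> 'a) set" where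
  "orbit_closure A x = full_shift A closure_of orbit x"

definition recurrent :: "(int \<Rightarrow> 'a) \<Rightarrow> bool" where
  "recurrent x \<longleftrightarrow> (\<forall>k n. \<exists>m. m \<noteq> k \<and> word x m n = word x k n)"

definition transitive_subshift :: "'a set \<Rightarrow> (int \<Rightarrow> 'a) set \<Rightarrow> bool" where
  "transitive_subshift A X \<longleftrightarrow> subshift A X \<and> (\<exists>x\<in>X. X = orbit_closure A x)"

text \<open>The empty set, which satisfies the orbit closure condition vacuously, does not count as
  minimal.\<close>

definition minimal_subshift :: "'a set \<Rightarrow> (int \<Rightarrow> 'a) set \<Rightarrow> bool" where
  "minimal_subshift A X \<longleftrightarrow> subshift A X \<and> X \<noteq> {} \<and> (\<forall>x\<in>X. X = orbit_closure A x)"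

definition proper_minimal_subsystems ::
    "'a set \<Rightarrow> (int \<Rightarrow> 'a) set \<Rightarrow> (int \<Rightarrow> 'a) set set" where
  "proper_minimal_subsystems A X = {M. M \<subset> X \<and> minimal_subshift A M}"

text \<open>Finiteness is required because \<^const>\<open>card\<close> is \<open>0\<close> on infinite sets.\<close>

definition has_minimal_counts :: "'a set \<Rightarrow> (int \<Rightarrow> 'a) set \<Rightarrow> nat \<Rightarrow> nat \<Rightarrow> bool" where
  "has_minimal_counts A X j i \<longleftrightarrow>
     finite (proper_minimal_subsystems A X) \<and>
     card (proper_minimal_subsystems A X) = j \<and>
     card {M \<in> proper_minimal_subsystems A X. infinite M} = i"

end

theory Submission
  imports Defs
begin

text \<open>
  Lower bounds. Fix \<open>N\<close> so large that distinct minimal subsystems share no word of length \<open>N\<close>, and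
  label a position of \<open>x\<close> by \<open>k\<close> if the word of length \<open>N + 1\<close> there belongs to the \<open>k\<close>-th minimal
  subsystem, and by \<open>0\<close> if it belongs to none. Let \<open>c n\<close> count the words of length \<open>n\<close> over this sequence
  that are not monochromatic with a nonzero label; by Morse and Hedlund it suffices that
  \<open>c n - (j + 1) n\<close> is unbounded. Each label has arbitrarily long runs, which end, so \<open>c\<close> grows by at least \<open>j\<close>
  in each step. If the growth is at most \<open>j + 1\<close> from some point on, then at infinitely many levels \<open>m\<close> the
  sequence is deterministic away from the long runs, which it therefore visits in a cyclic order, with
  fixed words in between. Let \<open>n\<close> be the sum of the shortest lengths of such a run for the label where it is
  largest and for the next label, plus the length of a connecting word. The windows of length \<open>n\<close> that start
  before a short visit differ from those that start before a long one, and counting both gives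
  \<open>c n - (j + 1) n \<ge> c m - j m\<close>, which is unbounded.

  Sharpness. Let \<open>W (s + 1) = W s A_0 \<dots> A_(j-1) W s\<close>, where \<open>A_k\<close> is a block of the \<open>k\<close>-th of \<open>j\<close> points
  (Sturmian or constant) and the lengths of the blocks grow very fast, from each block to the next. A window is
  determined by the position of the block boundaries in it; at a length \<open>n\<close> between two
  consecutive block lengths, besides the windows at the \<open>j\<close> transitions between long blocks there are only about
  \<open>n\<close> windows that see a block shorter than \<open>n\<close>.
\<close>

section \<open>Words, orbit closures and subshifts\<close>

text \<open>The number of non-monochromatic words grows through right special words and through
  exits, that is, monochromatic words followed by a letter with another label. Every label has an
  exit word of each length, which gives growth \<open>j\<close> for free. The obstacle is that
  growth of exactly \<open>j + 1\<close> would keep \<open>c n - (j + 1) n\<close> bounded. Such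
  growth leaves room for one surplus per length: one right special word or one second exit word.
  Visits to a label are unbounded, so right special words made of one letter and a long run occur at
  arbitrarily large lengths, and there all exits are unique. If uniqueness later breaks, that length
  has no right special word; if it persists, the next right special entrance can be absorbed into
  the start of a visit. Both ways the sequence is deterministic between long visits.

  Recurrence may hold in one direction only; recurrence to the left is reduced to recurrence to the
  right by reflection.

  For sharpness, blocks of all stages must look alike near their ends. They are therefore cut from
  points whose words on \<open>[-a, 0)\<close> and \<open>[0, a)\<close> coincide for arbitrarily
  large \<open>a\<close>.\<close>

lemma length_word [simp]: "length (word x k n) = n"
  by (simp add: word_def)

lemma nth_word [simp]: "l < n \<Longrightarrow> word x k n ! l = x (k + int l)"
  by (simp add: word_def)

lemma word_0 [simp]: "word x k 0 = []"
  by (simp add: word_def)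

lemma word_eq_iff: "word x k n = word y m n \<longleftrightarrow> (\<forall>l<n. x (k + int l) = y (m + int l))"
  by (auto simp: list_eq_iff_nth_eq)

lemma word_Suc: "word x k (Suc n) = word x k n @ [x (k + int n)]"
  by (rule nth_equalityI) (auto simp: nth_append less_Suc_eq)

lemma take_word: "m \<le> n \<Longrightarrow> take m (word x k n) = word x k m"
  by (rule nth_equalityI) auto

lemma drop_word: "drop m (word x k n) = word x (k + int m) (n - m)"
  by (rule nth_equalityI) (auto simp: algebra_simps)

lemma hd_word: "n > 0 \<Longrightarrow> hd (word x k n) = x k"
  by (cases n) (simp_all add: word_def upt_conv_Cons del: upt_Suc)

lemma butlast_word: "butlast (word x k (Suc n)) = word x k n"
  by (simp add: word_Suc)

lemma Ball_set_word: "(\<forall>b\<in>set (word x k n). P b) \<longleftrightarrow> (\<forall>l<n. P (x (k + int l)))"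
  by (simp add: all_set_conv_all_nth)

lemma word_eqD: "word x k n = word y m n \<Longrightarrow> 0 \<le> i \<Longrightarrow> i < int n \<Longrightarrow> x (k + i) = y (m + i)"
  unfolding word_eq_iff by (drule spec[of _ "nat i"]) auto

lemma word_eqI: "(\<And>i. 0 \<le> i \<Longrightarrow> i < int n \<Longrightarrow> x (k + i) = y (m + i)) \<Longrightarrow> word x k n = word y m n"
  by (simp add: word_eq_iff)

lemma subword_eq:
  assumes "word x t m = word z s m" "t \<le> q" "q + int n \<le> t + int m"
  shows "word x q n = word z (s + (q - t)) n"
proof (rule word_eqI)
  fix i assume "0 \<le> i" "i < int n"
  then have "x (t + (q - t + i)) = z (s + (q - t + i))"
    using assms by (intro word_eqD[OF assms(1)]) auto
  then show "x (q + i) = z (s + (q - t) + i)" by (simp add: algebra_simps)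
qed

section \<open>The product topology in terms of words\<close>

lemma topspace_full_shift: "topspace (full_shift A) = {x. \<forall>k. x k \<in> A}"
  by (auto simp: full_shift_def PiE_def Pi_def)

lemma openin_cylinder: "openin (full_shift A) {z. (\<forall>i. z i \<in> A) \<and> word z k n = word y k n}"
proof -
  define U where "U i = (if k \<le> i \<and> i < k + int n then A \<inter> {y i} else A)" for i
  have fin: "finite {i. U i \<noteq> A}"
    by (rule finite_subset[of _ "{k..<k + int n}"]) (auto simp: U_def)
  have eq: "{z. (\<forall>i. z i \<in> A) \<and> word z k n = word y k n} = PiE UNIV U"
  proof (rule set_eqI)
    fix z
    have "word z k n = word y k n \<longleftrightarrow> (\<forall>i. k \<le> i \<and> i < k + int n \<longrightarrow> z i = y i)"
    proof
      assume w: "word z k n = word y k n"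
      show "\<forall>i. k \<le> i \<and> i < k + int n \<longrightarrow> z i = y i"
        using word_eqD[OF w, of "i - k" for i] by simp
    qed (simp add: word_eq_iff)
    then show "z \<in> {z. (\<forall>i. z i \<in> A) \<and> word z k n = word y k n} \<longleftrightarrow> z \<in> PiE UNIV U"
      by (auto simp: U_def PiE_iff)
  qed
  show ?thesis
    unfolding eq full_shift_def openin_product_topology_alt
  proof (intro ballI exI[of _ U] conjI)
    show "finite {i \<in> UNIV. U i \<noteq> topspace (discrete_topology A)}" using fin by simp
  qed (auto simp: U_def split: if_splits)
qed

lemma full_shift_closure_of:
  "y \<in> full_shift A closure_of S \<longleftrightarrow>
     (\<forall>k. y k \<in> A) \<and> (\<forall>k n. \<exists>z\<in>S. (\<forall>i. z i \<in> A) \<and> word z k n = word y k n)"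
proof
  assume y: "y \<in> full_shift A closure_of S"
  have yt: "y \<in> topspace (full_shift A)" using y by (simp add: in_closure_of)
  have "\<exists>z\<in>S. (\<forall>i. z i \<in> A) \<and> word z k n = word y k n" for k n
  proof -
  define C where "C = {z. (\<forall>i. z i \<in> A) \<and> word z k n = word y k n}"
  have "y \<in> C" "openin (full_shift A) C"
    using yt openin_cylinder by (auto simp: C_def topspace_full_shift)
  with y obtain z where "z \<in> S" "z \<in> C" unfolding in_closure_of by meson
  then show "\<exists>z\<in>S. (\<forall>i. z i \<in> A) \<and> word z k n = word y k n"
    by (intro bexI[of _ z]) (auto simp: C_def)
  qed
  with yt show "(\<forall>k. y k \<in> A) \<and> (\<forall>k n. \<exists>z\<in>S. (\<forall>i. z i \<in> A) \<and> word z k n = word y k n)"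
    by (simp add: topspace_full_shift)
next
  assume "(\<forall>k. y k \<in> A) \<and> (\<forall>k n. \<exists>z\<in>S. (\<forall>i. z i \<in> A) \<and> word z k n = word y k n)"
  then have yA: "\<forall>k. y k \<in> A"
    and d: "\<forall>k n. \<exists>z\<in>S. (\<forall>i. z i \<in> A) \<and> word z k n = word y k n" by blast+
  show "y \<in> full_shift A closure_of S"
    unfolding in_closure_of
  proof (intro conjI allI impI)
    show "y \<in> topspace (full_shift A)" using yA by (simp add: topspace_full_shift)
    fix T assume "y \<in> T \<and> openin (full_shift A) T"
    then obtain U where fin: "finite {i. U i \<noteq> A}" and op: "\<And>i. openin (discrete_topology A) (U i)"
      and yU: "y \<in> PiE UNIV U" and UT: "PiE UNIV U \<subseteq> T"
      unfolding full_shift_def openin_product_topology_alt by auto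
    define B where "B = Max ((\<lambda>i. \<bar>i\<bar>) ` {i. U i \<noteq> A}) + 1"
    have B: "\<forall>i\<in>{i. U i \<noteq> A}. \<bar>i\<bar> < B"
    proof
      fix i assume "i \<in> {i. U i \<noteq> A}"
      then have "\<bar>i\<bar> \<le> Max ((\<lambda>i. \<bar>i\<bar>) ` {i. U i \<noteq> A})"
        using fin by (intro Max_ge) auto
      then show "\<bar>i\<bar> < B" by (simp add: B_def)
    qed
    \<comment> \<open>If no coordinate is restricted, \<open>B\<close> is built from
      \<open>Max {}\<close> and may be negative; the absolute value keeps the window well
      formed.\<close>
    obtain z where z: "z \<in> S" "\<forall>i. z i \<in> A" "word z (- \<bar>B\<bar>) (nat (2 * \<bar>B\<bar>)) = word y (- \<bar>B\<bar>) (nat (2 * \<bar>B\<bar>))"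
      using d by blast
    have "z i \<in> U i" for i
    proof (cases "U i = A")
      case False
      then have "\<bar>i\<bar> < B" using B by simp
      then have "z i = y i" using word_eqD[OF z(3), of "i + \<bar>B\<bar>"] by simp
      then show ?thesis using yU by auto
    qed (use z in auto)
    then have "z \<in> T" using UT by (auto simp: PiE_iff)
    then show "\<exists>u. u \<in> S \<and> u \<in> T" using z by auto
  qed
qed

lemma mem_orbit_closure:
  assumes "\<And>k. x k \<in> A"
  shows "y \<in> orbit_closure A x \<longleftrightarrow> (\<forall>k n. \<exists>m. word x m n = word y k n)"
proof -
  have *: "word (\<lambda>i. x (i + m)) k n = word x (k + m) n" for m k n
    by (simp add: word_eq_iff algebra_simps)
  have 1: "(\<exists>z\<in>orbit x. (\<forall>i. z i \<in> A) \<and> word z k n = word y k n) \<longleftrightarrow>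
     (\<exists>m. word x m n = word y k n)" for k n
  proof
    assume "\<exists>m. word x m n = word y k n"
    then obtain m where m: "word x m n = word y k n" by blast
    have "word (\<lambda>i. x (i + (m - k))) k n = word y k n" using m by (simp add: *)
    moreover have "(\<lambda>i. x (i + (m - k))) \<in> orbit x" unfolding orbit_def by blast
    ultimately show "\<exists>z\<in>orbit x. (\<forall>i. z i \<in> A) \<and> word z k n = word y k n"
      by (intro bexI[of _ "\<lambda>i. x (i + (m - k))"]) (use assms in auto)
  next
    assume "\<exists>z\<in>orbit x. (\<forall>i. z i \<in> A) \<and> word z k n = word y k n"
    then obtain m where "word (\<lambda>i. x (i + m)) k n = word y k n" unfolding orbit_def by blast
    then show "\<exists>m. word x m n = word y k n" unfolding * by blast
  qed
  have "y k \<in> A" if h: "\<forall>k n. \<exists>m. word x m n = word y k n" for k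
  proof -
    obtain m where "word x m 1 = word y k 1" using h by blast
    then have "x m = y k" by (simp add: word_eq_iff)
    then show ?thesis using assms by metis
  qed
  then show ?thesis
    unfolding orbit_closure_def full_shift_closure_of 1 by blast
qed

lemma orbit_closure_subset_full: "y \<in> orbit_closure A x \<Longrightarrow> y k \<in> A"
  unfolding orbit_closure_def full_shift_closure_of by blast

lemma word_shift: "word (shift x) k n = word x (k + 1) n"
  by (simp add: word_eq_iff shift_def algebra_simps)

lemma mem_subshift_iff:
  assumes "subshift A X"
  shows "y \<in> X \<longleftrightarrow> (\<forall>k n. \<exists>z\<in>X. word z k n = word y k n)"
proof -
  have cl: "closedin (full_shift A) X" using assms by (simp add: subshift_def)
  have XA: "\<forall>z\<in>X. \<forall>i. z i \<in> A"
    using closedin_subset[OF cl] by (auto simp: topspace_full_shift)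
  have "X = full_shift A closure_of X" using cl by (simp add: closure_of_closedin)
  then have "y \<in> X \<longleftrightarrow> (\<forall>k. y k \<in> A) \<and> (\<forall>k n. \<exists>z\<in>X. (\<forall>i. z i \<in> A) \<and> word z k n = word y k n)"
    using full_shift_closure_of by metis
  moreover have "y k \<in> A" if h: "\<forall>k n. \<exists>z\<in>X. word z k n = word y k n" for k
  proof -
    obtain z where "z \<in> X" "word z k 1 = word y k 1" using h by blast
    then have "z k = y k" by (simp add: word_eq_iff)
    then show ?thesis using XA \<open>z \<in> X\<close> by metis
  qed
  ultimately show ?thesis using XA by (meson)
qed

lemma subshift_letters: "subshift A X \<Longrightarrow> z \<in> X \<Longrightarrow> z i \<in> A"
  using closedin_subset[of "full_shift A" X] by (auto simp: topspace_full_shift subshift_def)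

lemma subshift_translate:
  assumes "subshift A X" "z \<in> X"
  shows "(\<lambda>k. z (k + m)) \<in> X"
proof -
  have sh: "shift ` X = X" using assms by (simp add: subshift_def)
  have fwd: "(\<lambda>k. z (k + int n)) \<in> X" if "z \<in> X" for n z
    using that
  proof (induction n arbitrary: z)
    case (Suc n)
    have "shift z \<in> X" using sh Suc.prems by blast
    from Suc.IH[OF this] show ?case by (simp add: shift_def algebra_simps)
  qed simp
  have bwd: "(\<lambda>k. z (k - int n)) \<in> X" if "z \<in> X" for n z
    using that
  proof (induction n arbitrary: z)
    case (Suc n)
    obtain u where u: "u \<in> X" "z = shift u" using sh Suc.prems by blast
    have "(\<lambda>k. z (k - int (Suc n))) = (\<lambda>k. u (k - int n))"
      by (rule ext) (simp add: u shift_def)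
    then show ?case using Suc.IH[OF u(1)] by simp
  qed simp
  show ?thesis
    using fwd[OF assms(2), of "nat m"] bwd[OF assms(2), of "nat (- m)"] by (cases "m \<ge> 0") auto
qed

lemma subshift_orbit_closure:
  assumes "finite A" "\<And>k. x k \<in> A"
  shows "subshift A (orbit_closure A x)"
  unfolding subshift_def
proof (intro conjI)
  show "finite A" by fact
  show "closedin (full_shift A) (orbit_closure A x)" by (simp add: orbit_closure_def)
  show "shift ` orbit_closure A x = orbit_closure A x"
  proof (intro equalityI subsetI)
    fix y assume "y \<in> shift ` orbit_closure A x"
    then show "y \<in> orbit_closure A x"
      by (auto simp: mem_orbit_closure[OF assms(2)] word_shift)
  next
    fix y assume y: "y \<in> orbit_closure A x"
    have "y = shift (\<lambda>k. y (k - 1))" by (auto simp: shift_def)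
    moreover have "(\<lambda>k. y (k - 1)) \<in> orbit_closure A x"
    proof -
      have "word (\<lambda>k. y (k - 1)) k n = word y (k - 1) n" for k n
        by (simp add: word_eq_iff algebra_simps)
      then show ?thesis using y by (auto simp: mem_orbit_closure[OF assms(2)])
    qed
    ultimately show "y \<in> shift ` orbit_closure A x" by blast
  qed
qed

lemma self_mem_orbit_closure: "(\<And>k. x k \<in> A) \<Longrightarrow> x \<in> orbit_closure A x"
  by (auto simp: mem_orbit_closure)

lemma words_orbit_closure:
  assumes "\<And>k. x k \<in> A"
  shows "words (orbit_closure A x) n = {word x k n | k. True}"
proof (intro equalityI subsetI)
  fix w assume "w \<in> words (orbit_closure A x) n"
  then obtain z k where "z \<in> orbit_closure A x" "w = word z k n" by (auto simp: words_def)
  moreover from this have "\<exists>m. word x m n = word z k n" by (simp add: mem_orbit_closure[OF assms])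
  then obtain m where "word x m n = word z k n" ..
  ultimately have "w = word x m n" by simp
  then show "w \<in> {word x k n | k. True}" by blast
next
  fix w assume "w \<in> {word x k n | k. True}"
  then show "w \<in> words (orbit_closure A x) n"
    using self_mem_orbit_closure[OF assms] by (auto simp: words_def)
qed

lemma finite_words:
  assumes "subshift A X" shows "finite (words X n)"
proof (rule finite_subset)
  show "words X n \<subseteq> {w. set w \<subseteq> A \<and> length w = n}"
    using subshift_letters[OF assms] by (fastforce simp: words_def in_set_conv_nth)
  show "finite {w. set w \<subseteq> A \<and> length w = n}"
    using assms by (intro finite_lists_length_eq) (simp add: subshift_def)
qed

text \<open>Shift invariance makes the position of a word irrelevant, so the language alone
  determines a subshift.\<close>

lemma mem_subshift_words:
  assumes "subshift A X"
  shows "y \<in> X \<longleftrightarrow> (\<forall>k n. word y k n \<in> words X n)"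
proof
  show "\<forall>k n. word y k n \<in> words X n" if "y \<in> X" using that by (auto simp: words_def)
  assume h: "\<forall>k n. word y k n \<in> words X n"
  have "\<exists>z\<in>X. word z k n = word y k n" for k n
  proof -
    obtain u m where um: "u \<in> X" "word y k n = word u m n" using h unfolding words_def by blast
    let ?z = "\<lambda>i. u (i + (m - k))"
    have "?z \<in> X" using subshift_translate[OF assms um(1)] .
    moreover have "word ?z k n = word u m n" by (simp add: word_eq_iff algebra_simps)
    ultimately show ?thesis using um by metis
  qed
  then show "y \<in> X" by (intro mem_subshift_iff[OF assms, THEN iffD2] allI)
qed

section \<open>Words that are not monochromatic in a labelled sequence\<close>

text \<open>\<open>recurs\<close> is recurrence to the right: every label is met again beyond any
  position, so scanning to the right finds the end of every run. In the application label
  \<open>0\<close> marks words that belong to no minimal subsystem; by \<open>adjacent\<close>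
  visits to different labels are separated by other labels such as \<open>0\<close>.\<close>

locale labelled_sequence =
  fixes y :: "int \<Rightarrow> 'b" and lab :: "'b \<Rightarrow> nat" and j :: nat
  assumes finite_range: "finite (range y)"
    and j_ge_2: "2 \<le> j"
    and recurs: "\<exists>t'>m. word y t' n = word y t n"
    and long_runs: "k \<in> {1..j} \<Longrightarrow> \<exists>t. \<forall>i. t \<le> i \<and> i < t + int n \<longrightarrow> lab (y i) = k"
    and adjacent: "lab (y t) \<noteq> lab (y (t + 1)) \<Longrightarrow> lab (y t) = 0 \<or> lab (y (t + 1)) = 0"
begin

definition run :: "nat \<Rightarrow> int \<Rightarrow> int \<Rightarrow> bool" where
  "run k s e \<longleftrightarrow> (\<forall>i. s \<le> i \<and> i < e \<longrightarrow> lab (y i) = k)"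

definition Lg :: "nat \<Rightarrow> 'b list set" where
  "Lg n = range (\<lambda>t. word y t n)"

definition mono_word :: "nat \<Rightarrow> 'b list \<Rightarrow> bool" where
  "mono_word k w \<longleftrightarrow> (\<forall>b\<in>set w. lab b = k)"

definition NM :: "nat \<Rightarrow> 'b list set" where
  "NM n = {w \<in> Lg n. \<forall>k\<in>{1..j}. \<not> mono_word k w}"

text \<open>For \<open>n \<ge> 1\<close> and \<open>k\<close> ranging over \<open>{1..j}\<close>
  these are the members of \<open>NM (Suc n)\<close> that do not extend a member of
  \<open>NM n\<close>.\<close>

definition exits :: "nat \<Rightarrow> nat \<Rightarrow> 'b list set" where
  "exits k n = {w \<in> Lg (Suc n). mono_word k (butlast w) \<and> lab (last w) \<noteq> k}"

text \<open>Right special words among the non-monochromatic ones; the branching of monochromatic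
  words is accounted for by \<open>exits\<close>.\<close>

definition RS :: "nat \<Rightarrow> 'b list set" where
  "RS n = {w \<in> NM n. \<exists>c c'. c \<noteq> c' \<and> w @ [c] \<in> Lg (Suc n) \<and> w @ [c'] \<in> Lg (Suc n)}"

lemma runI: "(\<And>i. s \<le> i \<Longrightarrow> i < e \<Longrightarrow> lab (y i) = k) \<Longrightarrow> run k s e"
  by (simp add: run_def)

lemma runD: "run k s e \<Longrightarrow> s \<le> i \<Longrightarrow> i < e \<Longrightarrow> lab (y i) = k"
  by (simp add: run_def)

lemma run_mono: "run k s e \<Longrightarrow> s \<le> s' \<Longrightarrow> e' \<le> e \<Longrightarrow> run k s' e'"
  by (simp add: run_def)

lemma mono_word_word: "mono_word k (word y t n) \<longleftrightarrow> run k t (t + int n)"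
proof
  assume "mono_word k (word y t n)"
  then have h: "\<forall>l<n. lab (y (t + int l)) = k" by (simp add: mono_word_def Ball_set_word)
  show "run k t (t + int n)"
  proof (rule runI)
    fix i assume "t \<le> i" "i < t + int n"
    then show "lab (y i) = k" using h[rule_format, of "nat (i - t)"] by auto
  qed
qed (simp add: mono_word_def Ball_set_word run_def)

lemma word_in_Lg [simp]: "word y t n \<in> Lg n"
  by (simp add: Lg_def)

lemma Lg_E: assumes "w \<in> Lg n" obtains t where "w = word y t n"
  using assms by (auto simp: Lg_def)

lemma finite_Lg [simp]: "finite (Lg n)"
proof (rule finite_subset)
  show "Lg n \<subseteq> {w. set w \<subseteq> range y \<and> length w = n}"
    by (auto simp: Lg_def in_set_conv_nth)
  show "finite {w. set w \<subseteq> range y \<and> length w = n}"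
    using finite_range by (rule finite_lists_length_eq)
qed

lemma finite_NM [simp]: "finite (NM n)" by (simp add: NM_def)
lemma finite_exits [simp]: "finite (exits k n)" by (simp add: exits_def)
lemma finite_RS [simp]: "finite (RS n)" by (simp add: RS_def)

lemma word_NM_iff: "word y t n \<in> NM n \<longleftrightarrow> (\<forall>k\<in>{1..j}. \<not> run k t (t + int n))"
  by (simp add: NM_def mono_word_word)

lemma word_exits_iff: "word y t (Suc n) \<in> exits k n \<longleftrightarrow> run k t (t + int n) \<and> lab (y (t + int n)) \<noteq> k"
  by (simp add: exits_def butlast_word mono_word_word) (simp add: word_Suc)

lemma run_cong:
  assumes "word y t n = word y t' n" "run k (t + a) (t + b)" "0 \<le> a" "b \<le> int n"
  shows "run k (t' + a) (t' + b)"
proof (rule runI)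
  fix i assume i: "t' + a \<le> i" "i < t' + b"
  then have "y (t + (i - t')) = y (t' + (i - t'))"
    using assms by (intro word_eqD[OF assms(1)]) auto
  then show "lab (y i) = k" using runD[OF assms(2), of "t + (i - t')"] i by simp
qed

lemma other_label: obtains l where "l \<in> {1..j}" "l \<noteq> k"
proof -
  have "1 \<in> {1..j}" "2 \<in> {1..j}" using j_ge_2 by auto
  then show ?thesis using that[of 1] that[of 2] by (cases "k = 1") auto
qed

lemma run_far:
  assumes "k \<in> {1..j}" shows "\<exists>s>B. run k s (s + int n)"
proof -
  obtain t where "run k t (t + int n)" using long_runs[OF assms, of n] by (auto simp: run_def)
  moreover obtain t' where "t' > B" "word y t' n = word y t n" using recurs by blast
  ultimately show ?thesis using run_cong[of t n t' k 0 "int n"] by auto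
qed

text \<open>Another label occurs to the right of \<open>u\<close> by recurrence, so there is a first
  position from \<open>u\<close> on without label \<open>k\<close>.\<close>

lemma run_end:
  assumes "run k s u" "s \<le> u"
  obtains e where "u \<le> e" "run k s e" "lab (y e) \<noteq> k"
proof -
  obtain l where l: "l \<in> {1..j}" "l \<noteq> k" by (rule other_label)
  obtain v where v: "v > u" "run l v (v + int 1)" using run_far[OF l(1)] by blast
  define S where "S = {i. u \<le> i \<and> i \<le> v \<and> lab (y i) \<noteq> k}"
  have fin: "finite S" by (rule finite_subset[of _ "{u..v}"]) (auto simp: S_def)
  have "v \<in> S" using v l runD[OF v(2), of v] by (auto simp: S_def)
  then have e: "Min S \<in> S" using fin by (intro Min_in) auto
  have "lab (y i) = k" if "s \<le> i" "i < Min S" for i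
  proof (cases "i < u")
    case True then show ?thesis using assms that by (auto dest: runD)
  next
    case False
    then have "i \<notin> S" using that fin by (meson Min_le not_less)
    then show ?thesis using False that e by (auto simp: S_def)
  qed
  then show ?thesis using e by (intro that[of "Min S"]) (auto simp: S_def intro: runI)
qed

lemma run_begin:
  assumes "k \<in> {1..j}" shows "\<exists>s>B. run k s (s + int n) \<and> lab (y (s - 1)) \<noteq> k"
proof -
  obtain l where l: "l \<in> {1..j}" "l \<noteq> k" by (rule other_label)
  obtain v where v: "v > B" "run l v (v + int 1)" using run_far[OF l(1)] by blast
  obtain s0 where s0: "s0 > v" "run k s0 (s0 + int n)" using run_far[OF assms] by blast
  define S where "S = {i. v \<le> i \<and> i < s0 \<and> lab (y i) \<noteq> k}"
  have fin: "finite S" by (rule finite_subset[of _ "{v..s0}"]) (auto simp: S_def)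
  have vS: "v \<in> S" using v l s0 runD[OF v(2), of v] by (auto simp: S_def)
  then have e: "Max S \<in> S" using fin by (intro Max_in) auto
  have "lab (y i) = k" if "Max S + 1 \<le> i" "i < s0 + int n" for i
  proof (cases "i < s0")
    case True
    have "i \<notin> S"
    proof
      assume "i \<in> S" then have "i \<le> Max S" using fin by simp
      then show False using that by simp
    qed
    moreover have "v \<le> i" using e that by (auto simp: S_def)
    ultimately show ?thesis using True by (auto simp: S_def)
  next
    case False
    then show ?thesis using runD[OF s0(2), of i] that by simp
  qed
  then have "run k (Max S + 1) (Max S + 1 + int n)"
    using e by (intro runI) (auto simp: S_def)
  then show ?thesis using e v by (intro exI[of _ "Max S + 1"]) (auto simp: S_def)
qed

lemma exists_exit:
  assumes "k \<in> {1..j}" shows "\<exists>e>B. run k (e - int n) e \<and> lab (y e) \<noteq> k"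
proof -
  obtain s where s: "s > B" "run k s (s + int n)" using run_far[OF assms] by blast
  obtain e where e: "s + int n \<le> e" "run k s e" "lab (y e) \<noteq> k" by (rule run_end[OF s(2)]) auto
  show ?thesis
  proof (cases "e > B")
    case True
    then show ?thesis using e by (intro exI[of _ e]) (auto intro: run_mono)
  qed (use s e in auto)
qed

lemma label_after_exit:
  assumes "k \<in> {1..j}" "lab (y (e - 1)) = k" "lab (y e) \<noteq> k" shows "lab (y e) = 0"
  using adjacent[of "e - 1"] assms by auto

lemma label_before_start:
  assumes "k \<in> {1..j}" "lab (y s) = k" "lab (y (s - 1)) \<noteq> k" shows "lab (y (s - 1)) = 0"
  using adjacent[of "s - 1"] assms by auto

lemma exits_nonempty: "k \<in> {1..j} \<Longrightarrow> exits k n \<noteq> {}"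
proof -
  assume k: "k \<in> {1..j}"
  obtain e where "run k (e - int n) e" "lab (y e) \<noteq> k" using exists_exit[OF k] by blast
  then have "word y (e - int n) (Suc n) \<in> exits k n" by (simp add: word_exits_iff)
  then show ?thesis by blast
qed

lemma exits_ge_1: "k \<in> {1..j} \<Longrightarrow> card (exits k n) \<ge> 1"
  using exits_nonempty[of k n] by (simp add: Suc_le_eq card_gt_0_iff)

section \<open>Growth of the number of non-monochromatic words\<close>

lemma length_Lg: "w \<in> Lg n \<Longrightarrow> length w = n"
  by (auto simp: Lg_def)

lemma mono_word_take: "mono_word k w \<Longrightarrow> mono_word k (take m w)"
  by (auto simp: mono_word_def dest: in_set_takeD)

lemma NM_extend: "take m w \<in> NM m \<Longrightarrow> w \<in> Lg n \<Longrightarrow> w \<in> NM n"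
  by (auto simp: NM_def dest: mono_word_take)

lemma Lg_right_extend: "w \<in> Lg n \<Longrightarrow> \<exists>c. w @ [c] \<in> Lg (Suc n)"
proof -
  assume "w \<in> Lg n"
  then obtain t where t: "w = word y t n" by (rule Lg_E)
  have "w @ [y (t + int n)] \<in> Lg (Suc n)" using word_in_Lg[of t "Suc n"] by (simp add: word_Suc t)
  then show ?thesis ..
qed

text \<open>Three disjoint families lie in \<open>NM (Suc n)\<close>: one extension of each word of
  \<open>NM n\<close>, a second extension of each right special word, and the exits, whose prefix of
  length \<open>n\<close> is monochromatic. For \<open>n \<ge> 1\<close> the first letter of an exit
  reveals its label, so exits of different labels do not coincide.\<close>

lemma NM_growth:
  assumes "n \<ge> 1"
  shows "card (RS n) + (\<Sum>k\<in>{1..j}. card (exits k n)) + card (NM n) \<le> card (NM (Suc n))"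
proof -
  define f where "f w = (SOME c. w @ [c] \<in> Lg (Suc n))" for w
  define g where "g w = (SOME c. c \<noteq> f w \<and> w @ [c] \<in> Lg (Suc n))" for w
  have f: "w @ [f w] \<in> Lg (Suc n)" if "w \<in> NM n" for w
    unfolding f_def
    by (rule someI_ex[of "\<lambda>c. w @ [c] \<in> Lg (Suc n)"], rule Lg_right_extend) (use that in \<open>simp add: NM_def\<close>)
  have g: "g w \<noteq> f w \<and> w @ [g w] \<in> Lg (Suc n)" if wRS: "w \<in> RS n" for w
  proof -
    obtain c c' where "c \<noteq> c'" "w @ [c] \<in> Lg (Suc n)" "w @ [c'] \<in> Lg (Suc n)"
      using wRS by (auto simp: RS_def)
    then have "\<exists>c. c \<noteq> f w \<and> w @ [c] \<in> Lg (Suc n)" 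
      by (cases "c = f w") (blast intro: exI[of _ c'], blast)
    then show ?thesis unfolding g_def by (rule someI_ex)
  qed
  let ?S1 = "(\<lambda>w. w @ [f w]) ` NM n" and ?S2 = "(\<lambda>w. w @ [g w]) ` RS n"
    and ?S3 = "\<Union>k\<in>{1..j}. exits k n"
  have len: "length w = n" if "w \<in> NM n" for w using that by (auto simp: NM_def length_Lg)
  have RS_NM: "RS n \<subseteq> NM n" by (auto simp: RS_def)
  have ext_NM: "w @ [c] \<in> NM (Suc n)" if "w \<in> NM n" "w @ [c] \<in> Lg (Suc n)" for w c
  proof (rule NM_extend[of n _ "Suc n"])
    show "take n (w @ [c]) \<in> NM n" using that(1) len[OF that(1)] by simp
  qed (rule that(2))
  have c1: "card ?S1 = card (NM n)" by (rule card_image) (auto simp: inj_on_def)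
  have c2: "card ?S2 = card (RS n)" by (rule card_image) (auto simp: inj_on_def)
  have ex_hd: "lab (hd w) = k" if wk: "w \<in> exits k n" for w k
  proof -
    obtain t where t: "w = word y t (Suc n)" using wk by (auto simp: exits_def elim: Lg_E)
    then have "run k t (t + int n)" using wk by (simp add: word_exits_iff)
    then show ?thesis using assms runD[of k t "t + int n" t] by (simp add: t hd_word)
  qed
  have c3: "card ?S3 = (\<Sum>k\<in>{1..j}. card (exits k n))"
  proof (rule card_UN_disjoint)
    show "\<forall>i\<in>{1..j}. \<forall>l\<in>{1..j}. i \<noteq> l \<longrightarrow> exits i n \<inter> exits l n = {}"
      using ex_hd by blast
  qed auto
  have bl: "butlast w \<notin> NM n" if "w \<in> ?S3" for w
    using that by (auto simp: exits_def NM_def)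
  have d12: "?S1 \<inter> ?S2 = {}" using g by (fastforce dest: sym)
  have d3: "(?S1 \<union> ?S2) \<inter> ?S3 = {}"
  proof (rule ccontr)
    assume "(?S1 \<union> ?S2) \<inter> ?S3 \<noteq> {}"
    then obtain w where w: "w \<in> ?S1 \<union> ?S2" "w \<in> ?S3" by blast
    then have "butlast w \<in> NM n" using RS_NM by auto
    then show False using bl[OF w(2)] by simp
  qed
  have s3: "?S3 \<subseteq> NM (Suc n)"
  proof
    fix w assume "w \<in> ?S3"
    then obtain k where k: "k \<in> {1..j}" "w \<in> exits k n" by blast
    have ne: "w \<noteq> []" using k by (auto simp: exits_def dest: length_Lg)
    have "\<not> mono_word l w" for l
    proof
      assume l: "mono_word l w"
      then have "lab (hd w) = l" "lab (last w) = l" using ne by (auto simp: mono_word_def)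
      then show False using ex_hd[OF k(2)] k(2) by (auto simp: exits_def)
    qed
    then show "w \<in> NM (Suc n)" using k by (auto simp: NM_def exits_def)
  qed
  have "?S1 \<union> ?S2 \<union> ?S3 \<subseteq> NM (Suc n)"
    using ext_NM f g RS_NM s3 by blast
  then have "card (?S1 \<union> ?S2 \<union> ?S3) \<le> card (NM (Suc n))" by (intro card_mono) auto
  moreover have "card (?S1 \<union> ?S2 \<union> ?S3) = card (?S1 \<union> ?S2) + card ?S3"
    by (rule card_Un_disjoint) (use d3 in auto)
  moreover have "card (?S1 \<union> ?S2) = card ?S1 + card ?S2"
    by (rule card_Un_disjoint) (use d12 in auto)
  ultimately show ?thesis using c1 c2 c3 by simp
qed

lemma NM_growth_j: "n \<ge> 1 \<Longrightarrow> card (NM n) + j \<le> card (NM (Suc n))"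
proof -
  assume n: "n \<ge> 1"
  have "(\<Sum>k\<in>{1..j}. 1) \<le> (\<Sum>k\<in>{1..j}. card (exits k n))"
    by (rule sum_mono) (rule exits_ge_1)
  then show ?thesis using NM_growth[OF n] by simp
qed

text \<open>A word that is not monochromatic is classified by its prefix of length \<open>m\<close> or, when that
  prefix is monochromatic, by the label and the length of the initial run.\<close>
definition kind :: "nat \<Rightarrow> 'b list \<Rightarrow> 'b list + nat \<times> nat" where
  "kind m w = (if \<exists>k\<in>{1..j}. mono_word k (take m w)
     then Inr (lab (w ! 0), LEAST q. lab (w ! q) \<noteq> lab (w ! 0)) else Inl (take m w))"

text \<open>The image of \<open>NM n\<close> under \<open>kind m\<close> contains all of
  \<open>NM m\<close> and all initial runs of length from \<open>m\<close> to \<open>n - 1\<close>,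
  that is, \<open>card (NM m) + j * (n - m)\<close> values. Every \<open>A' p\<close> shares its
  value with \<open>A p\<close>, which is no \<open>A' q\<close>; discarding all the
  \<open>A' p\<close> loses no value, so they are a pure surplus.\<close>

lemma NM_pair_count:
  assumes m: "1 \<le> m" "m \<le> n" and P: "finite P"
    and A: "\<And>p. p \<in> P \<Longrightarrow> A p \<in> NM n" and A': "\<And>p. p \<in> P \<Longrightarrow> A' p \<in> NM n"
    and inj: "inj_on A' P" and ne: "\<And>p q. p \<in> P \<Longrightarrow> q \<in> P \<Longrightarrow> A p \<noteq> A' q"
    and kind: "\<And>p. p \<in> P \<Longrightarrow> kind m (A p) = kind m (A' p)"
  shows "card (NM m) + j * (n - m) + card P \<le> card (NM n)"
proof -
  let ?O = "Inl ` NM m \<union> Inr ` ({1..j} \<times> {m..<n}) :: ('b list + nat \<times> nat) set"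
  have surj: "?O \<subseteq> kind m ` NM n"
  proof
    fix o' assume "o' \<in> ?O"
    then consider v where "v \<in> NM m" "o' = Inl v"
      | k q where "k \<in> {1..j}" "m \<le> q" "q < n" "o' = Inr (k, q)" by auto
    then show "o' \<in> kind m ` NM n"
    proof cases
      case 1
      then obtain t where t: "v = word y t m" by (auto simp: NM_def elim: Lg_E)
      have tk: "take m (word y t n) = v" using m t by (simp add: take_word)
      have "word y t n \<in> NM n" using 1 tk by (intro NM_extend[of m _ n]) simp_all
      moreover have "kind m (word y t n) = Inl v"
        using 1 tk by (auto simp: kind_def NM_def)
      ultimately show ?thesis using 1 by (intro image_eqI[of _ _ "word y t n"]) auto
    next
      case 2
      \<comment> \<open>Starting \<open>q\<close> letters before an exit makes the initial run end
        after exactly \<open>q\<close> letters.\<close>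
      obtain e where e: "run k (e - int q) e" "lab (y e) \<noteq> k" using exists_exit[OF 2(1)] by blast
      let ?w = "word y (e - int q) n"
      have l1: "lab (?w ! i) = k" if "i < q" for i
        using that 2 runD[OF e(1), of "e - int q + int i"] by simp
      have l2: "lab (?w ! q) \<noteq> k" using 2 e by simp
      have l0: "lab (?w ! 0) = k" using l1[of 0] m 2 by simp
      have "mono_word k (take m ?w)"
        using m 2 e by (simp add: take_word mono_word_word run_def)
      moreover have "(LEAST i. lab (?w ! i) \<noteq> k) = q"
        using l1 l2 by (intro Least_equality) (auto simp: not_less[symmetric])
      ultimately have kd: "kind m ?w = Inr (k, q)"
        using 2(1) l0 by (auto simp: kind_def)
      have "?w \<in> NM n"
        unfolding word_NM_iff
      proof
        fix l assume "l \<in> {1..j}"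
        show "\<not> run l (e - int q) (e - int q + int n)"
        proof
          assume r: "run l (e - int q) (e - int q + int n)"
          have "lab (y (e - int q)) = l" "lab (y e) = l"
            using r 2 m by (auto intro!: runD[OF r])
          moreover have "lab (y (e - int q)) = k" using e 2 m by (auto intro!: runD[OF e(1)])
          ultimately show False using e by simp
        qed
      qed
      then show ?thesis using kd 2 by (intro image_eqI[of _ _ ?w]) auto
    qed
  qed
  let ?T = "A' ` P"
  have "?O \<subseteq> kind m ` (NM n - ?T)"
  proof
    fix o' assume "o' \<in> ?O"
    then obtain w where w: "w \<in> NM n" "o' = kind m w" using surj by blast
    show "o' \<in> kind m ` (NM n - ?T)"
    proof (cases "w \<in> ?T")
      case True
      then obtain p where p: "p \<in> P" "w = A' p" by blast
      then have "A p \<in> NM n - ?T" using A ne by blast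
      then show ?thesis using kind[OF p(1)] p w by (intro image_eqI[of _ _ "A p"]) auto
    qed (use w in blast)
  qed
  then have "card ?O \<le> card (NM n - ?T)" by (intro surj_card_le) auto
  also have "\<dots> = card (NM n) - card P"
  proof -
    have "?T \<subseteq> NM n" using A' by blast
    then show ?thesis using P card_image[OF inj] by (simp add: card_Diff_subset)
  qed
  finally have 1: "card ?O \<le> card (NM n) - card P" .
  have "card ?O = card (Inl ` NM m :: ('b list + nat \<times> nat) set) + card (Inr ` ({1..j} \<times> {m..<n}) :: ('b list + nat \<times> nat) set)"
    by (rule card_Un_disjoint) auto
  also have "\<dots> = card (NM m) + j * (n - m)"
    by (simp add: card_image card_cartesian_product)
  finally have 2: "card ?O = card (NM m) + j * (n - m)" .
  have "card P \<le> card (NM n)"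
    using card_mono[of "NM n" ?T] A' card_image[OF inj] by auto
  then show ?thesis using 1 2 by linarith
qed

end

lemma Least_eq_if_agree:
  fixes P R :: "nat \<Rightarrow> bool"
  assumes "P r" and agree: "\<And>q. q \<le> r \<Longrightarrow> P q \<longleftrightarrow> R q"
  shows "(LEAST q. P q) = (LEAST q. R q)"
proof (rule Least_equality)
  have "R r" using assms by simp
  have le: "(LEAST q. R q) \<le> r" using \<open>R r\<close> by (rule Least_le)
  have "R (LEAST q. R q)" using \<open>R r\<close> by (rule LeastI)
  then show "P (LEAST q. R q)" using agree le by simp
  fix q assume "P q"
  show "(LEAST q. R q) \<le> q"
  proof (cases "q \<le> r")
    case True then show ?thesis using agree \<open>P q\<close> by (simp add: Least_le)
  qed (use le in simp)
qed

section \<open>Consequences of a cyclic structure\<close>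

context labelled_sequence
begin

text \<open>The threshold \<open>Q\<close> depends on the label because
  \<open>good_if_entrance\<close> uses \<open>n\<close> for some labels and \<open>n + 1\<close> for
  others.\<close>

definition qend :: "(nat \<Rightarrow> nat) \<Rightarrow> nat \<Rightarrow> int \<Rightarrow> bool" where
  "qend Q k e \<longleftrightarrow> run k (e - int (Q k)) e \<and> lab (y e) \<noteq> k"

text \<open>A visit to \<open>k\<close> is a maximal run of label \<open>k\<close>, and it counts when it has length at least
  \<open>Q k\<close>. In a cyclic structure, a counted visit to \<open>k\<close> is followed by a fixed word of length \<open>d k\<close>
  and then by a counted visit to \<open>\<tau> k\<close>, with no counted visit in between.\<close>
definition cyclic :: "(nat \<Rightarrow> nat) \<Rightarrow> nat \<Rightarrow> (nat \<Rightarrow> 'b list) \<Rightarrow> (nat \<Rightarrow> nat) \<Rightarrow> (nat \<Rightarrow> nat) \<Rightarrow> bool" where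
  "cyclic Q m V d \<tau> \<longleftrightarrow> 1 \<le> m \<and> (\<forall>k\<in>{1..j}. m \<le> Q k) \<and>
     (\<forall>k\<in>{1..j}. \<forall>e. qend Q k e \<longrightarrow> \<tau> k \<in> {1..j} \<and> 1 \<le> d k \<and>
        word y (e - int m + 1) (m - 1 + d k + Q (\<tau> k)) = V k \<and>
        run (\<tau> k) (e + int (d k)) (e + int (d k) + int (Q (\<tau> k))) \<and>
        (\<forall>t. \<forall>l\<in>{1..j}. e \<le> t \<and> t < e + int (d k) \<longrightarrow> \<not> run l t (t + int (Q l))))"

context
  fixes Q m V d \<tau>
  assumes cyc: "cyclic Q m V d \<tau>"
begin

lemma cyc_m: "1 \<le> m" and cyc_Q: "k \<in> {1..j} \<Longrightarrow> m \<le> Q k"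
  using cyc by (auto simp: cyclic_def)

lemma cyc_step:
  assumes "k \<in> {1..j}" "qend Q k e"
  shows "\<tau> k \<in> {1..j}" "1 \<le> d k" "word y (e - int m + 1) (m - 1 + d k + Q (\<tau> k)) = V k"
    "run (\<tau> k) (e + int (d k)) (e + int (d k) + int (Q (\<tau> k)))"
    "\<And>t l. l \<in> {1..j} \<Longrightarrow> e \<le> t \<Longrightarrow> t < e + int (d k) \<Longrightarrow> \<not> run l t (t + int (Q l))"
  using cyc[unfolded cyclic_def, THEN conjunct2, THEN conjunct2, THEN bspec, OF assms(1),
      THEN spec, THEN mp, OF assms(2)] by blast+

lemma ex_qend: assumes "k \<in> {1..j}" shows "\<exists>e>B. qend Q k e"
  using exists_exit[OF assms, of B "Q k"] by (simp add: qend_def)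

lemma tau_in: "k \<in> {1..j} \<Longrightarrow> \<tau> k \<in> {1..j}"
  using ex_qend[of k 0] cyc_step(1) by blast

lemma d_ge: "k \<in> {1..j} \<Longrightarrow> 1 \<le> d k"
  using ex_qend[of k 0] cyc_step(2) by blast

lemma Q_pos: "k \<in> {1..j} \<Longrightarrow> 0 < Q k"
  using cyc_m cyc_Q[of k] by simp

lemma qend_next:
  assumes "l \<in> {1..j}" "run l u (u + int (Q l))"
  obtains e where "u + int (Q l) \<le> e" "run l u e" "qend Q l e"
proof -
  obtain e where e: "u + int (Q l) \<le> e" "run l u e" "lab (y e) \<noteq> l"
    by (rule run_end[OF assms(2)]) auto
  have "run l (e - int (Q l)) e" using e by (intro run_mono[OF e(2)]) auto
  then show ?thesis using e that by (auto simp: qend_def)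
qed

lemma adjacent_labels:
  assumes "k \<in> {1..j}" "l \<in> {1..j}" "lab (y (s - 1)) = k" "lab (y s) = l"
  shows "k = l"
  using adjacent[of "s - 1"] assms by fastforce

text \<open>Take the last counted exit \<open>e\<close> before \<open>s\<close>; the visit that
  follows it starts at \<open>e + d k\<close>. If that were before \<open>s\<close>, this visit
  would yield a later counted exit before \<open>s\<close> or run up to \<open>s\<close>. If it were
  after \<open>s\<close>, the visit at \<open>s\<close> would start inside the connecting word.
  Hence it starts at \<open>s\<close>.\<close>

lemma pred_exists:
  assumes k0: "k0 \<in> {1..j}" "qend Q k0 e0" and s: "e0 < s"
    and l: "l \<in> {1..j}" "run l s (s + int (Q l))" "lab (y (s - 1)) \<noteq> l"
  shows "\<exists>k\<in>{1..j}. \<exists>e. qend Q k e \<and> s = e + int (d k) \<and> \<tau> k = l \<and> e0 \<le> e"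
proof -
  define S where "S = {e. e0 \<le> e \<and> e < s \<and> (\<exists>k\<in>{1..j}. qend Q k e)}"
  have fin: "finite S" by (rule finite_subset[of _ "{e0..s}"]) (auto simp: S_def)
  have "e0 \<in> S" using k0 s by (auto simp: S_def)
  then have "Max S \<in> S" using fin by (intro Max_in) auto
  then obtain k where k: "e0 \<le> Max S" "Max S < s" "k \<in> {1..j}" "qend Q k (Max S)"
    by (auto simp: S_def)
  define e where "e = Max S"
  note st = cyc_step[OF k(3,4), folded e_def]
  let ?u = "e + int (d k)"
  have Ls: "lab (y s) = l" using l Q_pos[OF l(1)] by (intro runD[OF l(2)]) auto
  have "\<not> ?u < s"
  proof
    assume us: "?u < s"
    obtain e' where e': "?u + int (Q (\<tau> k)) \<le> e'" "run (\<tau> k) ?u e'" "qend Q (\<tau> k) e'"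
      by (rule qend_next[OF st(1) st(4)])
    have ee': "e < e'" using e' st(2) by linarith
    consider "e' < s" | "e' = s" | "e' > s" by linarith
    then show False
    proof cases
      case 1
      then have "e' \<in> S" using e' st(1) k ee' by (auto simp: S_def e_def)
      then have "e' \<le> e" unfolding e_def using fin by simp
      then show False using ee' by simp
    next
      case 2
      have "lab (y (s - 1)) = \<tau> k" using us 2 by (intro runD[OF e'(2)]) auto
      then have "\<tau> k = l" using adjacent_labels[OF st(1) l(1) _ Ls] by blast
      then show False using l \<open>lab (y (s - 1)) = \<tau> k\<close> by simp
    next
      case 3
      have "lab (y (s - 1)) = \<tau> k" "lab (y s) = \<tau> k" using us 3 by (auto intro!: runD[OF e'(2)])
      then show False using l Ls by simp
    qed
  qed
  moreover have "\<not> ?u > s"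
    using st(5)[OF l(1), of s] l(2) k(2) by (auto simp: e_def)
  ultimately have us: "?u = s" by simp
  have "lab (y ?u) = \<tau> k" using Q_pos[OF st(1)] by (intro runD[OF st(4)]) auto
  then have "\<tau> k = l" using us Ls by simp
  then show ?thesis using k us by (intro bexI[of _ k] exI[of _ e]) (auto simp: e_def)
qed

text \<open>Every label is entered again after \<open>e0\<close>, and that visit has a predecessor
  by \<open>pred_exists\<close>. On a finite set this makes \<open>\<tau>\<close> a
  permutation.\<close>

lemma tau_surj: "\<tau> ` {1..j} = {1..j}"
proof (intro equalityI subsetI)
  fix l assume l: "l \<in> {1..j}"
  have one: "(1::nat) \<in> {1..j}" using j_ge_2 by simp
  obtain e0 where e0: "qend Q 1 e0" using ex_qend[OF one] by blast
  obtain s where s: "s > e0" "run l s (s + int (Q l))" "lab (y (s - 1)) \<noteq> l"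
    using run_begin[OF l] by blast
  show "l \<in> \<tau> ` {1..j}" using pred_exists[OF one e0 s(1) l s(2,3)] by blast
qed (use tau_in in blast)

lemma tau_inj: "inj_on \<tau> {1..j}"
  by (rule eq_card_imp_inj_on) (simp_all add: tau_surj del: One_nat_def)

text \<open>Otherwise counted visits to \<open>k\<close> would follow one another forever, and a
  later visit to another label \<open>l\<close> would never be reached.\<close>

lemma tau_neq: assumes k: "k \<in> {1..j}" shows "\<tau> k \<noteq> k"
proof
  assume tk: "\<tau> k = k"
  obtain l where l: "l \<in> {1..j}" "l \<noteq> k" by (rule other_label)
  obtain e0 where e0: "qend Q k e0" using ex_qend[OF k] by blast
  obtain s where s: "s > e0" "run l s (s + int (Q l))" "lab (y (s - 1)) \<noteq> l"
    using run_begin[OF l(1)] by blast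
  define S where "S = {e. e0 \<le> e \<and> e < s \<and> qend Q k e}"
  have fin: "finite S" by (rule finite_subset[of _ "{e0..s}"]) (auto simp: S_def)
  have "e0 \<in> S" using e0 s by (auto simp: S_def)
  then have "Max S \<in> S" using fin by (intro Max_in) auto
  then have M: "e0 \<le> Max S" "Max S < s" "qend Q k (Max S)" by (auto simp: S_def)
  define e where "e = Max S"
  note st = cyc_step[OF k M(3), folded e_def, unfolded tk]
  have "e + int (d k) \<le> s" using st(5)[OF l(1), of s] s(2) M(2) by (fastforce simp: e_def)
  obtain e' where e': "e + int (d k) + int (Q k) \<le> e'" "run k (e + int (d k)) e'" "qend Q k e'"
    by (rule qend_next[OF k st(4)])
  have Ls: "lab (y s) = l" using Q_pos[OF l(1)] by (intro runD[OF s(2)]) auto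
  have "\<not> s < e'" using runD[OF e'(2), of s] \<open>e + int (d k) \<le> s\<close> Ls l by auto
  moreover have "e < e'" using e' st(2) by linarith
  moreover have "s \<noteq> e'"
  proof
    assume "s = e'"
    have "lab (y (s - 1)) = k"
      using e'(1) Q_pos[OF k] \<open>s = e'\<close> by (intro runD[OF e'(2)]) auto
    then show False using adjacent_labels[OF k l(1) _ Ls] l by blast
  qed
  ultimately have "e' \<in> S" using e' M by (auto simp: S_def e_def)
  then have "e' \<le> e" unfolding e_def using fin by simp
  then show False using \<open>e < e'\<close> by simp
qed

text \<open>The shortest length of a counted visit to \<open>k\<close>. Visits of this length recur
  (\<open>short_visit\<close>), and every counted exit is preceded by \<open>b k\<close> letters of
  label \<open>k\<close> (\<open>qend_run_b\<close>).\<close>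

definition b :: "nat \<Rightarrow> nat" where
  "b k = (LEAST r. Q k \<le> r \<and> (\<exists>s. run k s (s + int r) \<and> lab (y (s - 1)) \<noteq> k \<and> lab (y (s + int r)) \<noteq> k))"

lemma b_ex:
  assumes k: "k \<in> {1..j}"
  shows "Q k \<le> b k \<and> (\<exists>s. run k s (s + int (b k)) \<and> lab (y (s - 1)) \<noteq> k \<and> lab (y (s + int (b k))) \<noteq> k)"
proof -
  obtain s where s: "run k s (s + int (Q k))" "lab (y (s - 1)) \<noteq> k" using run_begin[OF k] by blast
  obtain e where e: "s + int (Q k) \<le> e" "run k s e" "lab (y e) \<noteq> k" by (rule run_end[OF s(1)]) auto
  have "Q k \<le> nat (e - s) \<and> (\<exists>s. run k s (s + int (nat (e - s'))) \<and> lab (y (s - 1)) \<noteq> k \<and> lab (y (s + int (nat (e - s')))) \<noteq> k)"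
    if "s' = s" for s'
    using that s e by (intro conjI exI[of _ s]) auto
  from this[OF refl] show ?thesis unfolding b_def by (rule LeastI)
qed

lemma b_ge_Q: "k \<in> {1..j} \<Longrightarrow> Q k \<le> b k"
  using b_ex by blast

lemma short_visit:
  assumes k: "k \<in> {1..j}"
  obtains s where "B < s" "run k s (s + int (b k))" "lab (y (s - 1)) \<noteq> k" "lab (y (s + int (b k))) \<noteq> k"
proof -
  obtain s0 where s0: "run k s0 (s0 + int (b k))" "lab (y (s0 - 1)) \<noteq> k" "lab (y (s0 + int (b k))) \<noteq> k"
    using b_ex[OF k] by blast
  obtain t where t: "t > B" "word y t (b k + 2) = word y (s0 - 1) (b k + 2)" using recurs by blast
  note eq = word_eqD[OF t(2)]
  have "run k (t + 1) (t + 1 + int (b k))"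
    using run_cong[OF t(2)[symmetric], of k 1 "1 + int (b k)"] s0 by (simp add: add.assoc)
  moreover have "lab (y t) \<noteq> k" using eq[of 0] s0 by simp
  moreover have "lab (y (t + 1 + int (b k))) \<noteq> k" using eq[of "1 + int (b k)"] s0 by (simp add: add.assoc)
  ultimately show ?thesis using t by (intro that[of "t + 1"]) auto
qed

lemma qend_run_b:
  assumes k: "k \<in> {1..j}" and e: "qend Q k e"
  shows "run k (e - int (b k)) e"
proof (rule ccontr)
  assume "\<not> run k (e - int (b k)) e"
  define S where "S = {i. e - int (b k) \<le> i \<and> i < e \<and> lab (y i) \<noteq> k}"
  have fin: "finite S" by (rule finite_subset[of _ "{e - int (b k)..e}"]) (auto simp: S_def)
  have "S \<noteq> {}" using \<open>\<not> run k _ e\<close> by (auto simp: S_def run_def)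
  then have M: "Max S \<in> S" using fin by (intro Max_in) auto
  define i where "i = Max S"
  have i: "e - int (b k) \<le> i" "i < e" "lab (y i) \<noteq> k" using M by (auto simp: S_def i_def)
  have r: "run k (i + 1) e"
  proof (rule runI)
    fix u assume u: "i + 1 \<le> u" "u < e"
    have "u \<notin> S"
    proof
      assume "u \<in> S" then have "u \<le> i" unfolding i_def using fin by simp
      then show False using u by simp
    qed
    then show "lab (y u) = k" using u i by (auto simp: S_def)
  qed
  have "i < e - int (Q k)"
  proof (rule ccontr)
    assume "\<not> i < e - int (Q k)"
    then have "lab (y i) = k" using e i by (intro runD[of k "e - int (Q k)" e]) (auto simp: qend_def)
    then show False using i by simp
  qed
  then have "b k \<le> nat (e - 1 - i)"
    unfolding b_def using r i e
    by (intro Least_le conjI exI[of _ "i + 1"]) (auto simp: qend_def)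
  then show False using i by linarith
qed

text \<open>A window that starts \<open>s\<close> letters before a counted visit, inside the preceding counted visit or
  after it, determines both \<open>s\<close> and the visit.\<close>
lemma window_inj:
  assumes k: "k \<in> {1..j}" "qend Q k e" and s: "1 \<le> s" "s \<le> d k + b k"
    and n: "Q k \<le> n" "s + Q (\<tau> k) \<le> n" 
    and k': "k' \<in> {1..j}" "qend Q k' e'" and s': "1 \<le> s'" "s' \<le> d k' + b k'"
    and n': "Q k' \<le> n" "s' + Q (\<tau> k') \<le> n" 
    and eq: "word y (e + int (d k) - int s) n = word y (e' + int (d k') - int s') n"
  shows "k = k' \<and> s = s'"
proof -
  have lab_eq: "lab (y (e + int (d k) - int s + i)) = lab (y (e' + int (d k') - int s' + i))"
    if "0 \<le> i" "i < int n" for i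
    using word_eqD[OF eq that] by simp
  have first: "run k (e + int (d k) - int s) e"
    if "k \<in> {1..j}" "qend Q k e" "s \<le> d k + b k" for k e s
    using qend_run_b[OF that(1,2)] that(3) by (intro run_mono[OF qend_run_b[OF that(1,2)]]) auto
  \<comment> \<open>If the window starts with fewer than \<open>Q k\<close> letters of the visit to
    \<open>k\<close>, the first run of threshold length that starts in it is the visit to
    \<open>\<tau> k\<close>.\<close>
  have none: "\<not> run l t (t + int (Q l))"
    if "k \<in> {1..j}" "qend Q k e" "1 \<le> s" "s \<le> d k + b k" "s < d k + Q k" "l \<in> {1..j}"
      "e + int (d k) - int s \<le> t" "t < e + int (d k)" for k e s l t
  proof (cases "e \<le> t")
    case True then show ?thesis using cyc_step(5)[OF that(1,2,6)] that(8) by blast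
  next
    case False
    show ?thesis
    proof
      assume r: "run l t (t + int (Q l))"
      have "lab (y t) = k" using False that(7) by (intro runD[OF first[OF that(1,2,4)]]) auto
      moreover have "lab (y t) = l" using Q_pos[OF that(6)] by (intro runD[OF r]) auto
      ultimately have "l = k" by simp
      moreover have "lab (y e) = l"
        using False that \<open>l = k\<close> by (intro runD[OF r]) auto
      ultimately show False using that(2) by (simp add: qend_def)
    qed
  qed
  \<comment> \<open>A window that starts with \<open>Q k\<close> letters of its counted visit cannot
    equal one that starts with less than a threshold run, by \<open>none\<close>.\<close>
  have mixed: "\<not> s' < d k' + Q k'"
    if "k \<in> {1..j}" "qend Q k e" "s \<le> d k + b k" "d k + Q k \<le> s" "Q k \<le> n"
      "k' \<in> {1..j}" "qend Q k' e'" "1 \<le> s'" "s' \<le> d k' + b k'"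
      "word y (e + int (d k) - int s) n = word y (e' + int (d k') - int s') n" for k e s k' e' s'
  proof
    assume lt: "s' < d k' + Q k'"
    have "run k (e + int (d k) - int s + 0) (e + int (d k) - int s + int (Q k))"
      using that(4) by (intro run_mono[OF first[OF that(1,2,3)]]) auto
    from run_cong[OF that(10) this] have "run k (e' + int (d k') - int s') (e' + int (d k') - int s' + int (Q k))"
      using that(5) by simp
    then show False using none[OF that(6,7,8,9) lt that(1), of "e' + int (d k') - int s'"] that(8) by simp
  qed
  \<comment> \<open>With both starts inside a counted visit to \<open>k\<close>, the exit is at
    \<open>s - d k\<close> in one window and at \<open>s' - d k\<close> in the other, so it reveals
    the offset.\<close>
  have len: "\<not> s < s'"
    if "k \<in> {1..j}" "qend Q k e" "1 \<le> s" "s \<le> d k + b k" "d k + Q k \<le> s" "s + Q (\<tau> k) \<le> n"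
      "k \<in> {1..j}" "qend Q k e'" "s' \<le> d k + b k" 
      "word y (e + int (d k) - int s) n = word y (e' + int (d k) - int s') n" for k e s e' s'
  proof
    assume lt: "s < s'"
    let ?q = "int s - int (d k)"
    have "y (e + int (d k) - int s + ?q) = y (e' + int (d k) - int s' + ?q)"
      using that(5,6) Q_pos[OF tau_in[OF that(1)]] by (intro word_eqD[OF that(10)]) auto
    moreover have "lab (y (e' + int (d k) - int s' + ?q)) = k"
      using lt that(5) by (intro runD[OF first[OF that(7,8,9)]]) auto
    ultimately show False using that(2) by (simp add: qend_def)
  qed
  have nolt: "\<not> s < s'"
    if "k \<in> {1..j}" "qend Q k e" "1 \<le> s" "s + Q (\<tau> k) \<le> n"
      "k' \<in> {1..j}" "qend Q k' e'" "1 \<le> s'" "s' \<le> d k' + b k'" "s' < d k' + Q k'"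
      "word y (e + int (d k) - int s) n = word y (e' + int (d k') - int s') n" for k e s k' e' s'
  proof
    assume lt: "s < s'"
    have "run (\<tau> k) (e + int (d k) - int s + int s) (e + int (d k) - int s + (int s + int (Q (\<tau> k))))"
      using cyc_step(4)[OF that(1,2)] by (simp add: algebra_simps)
    from run_cong[OF that(10) this]
    have "run (\<tau> k) (e' + int (d k') - int s' + int s) (e' + int (d k') - int s' + int s + int (Q (\<tau> k)))"
      using that(4) by (simp add: add.assoc)
    then show False
      using none[OF that(5-9) tau_in[OF that(1)], of "e' + int (d k') - int s' + int s"] lt by auto
  qed
  show ?thesis
  proof (cases "s < d k + Q k")
    case True
    have T': "s' < d k' + Q k'" using mixed[OF k' s'(2) _ n'(1) k s eq[symmetric]] True by force
    have ss: "s = s'"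
      using nolt[OF k s(1) n(2) k' s' T' eq] nolt[OF k' s'(1) n'(2) k s True eq[symmetric]] by simp
    have "lab (y (e + int (d k) - int s + int s)) = lab (y (e' + int (d k') - int s' + int s))"
      using n(2) Q_pos[OF tau_in[OF k(1)]] by (intro lab_eq) auto
    moreover have "lab (y (e + int (d k))) = \<tau> k"
      using Q_pos[OF tau_in[OF k(1)]] by (intro runD[OF cyc_step(4)[OF k]]) auto
    moreover have "lab (y (e' + int (d k'))) = \<tau> k'"
      using Q_pos[OF tau_in[OF k'(1)]] by (intro runD[OF cyc_step(4)[OF k']]) auto
    ultimately have "\<tau> k = \<tau> k'" using ss by simp
    then show ?thesis using ss tau_inj k k' by (auto dest: inj_onD)
  next
    case False
    then have T': "d k' + Q k' \<le> s'" using mixed[OF k s(2) _ n(1) k' s' eq] by force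
    have "lab (y (e + int (d k) - int s + 0)) = lab (y (e' + int (d k') - int s' + 0))"
      using n(1) Q_pos[OF k(1)] by (intro lab_eq) auto
    moreover have "lab (y (e + int (d k) - int s)) = k"
      using False Q_pos[OF k(1)] by (intro runD[OF first[OF k s(2)]]) auto
    moreover have "lab (y (e' + int (d k') - int s')) = k'"
      using T' Q_pos[OF k'(1)] by (intro runD[OF first[OF k' s'(2)]]) auto
    ultimately have kk: "k = k'" by simp
    have "\<not> s < s'"
      using len[OF k s _ n(2) k(1), of e' s'] False k' s' eq kk by simp
    moreover have "\<not> s' < s"
      using len[OF k' s' T' n'(2) k'(1), of e s] k s eq kk by simp
    ultimately show ?thesis using kk by simp
  qed
qed

text \<open>For two consecutive labels \<open>k\<close>, windows that start before a visit to
  \<open>\<tau> k\<close> of the shortest length are compared with windows that start before one of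
  length at least \<open>n\<close>. They have the same \<open>kind\<close> and differ at the end of
  the short visit. One label gives only \<open>d k + b k\<close> pairs, but two give at least
  \<open>n\<close>, and \<open>NM_pair_count\<close> turns these into the surplus
  \<open>n\<close>.\<close>

lemma cyclic_growth: "\<exists>n\<ge>m. n + j * n + card (NM m) \<le> card (NM n) + j * m"
proof -
  define k1 where "k1 = (ARG_MAX b k. k \<in> {1..j})"
  have one: "(1::nat) \<in> {1..j}" using j_ge_2 by simp
  have k1: "k1 \<in> {1..j}" and k1max: "\<And>k. k \<in> {1..j} \<Longrightarrow> b k \<le> b k1"
  proof -
    have "is_arg_max b (\<lambda>k. k \<in> {1..j}) k1"
      unfolding k1_def arg_max_def
    proof (rule someI_ex)
      have "Max (b ` {1..j}) \<in> b ` {1..j}" using one by (intro Max_in) auto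
      then obtain k where "k \<in> {1..j}" "b k = Max (b ` {1..j})" by auto
      then show "\<exists>k. is_arg_max b (\<lambda>k. k \<in> {1..j}) k"
        by (intro exI[of _ k]) (auto simp: is_arg_max_linorder)
    qed
    then show "k1 \<in> {1..j}" "\<And>k. k \<in> {1..j} \<Longrightarrow> b k \<le> b k1"
      by (auto simp: is_arg_max_linorder)
  qed
  define k2 where "k2 = \<tau> k1"
  have k2: "k2 \<in> {1..j}" and k12: "k1 \<noteq> k2"
    using tau_in[OF k1] tau_neq[OF k1] by (simp_all add: k2_def)
  \<comment> \<open>Maximality of \<open>b k1\<close> gives \<open>b (\<tau> k2) \<le> b k1\<close>.
    So for \<open>k1\<close> and \<open>k2\<close> alike, a window that starts up to
    \<open>d k + b k\<close> letters before a visit of length \<open>b (\<tau> k)\<close> sees the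
    letter after that visit. The number of pairs, the sum of both \<open>d k + b k\<close>, still
    reaches \<open>n\<close> because the smaller \<open>d\<close> is at least
    \<open>1\<close>.\<close>
  define n where "n = b k1 + b k2 + max (d k1) (d k2) + 1"
  have K: "k \<in> {1..j}" if "k \<in> {k1, k2}" for k using that k1 k2 by auto
  have nk: "d k + b k + b (\<tau> k) < n" if "k \<in> {k1, k2}" for k
    using that k1max[OF tau_in[OF k2]] by (auto simp: n_def k2_def)
  have mn: "m \<le> n" using cyc_Q[OF k1] b_ge_Q[OF k1] by (simp add: n_def)
  obtain e0 where e0: "qend Q 1 e0" using ex_qend[OF one] by blast
  have "\<exists>e. qend Q k e \<and> lab (y (e + int (d k) + int (b (\<tau> k)))) \<noteq> \<tau> k" if "k \<in> {1..j}" for k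
  proof -
    note tk = tau_in[OF that]
    obtain s where s: "e0 < s" "run (\<tau> k) s (s + int (b (\<tau> k)))" "lab (y (s - 1)) \<noteq> \<tau> k"
      "lab (y (s + int (b (\<tau> k)))) \<noteq> \<tau> k" by (rule short_visit[OF tk])
    have "run (\<tau> k) s (s + int (Q (\<tau> k)))"
      using b_ge_Q[OF tk] by (intro run_mono[OF s(2)]) auto
    from pred_exists[OF one e0 s(1) tk this s(3)] obtain k' e where
      k': "k' \<in> {1..j}" "qend Q k' e" "s = e + int (d k')" "\<tau> k' = \<tau> k" by blast
    have "k' = k" using inj_onD[OF tau_inj k'(4) k'(1) \<open>k \<in> {1..j}\<close>] .
    then show ?thesis using k' s by (intro exI[of _ e]) auto
  qed
  then obtain sh where sh: "\<And>k. k \<in> {1..j} \<Longrightarrow> qend Q k (sh k)"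
    "\<And>k. k \<in> {1..j} \<Longrightarrow> lab (y (sh k + int (d k) + int (b (\<tau> k)))) \<noteq> \<tau> k" by metis
  have "\<exists>e. qend Q k e \<and> run (\<tau> k) (e + int (d k)) (e + int (d k) + int n)" if "k \<in> {1..j}" for k
  proof -
    note tk = tau_in[OF that]
    obtain s where s: "e0 < s" "run (\<tau> k) s (s + int (n + Q (\<tau> k)))" "lab (y (s - 1)) \<noteq> \<tau> k"
      using run_begin[OF tk] by blast
    have "run (\<tau> k) s (s + int (Q (\<tau> k)))" by (intro run_mono[OF s(2)]) auto
    from pred_exists[OF one e0 s(1) tk this s(3)] obtain k' e where
      k': "k' \<in> {1..j}" "qend Q k' e" "s = e + int (d k')" "\<tau> k' = \<tau> k" by blast
    have "k' = k" using inj_onD[OF tau_inj k'(4) k'(1) \<open>k \<in> {1..j}\<close>] .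
    then show ?thesis using k' s by (intro exI[of _ e] conjI run_mono[OF s(2)]) auto
  qed
  then obtain lo where lo: "\<And>k. k \<in> {1..j} \<Longrightarrow> qend Q k (lo k)"
    "\<And>k. k \<in> {1..j} \<Longrightarrow> run (\<tau> k) (lo k + int (d k)) (lo k + int (d k) + int n)" by metis
  define P where "P = Sigma {k1, k2} (\<lambda>k. {1..d k + b k})"
  define A where "A p = word y (sh (fst p) + int (d (fst p)) - int (snd p)) n" for p
  define A' where "A' p = word y (lo (fst p) + int (d (fst p)) - int (snd p)) n" for p
  have Pn: "fst p \<in> {1..j}" "1 \<le> snd p" "snd p \<le> d (fst p) + b (fst p)" "Q (fst p) \<le> n"
    "snd p + Q (\<tau> (fst p)) \<le> n" "snd p + b (\<tau> (fst p)) < n" if "p \<in> P" for p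
  proof -
    have p: "fst p \<in> {k1, k2}" "1 \<le> snd p" "snd p \<le> d (fst p) + b (fst p)"
      using that by (auto simp: P_def)
    show "fst p \<in> {1..j}" "1 \<le> snd p" "snd p \<le> d (fst p) + b (fst p)" using p K by auto
    show "Q (fst p) \<le> n" "snd p + Q (\<tau> (fst p)) \<le> n" "snd p + b (\<tau> (fst p)) < n"
      using p nk[OF p(1)] b_ge_Q[OF K[OF p(1)]] b_ge_Q[OF tau_in[OF K[OF p(1)]]] by linarith+
  qed
  have finP: "finite P" by (simp add: P_def)
  have cardP: "card P = d k1 + b k1 + d k2 + b k2"
    using k12 by (simp add: P_def)
  \<comment> \<open>Label \<open>\<tau> k\<close> at this position would let a counted run start
    inside the connecting word.\<close>
  have before: "lab (y (e + int (d k) - 1)) = 0" if "k \<in> {1..j}" "qend Q k e" for k e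
  proof -
    note st = cyc_step[OF that]
    have 1: "lab (y (e + int (d k))) = \<tau> k" using Q_pos[OF st(1)] by (intro runD[OF st(4)]) auto
    have "lab (y (e + int (d k) - 1)) \<noteq> \<tau> k"
    proof
      assume 2: "lab (y (e + int (d k) - 1)) = \<tau> k"
      have "run (\<tau> k) (e + int (d k) - 1) (e + int (d k) - 1 + int (Q (\<tau> k)))"
      proof (rule runI)
        fix i assume "e + int (d k) - 1 \<le> i" "i < e + int (d k) - 1 + int (Q (\<tau> k))"
        then show "lab (y i) = \<tau> k" using 2 runD[OF st(4), of i] by (cases "i = e + int (d k) - 1") auto
      qed
      then show False using st(5)[OF st(1), of "e + int (d k) - 1"] st(2) by simp
    qed
    then show ?thesis using label_before_start[OF st(1) 1] by simp
  qed
  have in_NM: "word y (e + int (d k) - int s) n \<in> NM n"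
    if "k \<in> {1..j}" "qend Q k e" "1 \<le> s" "s \<le> n" for k e s
    unfolding word_NM_iff
  proof
    fix l assume l: "l \<in> {1..j}"
    show "\<not> run l (e + int (d k) - int s) (e + int (d k) - int s + int n)"
    proof
      assume r: "run l (e + int (d k) - int s) (e + int (d k) - int s + int n)"
      have "lab (y (e + int (d k) - 1)) = l" using that by (intro runD[OF r]) auto
      then show False using before[OF that(1,2)] l by simp
    qed
  qed
  have Akind: "kind m (A p) = kind m (A' p)" if p: "p \<in> P" for p
  proof -
    define k s where "k = fst p" and "s = snd p"
    note pn = Pn[OF p, folded k_def s_def]
    note qs = sh(1)[OF pn(1)] and ql = lo(1)[OF pn(1)]
    have runs: "run k (sh k + int (d k) - int s) (sh k)" "run k (lo k + int (d k) - int s) (lo k)"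
      using pn(3) by (auto intro: run_mono[OF qend_run_b[OF pn(1) qs]] run_mono[OF qend_run_b[OF pn(1) ql]])
    have V: "y (sh k + i) = y (lo k + i)" if "- int m < i" "i < int (d k) + int (Q (\<tau> k))" for i
    proof -
      have "word y (sh k - int m + 1) (m - 1 + d k + Q (\<tau> k)) = word y (lo k - int m + 1) (m - 1 + d k + Q (\<tau> k))"
        using cyc_step(3)[OF pn(1) qs] cyc_step(3)[OF pn(1) ql] by simp
      from word_eqD[OF this, of "i + int m - 1"] show ?thesis using that cyc_m by (simp add: algebra_simps)
    qed
    let ?w = "A p" and ?w' = "A' p"
    have nth: "?w ! i = y (sh k + int (d k) - int s + int i)" "?w' ! i = y (lo k + int (d k) - int s + int i)"
      if "i < n" for i using that by (simp_all add: A_def A'_def k_def s_def)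
    \<comment> \<open>If the window starts with \<open>m\<close> letters of label \<open>k\<close>,
      its kind is that label and the distance \<open>s - d k\<close> to the exit, the same for both.
      Otherwise it starts at most \<open>m - 1\<close> letters before the exit, where the fixed word
      \<open>V k\<close> has begun. Then both windows agree up to \<open>Q (\<tau> k)\<close>
      letters into the next visit, and an initial monochromatic run ends earlier because the letter
      before that visit has label \<open>0\<close>.\<close>
    show ?thesis
    proof (cases "d k + m \<le> s")
      case True
      let ?q = "s - d k"
      have qn: "?q < n" and q1: "m \<le> ?q" using True pn cyc_m by linarith+
      have "lab (?w ! i) = k" "lab (?w' ! i) = k" if "i < ?q" for i
        using that qn nth[of i] runD[OF runs(1), of "sh k + int (d k) - int s + int i"]
          runD[OF runs(2), of "lo k + int (d k) - int s + int i"] by auto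
      note lt = this
      have "lab (?w ! ?q) \<noteq> k" "lab (?w' ! ?q) \<noteq> k"
        using nth[OF qn] qs ql True by (auto simp: qend_def of_nat_diff)
      note at = this
      have L: "(LEAST i. lab (?w ! i) \<noteq> k) = ?q" "(LEAST i. lab (?w' ! i) \<noteq> k) = ?q"
        using lt at by (intro Least_equality; force simp: not_less[symmetric])+
      have l0: "lab (?w ! 0) = k" "lab (?w' ! 0) = k" using lt[of 0] q1 cyc_m by auto
      have "take m ?w = word y (sh k + int (d k) - int s) m" "take m ?w' = word y (lo k + int (d k) - int s) m"
        using mn by (simp_all add: A_def A'_def k_def s_def take_word)
      moreover have "run k (sh k + int (d k) - int s) (sh k + int (d k) - int s + int m)"
        "run k (lo k + int (d k) - int s) (lo k + int (d k) - int s + int m)"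
        using True by (auto intro: run_mono[OF runs(1)] run_mono[OF runs(2)])
      ultimately have "mono_word k (take m ?w)" "mono_word k (take m ?w')"
        by (simp_all add: mono_word_word)
      then show ?thesis using pn(1) L l0 by (auto simp: kind_def)
    next
      case False
      have agree: "?w ! i = ?w' ! i" if "i < s + Q (\<tau> k)" for i
      proof -
        have "i < n" using that pn by linarith
        moreover have "y (sh k + (int (d k) - int s + int i)) = y (lo k + (int (d k) - int s + int i))"
          using that False by (intro V) auto
        ultimately show ?thesis using nth[of i] by (simp add: algebra_simps)
      qed
      have mQ: "m \<le> Q (\<tau> k)" using cyc_Q[OF tau_in[OF pn(1)]] .
      have tk: "take m ?w = take m ?w'"
      proof (rule nth_equalityI)
        show "length (take m ?w) = length (take m ?w')" by (simp add: A_def A'_def)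
        fix i assume "i < length (take m ?w)"
        then have "i < m" by simp
        then show "take m ?w ! i = take m ?w' ! i" using agree[of i] mQ by simp
      qed
      show ?thesis
      proof (cases "\<exists>l\<in>{1..j}. mono_word l (take m ?w)")
        case mono: True
        then obtain l where l: "l \<in> {1..j}" "mono_word l (take m ?w)" by blast
        have l0: "?w ! 0 = ?w' ! 0" using agree[of 0] pn by simp
        have "?w ! 0 \<in> set (take m ?w)"
          using cyc_m mn by (auto simp: in_set_conv_nth A_def intro!: exI[of _ 0])
        then have "lab (?w ! 0) = l" using l by (auto simp: mono_word_def)
        moreover have "lab (?w ! (s - 1)) = 0"
        proof -
          have "s - 1 < n" using pn by linarith
          then show ?thesis using nth(1)[of "s - 1"] pn(2) before[OF pn(1) qs]
            by (simp add: of_nat_diff algebra_simps)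
        qed
        ultimately have "lab (?w ! (s - 1)) \<noteq> lab (?w ! 0)" using l by simp
        then have "(LEAST q. lab (?w ! q) \<noteq> lab (?w ! 0)) = (LEAST q. lab (?w' ! q) \<noteq> lab (?w ! 0))"
        proof (rule Least_eq_if_agree)
          fix q assume "q \<le> s - 1"
          then have "q < s + Q (\<tau> k)" using pn(2) by linarith
          from agree[OF this] show "(lab (?w ! q) \<noteq> lab (?w ! 0)) = (lab (?w' ! q) \<noteq> lab (?w ! 0))" by simp
        qed
        then show ?thesis using tk l0 by (simp add: kind_def)
      next
        case False
        then show ?thesis using tk by (simp add: kind_def)
      qed
    qed
  qed
  have "card (NM m) + j * (n - m) + card P \<le> card (NM n)"
  proof (rule NM_pair_count[OF cyc_m mn finP])
    fix p assume p: "p \<in> P"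
    show "A p \<in> NM n" "A' p \<in> NM n"
      unfolding A_def A'_def using Pn[OF p] sh(1) lo(1) by (auto intro!: in_NM)
    show "kind m (A p) = kind m (A' p)" by (rule Akind[OF p])
  next
    show "inj_on A' P"
    proof (rule inj_onI)
      fix p q assume pq: "p \<in> P" "q \<in> P" "A' p = A' q"
      note a = Pn[OF pq(1)] and c = Pn[OF pq(2)]
      have "fst p = fst q \<and> snd p = snd q"
        by (rule window_inj[OF a(1) lo(1)[OF a(1)] a(2-5) c(1) lo(1)[OF c(1)] c(2-5)])
          (use pq(3) in \<open>simp add: A'_def\<close>)
      then show "p = q" by (simp add: prod_eq_iff)
    qed
  next
    fix p q assume pq: "p \<in> P" "q \<in> P"
    note a = Pn[OF pq(1)] and c = Pn[OF pq(2)]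
    show "A p \<noteq> A' q"
    proof
      assume eq: "A p = A' q"
      have "fst p = fst q \<and> snd p = snd q"
        by (rule window_inj[OF a(1) sh(1)[OF a(1)] a(2-5) c(1) lo(1)[OF c(1)] c(2-5)])
          (use eq in \<open>simp add: A_def A'_def\<close>)
      then have qp: "q = p" by (simp add: prod_eq_iff)
      define k s where "k = fst p" and "s = snd p"
      have "word y (sh k + int (d k) - int s) n = word y (lo k + int (d k) - int s) n"
        using eq by (simp add: qp A_def A'_def k_def s_def)
      from word_eqD[OF this, of "int s + int (b (\<tau> k))"] a(6)
      have "y (sh k + int (d k) + int (b (\<tau> k))) = y (lo k + int (d k) + int (b (\<tau> k)))"
        by (simp add: k_def s_def algebra_simps)
      moreover have "lab (y (lo k + int (d k) + int (b (\<tau> k)))) = \<tau> k"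
        using a by (intro runD[OF lo(2)]) (auto simp: k_def)
      ultimately show False using sh(2)[OF a(1)] by (simp add: k_def)
    qed
  qed
  then have *: "card (NM m) + j * (n - m) + (d k1 + b k1 + d k2 + b k2) \<le> card (NM n)"
    by (simp only: cardP)
  have "d k1 + b k1 + d k2 + b k2 \<ge> n"
    using d_ge[OF k1] d_ge[OF k2] by (simp add: n_def max_def)
  moreover have "j * n = j * (n - m) + j * m" using mn by (metis add_mult_distrib2 le_add_diff_inverse2)
  ultimately show ?thesis using * mn by (intro exI[of _ n] conjI) linarith+
qed

end

end

section \<open>Cyclic structures from slow growth\<close>

context labelled_sequence
begin

text \<open>By \<open>D1\<close> all counted exits of \<open>k\<close> look alike on the
  \<open>p\<close> letters that end with the exit letter. From there \<open>D2\<close> forces letter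
  after letter until the next run of threshold length is complete, so the route from
  \<open>k\<close> to the next counted visit is always the same.\<close>

lemma deterministic_cyclic:
  assumes m: "1 \<le> m" "m \<le> p" and Q: "\<And>k. k \<in> {1..j} \<Longrightarrow> m \<le> Q k \<and> Q k \<le> p"
    and D1: "\<And>k e e'. k \<in> {1..j} \<Longrightarrow> qend Q k e \<Longrightarrow> qend Q k e' \<Longrightarrow>
      word y (e - int p + 1) p = word y (e' - int p + 1) p"
    and D2: "\<And>t t'. word y t p = word y t' p \<Longrightarrow>
      \<forall>l\<in>{1..j}. \<not> run l (t + int p - int (Q l)) (t + int p) \<Longrightarrow> y (t + int p) = y (t' + int p)"
  shows "\<exists>V d \<tau>. cyclic Q m V d \<tau>"
proof -
  have Qpos: "0 < Q k" if "k \<in> {1..j}" for k using Q[OF that] m by simp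
  define C where "C k Vk dk tk \<longleftrightarrow> (\<forall>e. qend Q k e \<longrightarrow> tk \<in> {1..j} \<and> 1 \<le> dk \<and>
        word y (e - int m + 1) (m - 1 + dk + Q tk) = Vk \<and>
        run tk (e + int dk) (e + int dk + int (Q tk)) \<and>
        (\<forall>t. \<forall>l\<in>{1..j}. e \<le> t \<and> t < e + int dk \<longrightarrow> \<not> run l t (t + int (Q l))))"
    for k Vk dk tk
  have main: "\<exists>Vk dk tk. C k Vk dk tk"
    if k: "k \<in> {1..j}" for k
  proof -
    obtain e0 where e0: "qend Q k e0" using exists_exit[OF k, of 0 "Q k"] by (auto simp: qend_def)
    define S where "S d \<longleftrightarrow> (\<exists>l\<in>{1..j}. run l (e0 + int d) (e0 + int d + int (Q l)))" for d
    obtain s where s: "s > e0" "run k s (s + int (Q k))" using run_far[OF k] by blast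
    have "S (nat (s - e0))" using s k by (auto simp: S_def)
    then have Sd: "S (LEAST d. S d)" by (rule LeastI)
    define d where "d = (LEAST d. S d)"
    have dmin: "d \<le> d'" if "S d'" for d' using that unfolding d_def by (rule Least_le)
    obtain l where l: "l \<in> {1..j}" "run l (e0 + int d) (e0 + int d + int (Q l))"
      using Sd by (auto simp: S_def d_def)
    have "lab (y (e0 - 1)) = k"
      using e0 Qpos[OF k] by (auto simp: qend_def intro!: runD[of k "e0 - int (Q k)" e0])
    then have L0: "lab (y e0) = 0" using e0 k by (intro label_after_exit[of k]) (auto simp: qend_def)
    have Ld: "lab (y (e0 + int d)) = l" using Qpos[OF l(1)] by (intro runD[OF l(2)]) auto
    have d1: "1 \<le> d"
    proof (rule ccontr)
      assume "\<not> 1 \<le> d" then have "d = 0" by simp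
      then show False using Ld L0 l by simp
    qed
    have Lpre: "lab (y (e0 + int d - 1)) = 0"
    proof -
      have "lab (y (e0 + int d - 1)) \<noteq> l"
      proof
        assume a: "lab (y (e0 + int d - 1)) = l"
        have "run l (e0 + int (d - 1)) (e0 + int (d - 1) + int (Q l))"
        proof (rule runI)
          fix i assume "e0 + int (d - 1) \<le> i" "i < e0 + int (d - 1) + int (Q l)"
          then show "lab (y i) = l" using a d1 runD[OF l(2), of i]
            by (cases "i = e0 + int d - 1") auto
        qed
        then have "S (d - 1)" using l(1) by (auto simp: S_def)
        then show False using dmin[of "d - 1"] d1 by simp
      qed
      then show ?thesis using label_before_start[OF l(1) Ld] by simp
    qed
    have grow: "word y (e0 - int p + 1) N = word y (e - int p + 1) N"
      if e: "qend Q k e" and N: "p \<le> N" "N \<le> p - 1 + d + Q l" for e N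
      using N
    proof (induction N rule: nat_induct_at_least)
      case base
      show ?case by (rule D1[OF k e0 e])
    next
      case (Suc N)
      have IH: "word y (e0 - int p + 1) N = word y (e - int p + 1) N" using Suc by simp
      define i where "i = int N - int p"
      have i: "0 \<le> i" "i + 1 < int d + int (Q l)" using Suc m by (auto simp: i_def)
      have "y (e0 + i + 1 - int p + int p) = y (e + i + 1 - int p + int p)"
      proof (rule D2)
        show "word y (e0 + i + 1 - int p) p = word y (e + i + 1 - int p) p"
          using subword_eq[OF IH, of "e0 + i + 1 - int p" p] i by (simp add: i_def algebra_simps)
        \<comment> \<open>A run of threshold length ending here would start after \<open>e0\<close>,
          whose label is \<open>0\<close>, and by minimality of \<open>d\<close> not before
          \<open>e0 + d\<close>. There the label is \<open>l\<close>, and the run of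
          \<open>l\<close> is not yet complete.\<close>
        show "\<forall>l\<in>{1..j}. \<not> run l (e0 + i + 1 - int p + int p - int (Q l)) (e0 + i + 1 - int p + int p)"
        proof (intro ballI notI)
          fix l' assume l': "l' \<in> {1..j}"
            and "run l' (e0 + i + 1 - int p + int p - int (Q l')) (e0 + i + 1 - int p + int p)"
          then have r: "run l' (e0 + i + 1 - int (Q l')) (e0 + i + 1)" by simp
          let ?s = "e0 + i + 1 - int (Q l')"
          have sl: "lab (y ?s) = l'" using Qpos[OF l'] by (intro runD[OF r]) auto
          show False
          proof (cases "?s < e0")
            case True
            then have "lab (y e0) = l'" using i by (intro runD[OF r]) auto
            then show False using L0 l' by simp
          next
            case False
            then have eq: "e0 + int (nat (?s - e0)) = ?s" by simp
            have "run l' ?s (?s + int (Q l'))" using r by simp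
            then have "S (nat (?s - e0))" unfolding S_def eq using l' by blast
            then have ds: "int d \<le> ?s - e0" using dmin[of "nat (?s - e0)"] False by linarith
            then have "lab (y ?s) = l" using i by (intro runD[OF l(2)]) auto
            then have "l' = l" using sl by simp
            then show False using ds i by simp
          qed
        qed
      qed
      then have "y (e0 - int p + 1 + int N) = y (e - int p + 1 + int N)"
        by (simp add: i_def algebra_simps)
      then show ?case using IH by (simp add: word_Suc)
    qed
    have agree: "y (e0 + i) = y (e + i)"
      if e: "qend Q k e" and i: "- int p < i" "i < int d + int (Q l)" for e i
    proof -
      have "p \<le> p - 1 + d + Q l" using d1 Qpos[OF l(1)] by simp
      from word_eqD[OF grow[OF e this order_refl], of "i + int p - 1"] show ?thesis
        using i m by (simp add: algebra_simps of_nat_diff)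
    qed
    show ?thesis
      unfolding C_def
    proof (rule exI[of _ "word y (e0 - int m + 1) (m - 1 + d + Q l)"], rule exI[of _ d],
        rule exI[of _ l], rule allI, rule impI, intro conjI)
      fix e assume e: "qend Q k e"
      show "l \<in> {1..j}" by (rule l(1))
      show "1 \<le> d" by (rule d1)
      show "word y (e - int m + 1) (m - 1 + d + Q l) = word y (e0 - int m + 1) (m - 1 + d + Q l)"
      proof (rule word_eqI)
        fix i assume i: "0 \<le> i" "i < int (m - 1 + d + Q l)"
        have "y (e0 + (i - int m + 1)) = y (e + (i - int m + 1))"
          using i m by (intro agree[OF e]) (auto simp: of_nat_diff)
        then show "y (e - int m + 1 + i) = y (e0 - int m + 1 + i)" by (simp add: algebra_simps)
      qed
      show "run l (e + int d) (e + int d + int (Q l))"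
      proof (rule runI)
        fix i assume i: "e + int d \<le> i" "i < e + int d + int (Q l)"
        have "y (e0 + (i - e)) = y (e + (i - e))" using i m by (intro agree[OF e]) auto
        then show "lab (y i) = l" using runD[OF l(2), of "e0 + (i - e)"] i by simp
      qed
      show "\<forall>t. \<forall>l\<in>{1..j}. e \<le> t \<and> t < e + int d \<longrightarrow> \<not> run l t (t + int (Q l))"
      proof (intro allI ballI impI notI)
        fix t l' assume l': "l' \<in> {1..j}" and t: "e \<le> t \<and> t < e + int d"
          and r: "run l' t (t + int (Q l'))"
        have "y (e0 + (int d - 1)) = y (e + (int d - 1))"
          using d1 m Qpos[OF l(1)] by (intro agree[OF e]) auto
        then have pre: "lab (y (e + int d - 1)) = 0" using Lpre by (simp add: algebra_simps)
        have short: "t + int (Q l') \<le> e + int d - 1"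
        proof (rule ccontr)
          assume "\<not> t + int (Q l') \<le> e + int d - 1"
          then have "lab (y (e + int d - 1)) = l'" using t by (intro runD[OF r]) auto
          then show False using pre l' by simp
        qed
        have "run l' (e0 + int (nat (t - e))) (e0 + int (nat (t - e)) + int (Q l'))"
        proof (rule runI)
          fix i assume i: "e0 + int (nat (t - e)) \<le> i" "i < e0 + int (nat (t - e)) + int (Q l')"
          have "y (e0 + (i - e0)) = y (e + (i - e0))"
            using i t short m by (intro agree[OF e]) auto
          then show "lab (y i) = l'" using runD[OF r, of "e + (i - e0)"] i t by simp
        qed
        then have "S (nat (t - e))" using l' by (auto simp: S_def)
        then show False using dmin[of "nat (t - e)"] t by linarith
      qed
    qed
  qed
  have "\<exists>T. \<forall>k\<in>{1..j}. C k (fst (T k)) (fst (snd (T k))) (snd (snd (T k)))"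
  proof (rule bchoice, rule ballI)
    fix k assume "k \<in> {1..j}"
    from main[OF this] obtain Vk dk tk where "C k Vk dk tk" by blast
    then show "\<exists>T. C k (fst T) (fst (snd T)) (snd (snd T))"
      by (intro exI[of _ "(Vk, dk, tk)"]) simp
  qed
  then obtain T where T: "\<forall>k\<in>{1..j}. C k (fst (T k)) (fst (snd (T k))) (snd (snd (T k)))" ..
  have "cyclic Q m (\<lambda>k. fst (T k)) (\<lambda>k. fst (snd (T k))) (\<lambda>k. snd (snd (T k)))"
    unfolding cyclic_def using m(1) Q T unfolding C_def by blast
  then show ?thesis by blast
qed

text \<open>Written without subtraction: for some \<open>n \<ge> m\<close>,
  \<open>card (NM n) - (j + 1) * n\<close> is at least \<open>card (NM m) - j * m\<close>, as
  \<open>cyclic_growth\<close> provides.\<close>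

definition good :: "nat \<Rightarrow> bool" where
  "good m \<longleftrightarrow> (\<exists>n\<ge>m. n + j * n + card (NM m) \<le> card (NM n) + j * m)"

lemma exit_unique:
  assumes "card (exits k n) = 1" "run k (e - int n) e" "lab (y e) \<noteq> k"
    "run k (e' - int n) e'" "lab (y e') \<noteq> k"
  shows "word y (e - int n) (Suc n) = word y (e' - int n) (Suc n)"
proof -
  obtain w where w: "exits k n = {w}" using assms(1) by (rule card_1_singletonE)
  have "word y (e - int n) (Suc n) \<in> exits k n" "word y (e' - int n) (Suc n) \<in> exits k n"
    using assms by (simp_all add: word_exits_iff)
  then show ?thesis by (simp add: w)
qed

lemma not_RS_next:
  assumes "word y t n \<in> NM n" "word y t n \<notin> RS n" "word y t n = word y t' n"
  shows "y (t + int n) = y (t' + int n)"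
proof (rule ccontr)
  assume "y (t + int n) \<noteq> y (t' + int n)"
  moreover have "word y t n @ [y (t + int n)] \<in> Lg (Suc n)" "word y t n @ [y (t' + int n)] \<in> Lg (Suc n)"
    using word_in_Lg[of t "Suc n"] word_in_Lg[of t' "Suc n"] assms(3) by (simp_all add: word_Suc)
  ultimately show False using assms(1,2) by (auto simp: RS_def)
qed

text \<open>With all thresholds equal to \<open>n\<close>, \<open>D2\<close> follows from the
  absence of right special words. \<open>D1\<close> concerns only \<open>n\<close> letters including
  the exit letter, so a unique exit word with \<open>n - 1\<close> letters before the exit serves as
  well as one with \<open>n\<close>; hence the disjunction.\<close>

lemma good_if_no_RS:
  assumes n: "2 \<le> n" and RS: "RS n = {}"
    and ex: "\<And>k. k \<in> {1..j} \<Longrightarrow> card (exits k n) = 1 \<or> card (exits k (n - 1)) = 1"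
  shows "good n"
proof -
  have "\<exists>V d \<tau>. cyclic (\<lambda>_. n) n V d \<tau>"
  proof (rule deterministic_cyclic[where p = n])
    fix k e e' assume k: "k \<in> {1..j}" and e: "qend (\<lambda>_. n) k e" and e': "qend (\<lambda>_. n) k e'"
    note q = e[unfolded qend_def] e'[unfolded qend_def]
    show "word y (e - int n + 1) n = word y (e' - int n + 1) n"
    proof (cases "card (exits k n) = 1")
      case True
      then have "word y (e - int n) (Suc n) = word y (e' - int n) (Suc n)"
        using q by (intro exit_unique[of k]) auto
      from arg_cong[OF this, of "drop 1"] show ?thesis by (simp add: drop_word algebra_simps)
    next
      case False
      then have "card (exits k (n - 1)) = 1" using ex[OF k] by simp
      then have "word y (e - int (n - 1)) (Suc (n - 1)) = word y (e' - int (n - 1)) (Suc (n - 1))"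
        using q n by (intro exit_unique[of k]) (auto intro: run_mono)
      then show ?thesis using n by (simp add: of_nat_diff algebra_simps)
    qed
  next
    fix t t' assume w: "word y t n = word y t' n"
      and nr: "\<forall>l\<in>{1..j}. \<not> run l (t + int n - int n) (t + int n)"
    show "y (t + int n) = y (t' + int n)"
    proof (rule not_RS_next[OF _ _ w])
      show "word y t n \<in> NM n" unfolding word_NM_iff using nr by simp
    qed (simp add: RS)
  qed (use n in auto)
  then show ?thesis unfolding good_def using cyclic_growth by blast
qed

text \<open>The only right special word ends with \<open>n\<close> letters of label
  \<open>l\<close>. As \<open>l\<close> has a unique exit at \<open>n\<close>, its threshold can be
  \<open>n\<close>; the word then ends with a complete run, where \<open>D2\<close> demands nothing.
  Labels without a unique exit at \<open>n\<close> get the threshold \<open>n + 1\<close>.\<close>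

lemma good_if_entrance:
  assumes n: "1 \<le> n" and RS: "RS (Suc n) = {word y t0 (Suc n)}"
    and l: "l \<in> {1..j}" "run l (t0 + 1) (t0 + 1 + int n)" "card (exits l n) = 1"
    and ex: "\<And>k. k \<in> {1..j} \<Longrightarrow> card (exits k (Suc n)) = 1"
  shows "good n"
proof -
  define Q where "Q k = (if card (exits k n) = 1 then n else Suc n)" for k
  have "\<exists>V d \<tau>. cyclic Q n V d \<tau>"
  proof (rule deterministic_cyclic[where p = "Suc n"])
    fix k e e' assume k: "k \<in> {1..j}" and e: "qend Q k e" and e': "qend Q k e'"
    note q = e[unfolded qend_def] e'[unfolded qend_def]
    show "word y (e - int (Suc n) + 1) (Suc n) = word y (e' - int (Suc n) + 1) (Suc n)"
    proof (cases "card (exits k n) = 1")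
      case True
      then have "word y (e - int n) (Suc n) = word y (e' - int n) (Suc n)"
        using q by (intro exit_unique[of k]) (auto simp: Q_def)
      then show ?thesis by (simp add: algebra_simps)
    next
      case False
      then have "word y (e - int (Suc n)) (Suc (Suc n)) = word y (e' - int (Suc n)) (Suc (Suc n))"
        using q ex[OF k] by (intro exit_unique[of k]) (auto simp: Q_def)
      from arg_cong[OF this, of "drop 1"] show ?thesis by (simp add: drop_word algebra_simps)
    qed
  next
    fix t t' assume w: "word y t (Suc n) = word y t' (Suc n)"
      and nr: "\<forall>l\<in>{1..j}. \<not> run l (t + int (Suc n) - int (Q l)) (t + int (Suc n))"
    show "y (t + int (Suc n)) = y (t' + int (Suc n))"
    proof (rule not_RS_next[OF _ _ w])
      show "word y t (Suc n) \<in> NM (Suc n)"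
        unfolding word_NM_iff
      proof (intro ballI notI)
        fix k assume k: "k \<in> {1..j}" and r: "run k t (t + int (Suc n))"
        have "run k (t + int (Suc n) - int (Q k)) (t + int (Suc n))"
          by (rule run_mono[OF r]) (auto simp: Q_def)
        then show False using nr k by blast
      qed
      show "word y t (Suc n) \<notin> RS (Suc n)"
      proof
        assume "word y t (Suc n) \<in> RS (Suc n)"
        then have eq: "word y t0 (Suc n) = word y t (Suc n)" using RS by simp
        have "run l (t + 1) (t + (1 + int n))"
          using run_cong[OF eq, of l 1 "1 + int n"] l(2) by (simp add: add.assoc)
        then have "run l (t + int (Suc n) - int (Q l)) (t + int (Suc n))"
          using l(3) by (simp add: Q_def algebra_simps)
        then show False using nr l by blast
      qed
    qed
  qed (use n in \<open>auto simp: Q_def\<close>)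
  then show ?thesis unfolding good_def using cyclic_growth by blast
qed

text \<open>Otherwise the entrance word of length \<open>n2 + 1\<close> would determine a whole visit, and visits would
  have bounded length.\<close>
lemma ex_RS_entrance:
  "\<exists>n\<ge>n2. \<exists>t. \<exists>l\<in>{1..j}. word y t (Suc n) \<in> RS (Suc n) \<and> run l (t + 1) (t + 1 + int n)"
proof (rule ccontr)
  assume "\<not> ?thesis"
  then have none: "word y t (Suc n) \<notin> RS (Suc n)"
    if "n2 \<le> n" "l \<in> {1..j}" "run l (t + 1) (t + 1 + int n)" for n t l using that by blast
  define n3 where "n3 = max 1 n2"
  have k: "(1::nat) \<in> {1..j}" using j_ge_2 by simp
  have same: "word y (s - 1) (Suc N) = word y (s' - 1) (Suc N)"
    if w: "word y (s - 1) (Suc n3) = word y (s' - 1) (Suc n3)" and s: "lab (y (s - 1)) \<noteq> 1"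
      and N: "n3 \<le> N" "run 1 s (s + int N)" for s s' N
    using N
  proof (induction N rule: nat_induct_at_least)
    case base
    show ?case by (rule w)
  next
    case (Suc N)
    have r: "run 1 s (s + int N)" using Suc.prems by (rule run_mono) auto
    have IH: "word y (s - 1) (Suc N) = word y (s' - 1) (Suc N)" using Suc.IH[OF r] .
    have N: "1 \<le> N" "n2 \<le> N" using Suc.hyps by (auto simp: n3_def)
    have "y (s - 1 + int (Suc N)) = y (s' - 1 + int (Suc N))"
    proof (rule not_RS_next[OF _ _ IH])
      show "word y (s - 1) (Suc N) \<notin> RS (Suc N)" using none[OF N(2) k, of "s - 1"] r by simp
      show "word y (s - 1) (Suc N) \<in> NM (Suc N)"
        unfolding word_NM_iff
      proof (intro ballI notI)
        fix l assume "run l (s - 1) (s - 1 + int (Suc N))"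
        then have "lab (y (s - 1)) = l" "lab (y s) = l" using N by (auto intro!: runD[of l])
        moreover have "lab (y s) = 1" using N by (intro runD[OF r]) auto
        ultimately show False using s by simp
      qed
    qed
    then show ?case using IH by (simp add: word_Suc[of y _ "Suc N"])
  qed
  define vis where "vis w r \<longleftrightarrow> (\<exists>s. word y (s - 1) (Suc n3) = w \<and> lab (y (s - 1)) \<noteq> 1 \<and>
      lab (y (s + int r)) \<noteq> 1)" for w r
  define f where "f w = (SOME r. vis w r)" for w
  \<comment> \<open>There are finitely many entrance words. For each one that occurs before a visit
    to \<open>1\<close>, \<open>f\<close> picks a distance at which some occurrence has left label
    \<open>1\<close>; by \<open>same\<close>, no run of label \<open>1\<close> can outlast these
    distances.\<close>
  define R where "R = Max (f ` Lg (Suc n3))"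
  obtain s where s: "run 1 s (s + int (n3 + R + 1))" "lab (y (s - 1)) \<noteq> 1"
    using run_begin[OF k] by blast
  obtain e where e: "s + int (n3 + R + 1) \<le> e" "lab (y e) \<noteq> 1"
    by (rule run_end[OF s(1)]) auto
  let ?w = "word y (s - 1) (Suc n3)"
  have "vis ?w (nat (e - s))" unfolding vis_def using s e by (intro exI[of _ s]) auto
  then have "vis ?w (f ?w)" unfolding f_def by (rule someI)
  then obtain s' where s': "?w = word y (s' - 1) (Suc n3)" "lab (y (s' - 1)) \<noteq> 1"
    "lab (y (s' + int (f ?w))) \<noteq> 1" unfolding vis_def by metis
  have "f ?w \<le> R" unfolding R_def by (intro Max_ge) auto
  have "word y (s - 1) (Suc (n3 + R + 1)) = word y (s' - 1) (Suc (n3 + R + 1))"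
    by (rule same[OF s'(1) s(2)]) (use s in auto)
  from word_eqD[OF this, of "1 + int (f ?w)"] have "y (s + int (f ?w)) = y (s' + int (f ?w))"
    using \<open>f ?w \<le> R\<close> by simp
  moreover have "lab (y (s + int (f ?w))) = 1"
    using \<open>f ?w \<le> R\<close> by (intro runD[OF s(1)]) auto
  ultimately show False using s'(3) by simp
qed

lemma NM_growth_far:
  assumes "1 \<le> m" "m \<le> n" shows "card (NM m) + j * (n - m) \<le> card (NM n)"
  using assms(2)
proof (induction n rule: nat_induct_at_least)
  case (Suc n)
  then show ?case using NM_growth_j[of n] assms(1) by (simp add: Suc_diff_le)
qed simp

text \<open>Every label has an exit word, so growth at most \<open>j + 1\<close> leaves one unit in
  \<open>NM_growth\<close>, to be spent on one right special word or on one second exit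
  word.\<close>

lemma excess_cases:
  assumes n: "1 \<le> n" and ex: "card (NM (Suc n)) \<le> card (NM n) + j + 1"
  shows "w \<in> RS n \<Longrightarrow> RS n = {w}"
    "RS n \<noteq> {} \<Longrightarrow> k \<in> {1..j} \<Longrightarrow> card (exits k n) = 1"
    "k \<in> {1..j} \<Longrightarrow> card (exits k n) \<noteq> 1 \<Longrightarrow> l \<in> {1..j} \<Longrightarrow> l \<noteq> k \<Longrightarrow> card (exits l n) = 1"
proof -
  have sum: "(\<Sum>k\<in>{1..j}. card (exits k n)) = j + (\<Sum>k\<in>{1..j}. card (exits k n) - 1)"
  proof -
    have "(\<Sum>k\<in>{1..j}. card (exits k n)) = (\<Sum>k\<in>{1..j}. 1 + (card (exits k n) - 1))"
    proof (rule sum.cong[OF refl])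
      fix k assume "k \<in> {1..j}"
      from exits_ge_1[OF this, of n] show "card (exits k n) = 1 + (card (exits k n) - 1)" by linarith
    qed
    then show ?thesis by (simp only: sum.distrib) simp
  qed
  have le: "card (RS n) + (\<Sum>k\<in>{1..j}. card (exits k n) - 1) \<le> 1"
    using NM_growth[OF n] ex sum by linarith
  show "RS n = {w}" if "w \<in> RS n"
  proof -
    have "card (RS n) = 1"
      using le that card_gt_0_iff[of "RS n"] by (auto intro!: le_antisym simp: Suc_le_eq)
    then show ?thesis using that by (metis card_1_singletonE singletonD)
  qed
  show "card (exits k n) = 1" if "RS n \<noteq> {}" "k \<in> {1..j}"
  proof -
    have "1 \<le> card (RS n)" using that by (simp add: Suc_le_eq card_gt_0_iff)
    then have "(\<Sum>k\<in>{1..j}. card (exits k n) - 1) = 0" using le by linarith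
    then have "card (exits k n) - 1 = 0" using that(2) by (subst (asm) sum_eq_0_iff) auto
    then show ?thesis using exits_ge_1[OF that(2), of n] by linarith
  qed
  show "card (exits l n) = 1" if "k \<in> {1..j}" "card (exits k n) \<noteq> 1" "l \<in> {1..j}" "l \<noteq> k"
  proof -
    have "(\<Sum>k\<in>{k, l}. card (exits k n) - 1) \<le> (\<Sum>k\<in>{1..j}. card (exits k n) - 1)"
      using that by (intro sum_mono2) auto
    then have "(card (exits k n) - 1) + (card (exits l n) - 1) \<le> 1" using le that(4) by simp
    then show ?thesis using exits_ge_1[OF that(1), of n] exits_ge_1[OF that(3), of n] that(2) by linarith
  qed
qed

lemma excess_RS:
  assumes n: "1 \<le> n" and ex: "card (NM (Suc n)) \<le> card (NM n) + j + 1"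
    and k: "k \<in> {1..j}" "card (exits k n) \<noteq> 1"
  shows "RS n = {}"
  using excess_cases(2)[OF n ex _ k(1)] k(2) by blast

lemma no_excess:
  assumes n: "1 \<le> n" and ex: "card (NM (Suc n)) = card (NM n) + j"
  shows "RS n = {}" "k \<in> {1..j} \<Longrightarrow> card (exits k n) = 1"
proof -
  have s: "(\<Sum>k\<in>{1..j}. 1) \<le> (\<Sum>k\<in>{1..j}. card (exits k n))"
    by (rule sum_mono) (rule exits_ge_1)
  have "(\<Sum>k\<in>{1..j}. 1) = j" by simp
  then have "card (RS n) = 0" using NM_growth[OF n] ex s by linarith
  then show "RS n = {}" by simp
  show "card (exits k n) = 1" if k: "k \<in> {1..j}"
  proof (rule ccontr)
    assume "card (exits k n) \<noteq> 1"
    then have "1 < card (exits k n)" using exits_ge_1[OF k, of n] by simp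
    then have "(\<Sum>k\<in>{1..j}. 1) < (\<Sum>k\<in>{1..j}. card (exits k n))"
      using k exits_ge_1 by (intro sum_strict_mono_ex1) auto
    then show False using NM_growth[OF n] ex by simp
  qed
qed

theorem NM_superlinear: "\<exists>n\<ge>1. (j + 1) * n + C \<le> card (NM n)"
proof (cases "\<forall>m0. \<exists>m\<ge>m0. good m")
  case True
  \<comment> \<open>Good levels are used twice: the first yields
    \<open>card (NM m0) - j * m0 \<ge> C\<close>, the second turns this into the bound for
    \<open>card (NM n) - (j + 1) * n\<close>.\<close>
  obtain m0 where m0: "m0 \<ge> 1" "j * m0 + C \<le> card (NM m0)"
  proof -
    obtain m where m: "m \<ge> C + j + 1" "good m" using True by blast
    then obtain n where n: "n \<ge> m" "n + j * n + card (NM m) \<le> card (NM n) + j * m"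
      by (auto simp: good_def)
    have "card (NM 1) + j * (m - 1) \<le> card (NM m)" using m by (intro NM_growth_far) auto
    moreover have "j * m = j * (m - 1) + j" using m by (simp add: algebra_simps)
    ultimately show ?thesis using n m by (intro that[of n]) linarith+
  qed
  obtain m where m: "m \<ge> m0" "good m" using True by blast
  then obtain n where n: "n \<ge> m" "n + j * n + card (NM m) \<le> card (NM n) + j * m"
    by (auto simp: good_def)
  have "card (NM m0) + j * (m - m0) \<le> card (NM m)" using m m0 by (intro NM_growth_far) auto
  moreover have "j * m = j * (m - m0) + j * m0" using m by (metis add_mult_distrib2 le_add_diff_inverse2)
  ultimately show ?thesis using n m m0 by (intro exI[of _ n] conjI) auto
next
  case False
  then obtain n00 where n00: "\<And>m. m \<ge> n00 \<Longrightarrow> \<not> good m" by blast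
  define n0 where "n0 = n00 + 2"
  have n0: "\<not> good m" if "m \<ge> n0" for m using n00 that by (simp add: n0_def)
  \<comment> \<open>Growth by only \<open>j\<close> would leave unique exits and no right special
    word, and the level would be good.\<close>
  have ge: "card (NM n) + j + 1 \<le> card (NM (Suc n))" if n: "n \<ge> n0" for n
  proof (rule ccontr)
    assume "\<not> ?thesis"
    then have "card (NM (Suc n)) = card (NM n) + j" using NM_growth_j[of n] n by (simp add: n0_def)
    note ne = no_excess[OF _ this]
    have "good n" using n ne by (intro good_if_no_RS) (auto simp: n0_def)
    then show False using n0 n by blast
  qed
  have step: "card (NM m) + (j + 1) * (n - m) \<le> card (NM n)" if "n0 \<le> m" "m \<le> n" for m n
    using that(2)
  proof (induction n rule: nat_induct_at_least)
    case (Suc n)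
    then show ?case using ge[of n] that(1) by (simp add: Suc_diff_le)
  qed simp
  show ?thesis
  proof (cases "\<forall>n1. \<exists>n\<ge>n1. card (NM n) + j + 2 \<le> card (NM (Suc n))")
    case True
    have "\<exists>n\<ge>n0. (j + 1) * n + c \<le> card (NM n) + (j + 1) * n0" for c
    proof (induction c)
      case 0 then show ?case by (intro exI[of _ n0]) auto
    next
      case (Suc c)
      then obtain n where n: "n \<ge> n0" "(j + 1) * n + c \<le> card (NM n) + (j + 1) * n0" by blast
      obtain n' where n': "n' \<ge> n" "card (NM n') + j + 2 \<le> card (NM (Suc n'))" using True by blast
      have "card (NM n) + (j + 1) * (n' - n) \<le> card (NM n')" using n n' by (intro step)
      moreover have "(j + 1) * n' = (j + 1) * (n' - n) + (j + 1) * n"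
        using n' by (metis add_mult_distrib2 le_add_diff_inverse2)
      ultimately show ?case using n n' by (intro exI[of _ "Suc n'"] conjI) auto
    qed
    from this[of "C + (j + 1) * n0"] obtain n where
      "n \<ge> n0" "(j + 1) * n + (C + (j + 1) * n0) \<le> card (NM n) + (j + 1) * n0" by blast
    then show ?thesis by (intro exI[of _ n] conjI) (simp_all add: n0_def)
  next
    case False
    then obtain n1' where n1': "\<And>n. n \<ge> n1' \<Longrightarrow> \<not> card (NM n) + j + 2 \<le> card (NM (Suc n))" by blast
    define n1 where "n1 = max n0 n1'"
    have le: "card (NM (Suc n)) \<le> card (NM n) + j + 1" if "n \<ge> n1" for n
      using n1'[of n] that by (simp add: n1_def)
    have n1: "n1 \<ge> 2" "n1 \<ge> n0" by (auto simp: n1_def n0_def)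
    \<comment> \<open>Uniqueness of exits persists: a new second exit would use up the only surplus,
      leave no right special word, and make the level good.\<close>
    have single: "card (exits l n) = 1"
      if n: "n > n1" and l: "l \<in> {1..j}" and s: "card (exits l (n - 1)) = 1" for n l
    proof (rule ccontr)
      assume d: "card (exits l n) \<noteq> 1"
      have len: "card (NM (Suc n)) \<le> card (NM n) + j + 1" using n by (intro le) simp
      have "good n"
      proof (rule good_if_no_RS)
        show "RS n = {}" using n n1 by (intro excess_RS[OF _ len l d]) simp
        show "card (exits k n) = 1 \<or> card (exits k (n - 1)) = 1" if "k \<in> {1..j}" for k
          using excess_cases(3)[OF _ len l d that] s n n1 by (cases "k = l") auto
      qed (use n n1 in simp)
      then show False using n0 n n1 by simp
    qed
    have entr: "card (exits l n) \<noteq> 1"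
      if n: "n \<ge> n1" and l: "l \<in> {1..j}" "word y t (Suc n) \<in> RS (Suc n)" "run l (t + 1) (t + 1 + int n)" for n l t
    proof
      assume s: "card (exits l n) = 1"
      have len: "card (NM (Suc (Suc n))) \<le> card (NM (Suc n)) + j + 1" using n by (intro le) simp
      have "good n"
        using n n1 l s excess_cases(1,2)[OF _ len]
        by (intro good_if_entrance[of n t l]) auto
      then show False using n0 n n1 by simp
    qed
    obtain n t l where n: "n \<ge> n1" "l \<in> {1..j}" "word y t (Suc n) \<in> RS (Suc n)" "run l (t + 1) (t + 1 + int n)"
      using ex_RS_entrance by blast
    have len: "card (NM (Suc (Suc n))) \<le> card (NM (Suc n)) + j + 1" using n by (intro le) simp
    \<comment> \<open>A right special entrance at \<open>n + 1\<close> makes all exits unique there,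
      and by \<open>single\<close> they stay so. By \<open>entr\<close> a later right special
      entrance would need a label with two exits.\<close>
    have all: "card (exits k n') = 1" if "k \<in> {1..j}" "n' \<ge> Suc n" for k n'
      using that(2)
    proof (induction n' rule: nat_induct_at_least)
      case base
      show ?case using n by (intro excess_cases(2)[OF _ len _ that(1)]) auto
    next
      case (Suc n')
      show ?case
      proof (rule single)
        show "Suc n' > n1" using Suc.hyps n by simp
        show "k \<in> {1..j}" by (rule that(1))
        show "card (exits k (Suc n' - 1)) = 1" using Suc.IH by simp
      qed
    qed
    obtain n' t' l' where n': "n' \<ge> Suc n" "l' \<in> {1..j}" "word y t' (Suc n') \<in> RS (Suc n')"
      "run l' (t' + 1) (t' + 1 + int n')"
      using ex_RS_entrance by blast
    have "card (exits l' n') \<noteq> 1" using n n' by (intro entr[of n' l' t']) auto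
    then show ?thesis using all n' by blast
  qed
qed

end

section \<open>Reflection and one-sided recurrence\<close>

definition nonmono_words :: "(int \<Rightarrow> 'b) \<Rightarrow> ('b \<Rightarrow> nat) \<Rightarrow> nat \<Rightarrow> nat \<Rightarrow> 'b list set" where
  "nonmono_words y lab j n = {word y t n | t. \<forall>k\<in>{1..j}. \<exists>l<n. lab (y (t + int l)) \<noteq> k}"

lemma (in labelled_sequence) NM_eq: "NM n = nonmono_words y lab j n"
proof -
  have "mono_word k (word y t n) \<longleftrightarrow> (\<forall>l<n. lab (y (t + int l)) = k)" for k t
    by (simp add: mono_word_def Ball_set_word)
  moreover have "NM n = {word y t n | t. \<forall>k\<in>{1..j}. \<not> mono_word k (word y t n)}"
    unfolding NM_def Lg_def by blast
  ultimately show ?thesis by (simp add: nonmono_words_def)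
qed

lemma word_reflect: "word (\<lambda>t. y (- t)) t n = rev (word y (1 - t - int n) n)"
  by (rule nth_equalityI) (auto simp: rev_nth of_nat_diff algebra_simps)

lemma nonmono_words_reflect:
  "nonmono_words (\<lambda>t. y (- t)) lab j n = rev ` nonmono_words y lab j n"
proof -
  have eq: "(\<forall>k\<in>{1..j}. \<exists>l<n. lab (y (- (t + int l))) \<noteq> k) \<longleftrightarrow>
        (\<forall>k\<in>{1..j}. \<exists>l<n. lab (y (1 - t - int n + int l)) \<noteq> k)" for t
  proof -
    have "(\<exists>l<n. lab (y (- (t + int l))) \<noteq> k) \<longleftrightarrow> (\<exists>l<n. lab (y (1 - t - int n + int l)) \<noteq> k)" for k
    proof
      assume "\<exists>l<n. lab (y (- (t + int l))) \<noteq> k"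
      then obtain l where "l < n" "lab (y (- (t + int l))) \<noteq> k" by blast
      then show "\<exists>l<n. lab (y (1 - t - int n + int l)) \<noteq> k"
        by (intro exI[of _ "n - 1 - l"]) (auto simp: of_nat_diff algebra_simps)
    next
      assume "\<exists>l<n. lab (y (1 - t - int n + int l)) \<noteq> k"
      then obtain l where "l < n" "lab (y (1 - t - int n + int l)) \<noteq> k" by blast
      then show "\<exists>l<n. lab (y (- (t + int l))) \<noteq> k"
        by (intro exI[of _ "n - 1 - l"]) (auto simp: of_nat_diff algebra_simps)
    qed
    then show ?thesis by simp
  qed
  show ?thesis
  proof (intro equalityI subsetI)
    fix w assume "w \<in> nonmono_words (\<lambda>t. y (- t)) lab j n"
    then obtain t where "w = word (\<lambda>t. y (- t)) t n"
      "\<forall>k\<in>{1..j}. \<exists>l<n. lab (y (- (t + int l))) \<noteq> k"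
      unfolding nonmono_words_def by blast
    then have "w = rev (word y (1 - t - int n) n)"
      "\<forall>k\<in>{1..j}. \<exists>l<n. lab (y (1 - t - int n + int l)) \<noteq> k"
      by (simp_all only: word_reflect eq)
    then show "w \<in> rev ` nonmono_words y lab j n" unfolding nonmono_words_def by blast
  next
    fix w assume "w \<in> rev ` nonmono_words y lab j n"
    then obtain s where s: "w = rev (word y s n)"
      "\<forall>k\<in>{1..j}. \<exists>l<n. lab (y (s + int l)) \<noteq> k" unfolding nonmono_words_def by blast
    define t where "t = 1 - s - int n"
    have "s = 1 - t - int n" by (simp add: t_def)
    then have "w = word (\<lambda>t. y (- t)) t n" "\<forall>k\<in>{1..j}. \<exists>l<n. lab (y (- (t + int l))) \<noteq> k"
      using s by (simp_all only: word_reflect eq)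
    then show "w \<in> nonmono_words (\<lambda>t. y (- t)) lab j n" unfolding nonmono_words_def by blast
  qed
qed

text \<open>The central window of length \<open>2 * r\<close> occurs infinitely often, hence without
  bound in one direction. If for some \<open>r0\<close> this fails to the right, it fails for all
  larger \<open>r\<close>, because a larger window contains the smaller one; so all words recur to
  the left.\<close>

lemma recurrent_one_sided:
  assumes "recurrent y"
  shows "(\<forall>m t n. \<exists>t'>m. word y t' n = word y t n) \<or> (\<forall>m t n. \<exists>t'<m. word y t' n = word y t n)"
proof -
  have inf: "infinite {t'. word y t' n = word y t n}" for t n
  proof
    define S where "S = {t'. word y t' n = word y t n}"
    assume "finite {t'. word y t' n = word y t n}"
    then have fin: "finite S" by (simp add: S_def)
    have "t \<in> S" by (simp add: S_def)
    then have S: "Min S \<in> S" "Max S \<in> S"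
      using fin by (auto intro: Min_in Max_in)
    then have "Min S \<le> Max S" using fin by (intro Min_le)
    define a c where "a = Min S" and "c = Max S"
    \<comment> \<open>The word from the first to the last occurrence has another copy, and one end
      of this copy falls outside the range of occurrences.\<close>
    obtain t' where t': "t' \<noteq> a" "word y t' (nat (c - a) + n) = word y a (nat (c - a) + n)"
      using assms unfolding recurrent_def by blast
    have ac: "a \<le> c" using \<open>Min S \<le> Max S\<close> by (simp add: a_def c_def)
    have "word y t' n = word y a n"
      using arg_cong[OF t'(2), of "take n"] by (simp add: take_word)
    then have 1: "t' \<in> S" using S by (simp add: S_def a_def)
    have "word y (t' + (c - a)) n = word y c n"
      using arg_cong[OF t'(2), of "drop (nat (c - a))"] ac by (simp add: drop_word)
    then have 2: "t' + (c - a) \<in> S" using S by (simp add: S_def c_def)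
    have "a \<le> t'" "t' + (c - a) \<le> c" using 1 2 fin by (auto simp: a_def c_def)
    then show False using t' by simp
  qed
  define O' where "O' r = {t'. word y t' (2 * r) = word y (- int r) (2 * r)}" for r
  have sub: "word y (u + (t + int r)) n = word y t n"
    if "u \<in> O' r" "int r \<ge> \<bar>t\<bar> + int n" for u r t n
  proof -
    have w: "word y u (2 * r) = word y (- int r) (2 * r)" using that(1) by (simp add: O'_def)
    show ?thesis using subword_eq[OF w, of "u + (t + int r)" n] that(2) by simp
  qed
  have bnd: "(\<forall>m. \<exists>u\<in>O' r. u > m) \<or> (\<forall>m. \<exists>u\<in>O' r. u < m)" for r
  proof (rule ccontr)
    assume "\<not> ?thesis"
    then obtain m m' where "\<forall>u\<in>O' r. \<not> u > m" "\<forall>u\<in>O' r. \<not> u < m'" by blast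
    then have "O' r \<subseteq> {m'..m}" by (auto simp: not_less)
    then have "finite (O' r)" by (rule finite_subset) simp
    then show False using inf by (simp add: O'_def)
  qed
  show ?thesis
  proof (cases "\<forall>r m. \<exists>u\<in>O' r. u > m")
    case True
    have "\<exists>t'>m. word y t' n = word y t n" for m t n
    proof -
      define r where "r = nat (\<bar>t\<bar> + int n)"
      obtain u where "u \<in> O' r" "u > m - (t + int r)" using True by blast
      then show ?thesis using sub[of u r t n] by (intro exI[of _ "u + (t + int r)"]) (auto simp: r_def)
    qed
    then show ?thesis by blast
  next
    case False
    then obtain r0 m0 where r0: "\<forall>u\<in>O' r0. \<not> u > m0" by blast
    have "\<exists>t'<m. word y t' n = word y t n" for m t n
    proof -
      define r where "r = nat (\<bar>t\<bar> + int n) + r0"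
      have "\<not> (\<forall>m. \<exists>u\<in>O' r. u > m)"
      proof
        assume h: "\<forall>m. \<exists>u\<in>O' r. u > m"
        obtain u where u: "u \<in> O' r" "u > m0 - (- int r0 + int r)" using h by blast
        have w: "word y u (2 * r) = word y (- int r) (2 * r)" using u by (simp add: O'_def)
        have "u + (- int r0 + int r) \<in> O' r0"
          using subword_eq[OF w, of "u + (- int r0 + int r)" "2 * r0"] by (simp add: O'_def r_def)
        then show False using r0 u by auto
      qed
      then obtain u where "u \<in> O' r" "u < m - (t + int r)" using bnd[of r] by blast
      then show ?thesis using sub[of u r t n] by (intro exI[of _ "u + (t + int r)"]) (auto simp: r_def)
    qed
    then show ?thesis by blast
  qed
qed

lemma labelled_sequence_reflect:
  assumes fin: "finite (range y)" and j: "2 \<le> j"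
    and rec: "\<forall>m t n. \<exists>t'<m. word y t' n = word y t n"
    and long: "\<And>k n. k \<in> {1..j} \<Longrightarrow> \<exists>t. \<forall>i. t \<le> i \<and> i < t + int n \<longrightarrow> lab (y i) = k"
    and adj: "\<And>t. lab (y t) \<noteq> lab (y (t + 1)) \<Longrightarrow> lab (y t) = 0 \<or> lab (y (t + 1)) = 0"
  shows "labelled_sequence (\<lambda>t. y (- t)) lab j"
proof
  show "finite (range (\<lambda>t. y (- t)))" by (rule finite_subset[OF _ fin]) auto
  show "\<exists>t'>m. word (\<lambda>t. y (- t)) t' n = word (\<lambda>t. y (- t)) t n" for m t n
  proof -
    obtain s where s: "s < 1 - m - int n" "word y s n = word y (1 - t - int n) n" using rec by blast
    have "word (\<lambda>t. y (- t)) (1 - s - int n) n = word (\<lambda>t. y (- t)) t n"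
      using s by (simp add: word_reflect)
    then show ?thesis using s by (intro exI[of _ "1 - s - int n"]) auto
  qed
  show "\<exists>t. \<forall>i. t \<le> i \<and> i < t + int n \<longrightarrow> lab (y (- i)) = k" if k: "k \<in> {1..j}" for k n
  proof -
    obtain t where "\<forall>i. t \<le> i \<and> i < t + int n \<longrightarrow> lab (y i) = k" using long[OF k] by blast
    then show ?thesis by (intro exI[of _ "1 - t - int n"]) auto
  qed
  show "lab (y (- t)) = 0 \<or> lab (y (- (t + 1))) = 0" if "lab (y (- t)) \<noteq> lab (y (- (t + 1)))" for t
    using adj[of "- t - 1"] that by auto
qed (rule j)

theorem nonmono_words_growth:
  assumes fin: "finite (range y)" and j: "2 \<le> j" and rec: "recurrent y"
    and long: "\<And>k n. k \<in> {1..j} \<Longrightarrow> \<exists>t. \<forall>i. t \<le> i \<and> i < t + int n \<longrightarrow> lab (y i) = k"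
    and adj: "\<And>t. lab (y t) \<noteq> lab (y (t + 1)) \<Longrightarrow> lab (y t) = 0 \<or> lab (y (t + 1)) = 0"
  shows "\<exists>n\<ge>1. (j + 1) * n + C \<le> card (nonmono_words y lab j n)"
    and "1 \<le> m \<Longrightarrow> m \<le> n \<Longrightarrow>
      card (nonmono_words y lab j m) + j * (n - m) \<le> card (nonmono_words y lab j n)"
proof -
  have "(\<exists>n\<ge>1. (j + 1) * n + C \<le> card (nonmono_words y lab j n)) \<and>
    (1 \<le> m \<longrightarrow> m \<le> n \<longrightarrow>
      card (nonmono_words y lab j m) + j * (n - m) \<le> card (nonmono_words y lab j n))"
    using recurrent_one_sided[OF rec]
  proof
    assume r: "\<forall>m t n. \<exists>t'>m. word y t' n = word y t n"
    have "labelled_sequence y lab j"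
      by unfold_locales (use fin j r long adj in auto)
    then interpret labelled_sequence y lab j .
    show ?thesis using NM_superlinear[of C] NM_growth_far[of m n] by (simp add: NM_eq)
  next
    assume r: "\<forall>m t n. \<exists>t'<m. word y t' n = word y t n"
    interpret labelled_sequence "\<lambda>t. y (- t)" lab j
      by (rule labelled_sequence_reflect[OF fin j r long adj])
    have "card (nonmono_words (\<lambda>t. y (- t)) lab j n) = card (nonmono_words y lab j n)" for n
      unfolding nonmono_words_reflect by (rule card_image) (auto simp: inj_on_def)
    then show ?thesis using NM_superlinear[of C] NM_growth_far[of m n] by (simp add: NM_eq)
  qed
  then show "\<exists>n\<ge>1. (j + 1) * n + C \<le> card (nonmono_words y lab j n)"
    "1 \<le> m \<Longrightarrow> m \<le> n \<Longrightarrow>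
      card (nonmono_words y lab j m) + j * (n - m) \<le> card (nonmono_words y lab j n)" by auto
qed

section \<open>The lower bounds\<close>

lemma word_in_words: "z \<in> M \<Longrightarrow> word z k n \<in> words M n"
  unfolding words_def by blast

lemma words_E:
  assumes "w \<in> words M n" obtains z k where "z \<in> M" "w = word z k n"
  using assms unfolding words_def by blast

lemma words_take: "take m ` words M (m + n) = words M m"
proof (intro equalityI subsetI)
  fix w assume "w \<in> words M m"
  then obtain z k where "z \<in> M" "w = word z k m" by (rule words_E)
  then have "w = take m (word z k (m + n))" "word z k (m + n) \<in> words M (m + n)"
    by (simp_all add: take_word word_in_words)
  then show "w \<in> take m ` words M (m + n)" by (rule image_eqI)
next
  fix w assume "w \<in> take m ` words M (m + n)"
  then show "w \<in> words M m" by (auto simp: take_word word_in_words elim!: words_E)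
qed

lemma words_drop: "drop n ` words M (n + m) = words M m"
proof (intro equalityI subsetI)
  fix w assume "w \<in> words M m"
  then obtain z k where "z \<in> M" "w = word z k m" by (rule words_E)
  then have "w = drop n (word z (k - int n) (n + m))" "word z (k - int n) (n + m) \<in> words M (n + m)"
    by (simp_all add: drop_word word_in_words)
  then show "w \<in> drop n ` words M (n + m)" by (rule image_eqI)
next
  fix w assume "w \<in> drop n ` words M (n + m)"
  then show "w \<in> words M m" by (auto simp: drop_word word_in_words elim!: words_E)
qed

lemma subword_in_words:
  assumes "word x t n \<in> words M n" "t \<le> s" "s + int m \<le> t + int n"
  shows "word x s m \<in> words M m"
proof -
  obtain z k where z: "z \<in> M" "word x t n = word z k n" using assms(1) by (auto simp: words_def)
  have "word x s m = word z (k + (s - t)) m" by (rule subword_eq[OF z(2) assms(2,3)])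
  then show ?thesis using z(1) unfolding words_def by blast
qed

text \<open>Morse and Hedlund: if the number of words does not grow from length \<open>n\<close> to \<open>n + 1\<close>, every
  word of length \<open>n\<close> determines its neighbours on both sides, hence the point.\<close>
lemma Morse_Hedlund:
  assumes sub: "subshift A M" and inf: "infinite M"
  shows "n + 1 \<le> card (words M n)"
proof (induction n)
  case 0
  have "M \<noteq> {}" using inf by auto
  then have "words M 0 \<noteq> {}" by (auto simp: words_def)
  then show ?case using finite_words[OF sub, of 0] by (simp add: Suc_le_eq card_gt_0_iff)
next
  case (Suc n)
  show ?case
  proof (rule ccontr)
    assume "\<not> ?thesis"
    then have le: "card (words M (n + 1)) \<le> card (words M n)" using Suc by simp
    have fin: "finite (words M (n + 1))" "finite (words M (1 + n))" using finite_words[OF sub] by auto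
    have "card (take n ` words M (n + 1)) \<ge> card (words M (n + 1))" using le by (simp only: words_take)
    then have "card (take n ` words M (n + 1)) = card (words M (n + 1))"
      using card_image_le[OF fin(1), of "take n"] by simp
    then have inj1: "inj_on (take n) (words M (n + 1))" using fin(1) by (simp add: eq_card_imp_inj_on)
    have "card (drop 1 ` words M (1 + n)) \<ge> card (words M (1 + n))"
      using le by (simp only: words_drop) simp
    then have "card (drop 1 ` words M (1 + n)) = card (words M (1 + n))"
      using card_image_le[OF fin(2), of "drop 1"] by simp
    then have inj2: "inj_on (drop 1) (words M (1 + n))" using fin(2) by (simp add: eq_card_imp_inj_on)
    have right: "word z (k + 1) n = word z' (k + 1) n"
      if z: "z \<in> M" "z' \<in> M" "word z k n = word z' k n" for z z' k
    proof -
      have "word z k (n + 1) = word z' k (n + 1)"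
        by (rule inj_onD[OF inj1]) (simp_all add: take_word word_in_words z)
      from arg_cong[OF this, of "drop 1"] show ?thesis by (simp add: drop_word)
    qed
    have left: "word z (k - 1) n = word z' (k - 1) n"
      if z: "z \<in> M" "z' \<in> M" "word z k n = word z' k n" for z z' k
    proof -
      have "word z (k - 1) (1 + n) = word z' (k - 1) (1 + n)"
      proof (rule inj_onD[OF inj2])
        show "drop 1 (word z (k - 1) (1 + n)) = drop 1 (word z' (k - 1) (1 + n))"
          using z(3) by (simp add: drop_word)
        show "word z (k - 1) (1 + n) \<in> words M (1 + n)" "word z' (k - 1) (1 + n) \<in> words M (1 + n)"
          using z by (auto intro: word_in_words)
      qed
      from arg_cong[OF this, of "take n"] show ?thesis by (simp add: take_word)
    qed
    have all: "word z k n = word z' k n" if z: "z \<in> M" "z' \<in> M" "word z 0 n = word z' 0 n" for z z' k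
    proof (induction k rule: int_induct[of _ 0])
      case base then show ?case by (rule z(3))
    next
      case (step1 i) then show ?case using right[OF z(1,2)] by simp
    next
      case (step2 i) then show ?case using left[OF z(1,2)] by simp
    qed
    have "inj_on (\<lambda>z. word z 0 n) M"
    proof (rule inj_onI)
      fix z z' assume z: "z \<in> M" "z' \<in> M" "word z 0 n = word z' 0 n"
      show "z = z'"
      proof
        fix i
        have "word z (i - int n) (n + 1) = word z' (i - int n) (n + 1)"
          by (rule inj_onD[OF inj1]) (simp_all add: take_word word_in_words z all[OF z])
        from word_eqD[OF this, of "int n"] show "z i = z' i" by simp
      qed
    qed
    moreover have "finite ((\<lambda>z. word z 0 n) ` M)"
      by (rule finite_subset[OF _ finite_words[OF sub, of n]]) (auto intro: word_in_words)
    ultimately have "finite M" by (rule finite_imageD[rotated])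
    then show False using inf by simp
  qed
qed

section \<open>Separating minimal subsystems by their words\<close>

lemma minimal_disjoint:
  assumes "minimal_subshift A M" "minimal_subshift A N" "M \<noteq> N" shows "M \<inter> N = {}"
  using assms unfolding minimal_subshift_def by blast

lemma closedin_word_in:
  "closedin (full_shift A) {z. (\<forall>i. z i \<in> A) \<and> word z k n \<in> W}"
proof -
  let ?C = "\<lambda>y. {z. (\<forall>i. z i \<in> A) \<and> word z k n = word y k n}"
  have "topspace (full_shift A) - {z. (\<forall>i. z i \<in> A) \<and> word z k n \<in> W}
      = \<Union> (?C ` {y. (\<forall>i. y i \<in> A) \<and> word y k n \<notin> W})"
    by (auto simp: topspace_full_shift)
  moreover have "openin (full_shift A) (\<Union> (?C ` {y. (\<forall>i. y i \<in> A) \<and> word y k n \<notin> W}))"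
    by (rule openin_Union) (use openin_cylinder in auto)
  ultimately have "openin (full_shift A) (topspace (full_shift A) - {z. (\<forall>i. z i \<in> A) \<and> word z k n \<in> W})"
    by simp
  then show ?thesis by (auto simp: closedin_def topspace_full_shift)
qed

lemma compact_full_shift: "finite A \<Longrightarrow> compact_space (full_shift A)"
  by (simp add: full_shift_def compact_space_product_topology compact_space_discrete_topology)

text \<open>Common words of unbounded length can be centred at the origin. By compactness some point
  of \<open>M\<close> has only words of \<open>N\<close>, so it lies in both, although distinct
  minimal subshifts are disjoint.\<close>

lemma minimal_words_separated:
  assumes M: "minimal_subshift A M" and N: "minimal_subshift A N" and ne: "M \<noteq> N"
  shows "\<exists>n0. \<forall>n\<ge>n0. words M n \<inter> words N n = {}"
proof (rule ccontr)
  assume "\<not> ?thesis"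
  then have common: "\<exists>n\<ge>n0. words M n \<inter> words N n \<noteq> {}" for n0 by blast
  have sM: "subshift A M" and sN: "subshift A N" using M N by (auto simp: minimal_subshift_def)
  define F where "F r = M \<inter> {z. (\<forall>i. z i \<in> A) \<and> word z (- int r) (2 * r) \<in> words N (2 * r)}" for r
  have "(\<Inter>r. F r) \<noteq> {}"
  proof (rule compact_space_imp_nest)
    show "compact_space (full_shift A)" using sM by (intro compact_full_shift) (simp add: subshift_def)
    show "closedin (full_shift A) (F r)" for r
      unfolding F_def using sM by (intro closedin_Int closedin_word_in) (simp add: subshift_def)
    show "F r \<noteq> {}" for r
    proof -
      obtain n where n: "n \<ge> 2 * r" "words M n \<inter> words N n \<noteq> {}" using common by blast
      then obtain z k where z: "z \<in> M" "word z k n \<in> words N n" by (auto simp: words_def)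
      define u where "u i = z (i + (k + int r))" for i
      have uM: "u \<in> M" unfolding u_def by (rule subshift_translate[OF sM z(1)])
      have "word u (- int r) (2 * r) = word z k (2 * r)" by (simp add: word_eq_iff u_def algebra_simps)
      moreover have "word z k (2 * r) \<in> words N (2 * r)"
        using n by (intro subword_in_words[OF z(2)]) auto
      ultimately have "u \<in> F r" using uM subshift_letters[OF sM uM] by (simp add: F_def)
      then show ?thesis by blast
    qed
    show "decseq F"
    proof (rule decseq_SucI, rule subsetI)
      fix r z assume z: "z \<in> F (Suc r)"
      have "word z (- int r) (2 * r) \<in> words N (2 * r)"
        by (rule subword_in_words[of z "- int (Suc r)" "2 * Suc r"]) (use z in \<open>auto simp: F_def\<close>)
      then show "z \<in> F r" using z by (simp add: F_def)
    qed
  qed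
  then obtain z where z: "\<And>r. z \<in> F r" by blast
  have "word z k n \<in> words N n" for k n
  proof -
    define r where "r = nat \<bar>k\<bar> + n"
    have "word z (- int r) (2 * r) \<in> words N (2 * r)" using z[of r] by (simp add: F_def)
    then show ?thesis by (rule subword_in_words) (auto simp: r_def)
  qed
  then have "z \<in> N" using mem_subshift_words[OF sN, of z] by blast
  moreover have "z \<in> M" using z[of 0] by (simp add: F_def)
  ultimately show False using minimal_disjoint[OF M N ne] by blast
qed

text \<open>A word of \<open>x\<close> whose \<open>n\<close> labels are not monochromatic is no
  word of any minimal subsystem, and long words of different subsystems are distinct. The former
  give \<open>c n\<close>, and each infinite subsystem gives at least \<open>n + N\<close> by Morse
  and Hedlund.\<close>

lemma complexity_lower_bound:
  fixes A :: "'a set"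
  assumes j: "2 \<le> j" and xA: "\<And>k. x k \<in> A" and sub: "subshift A X"
    and X: "X = orbit_closure A x" and rec: "recurrent x" and counts: "has_minimal_counts A X j i"
  obtains N and c :: "nat \<Rightarrow> nat" where
    "\<And>n. 1 \<le> n \<Longrightarrow> i * (n + N) + c n \<le> complexity X (n + N)"
    "\<And>C. \<exists>n\<ge>1. (j + 1) * n + C \<le> c n"
    "\<And>m n. 1 \<le> m \<Longrightarrow> m \<le> n \<Longrightarrow> c m + j * (n - m) \<le> c n"
proof -
  define PM where "PM = proper_minimal_subsystems A X"
  have PM: "finite PM" "card PM = j" "card {M \<in> PM. infinite M} = i"
    using counts by (auto simp: has_minimal_counts_def PM_def)
  obtain f where f: "bij_betw f {1..j} PM"
    using ex_bij_betw_nat_finite_1[OF PM(1)] PM(2) by auto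
  have fmin: "minimal_subshift A (f k)" "f k \<subseteq> X" if "k \<in> {1..j}" for k
    using bij_betwE[OF f] that by (auto simp: PM_def proper_minimal_subsystems_def)
  have fsub: "subshift A (f k)" "f k \<noteq> {}" if "k \<in> {1..j}" for k
    using fmin(1)[OF that] by (auto simp: minimal_subshift_def)
  have fne: "f k \<noteq> f l" if "k \<in> {1..j}" "l \<in> {1..j}" "k \<noteq> l" for k l
    using f that by (auto simp: bij_betw_def dest: inj_onD)
  define sep where "sep p = (SOME n0. \<forall>n\<ge>n0. words (f (fst p)) n \<inter> words (f (snd p)) n = {})" for p
  have sep: "\<forall>n\<ge>sep (k, l). words (f k) n \<inter> words (f l) n = {}"
    if "k \<in> {1..j}" "l \<in> {1..j}" "k \<noteq> l" for k l
  proof -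
    have "\<exists>n0. \<forall>n\<ge>n0. words (f k) n \<inter> words (f l) n = {}"
      by (rule minimal_words_separated[OF fmin(1)[OF that(1)] fmin(1)[OF that(2)] fne[OF that]])
    then show ?thesis unfolding sep_def fst_conv snd_conv by (rule someI_ex)
  qed
  define N where "N = Max (sep ` ({1..j} \<times> {1..j}))"
  have disj: "words (f k) n \<inter> words (f l) n = {}"
    if "k \<in> {1..j}" "l \<in> {1..j}" "k \<noteq> l" "n \<ge> N" for k l n
  proof -
    have "sep (k, l) \<le> N" unfolding N_def using that by (intro Max_ge) auto
    then show ?thesis using sep[OF that(1-3)] that(4) by simp
  qed
  \<comment> \<open>A letter of \<open>y\<close> is a window of \<open>N + 1\<close> letters, one
    more than separation requires. Neighbouring letters share a window of length \<open>N\<close>,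
    which rules out two different nonzero labels side by side. A word of length \<open>n\<close> in
    \<open>y\<close> corresponds to \<open>n + N\<close> letters of \<open>x\<close>.\<close>
  define y where "y t = word x t (Suc N)" for t
  define lab where "lab w = (if \<exists>k\<in>{1..j}. w \<in> words (f k) (Suc N)
      then SOME k. k \<in> {1..j} \<and> w \<in> words (f k) (Suc N) else 0)" for w
  have lab1: "lab w = k" if "k \<in> {1..j}" "w \<in> words (f k) (Suc N)" for w k
  proof -
    have "\<exists>k. k \<in> {1..j} \<and> w \<in> words (f k) (Suc N)" using that by blast
    from someI_ex[OF this] have s: "lab w \<in> {1..j}" "w \<in> words (f (lab w)) (Suc N)"
      using that unfolding lab_def by auto
    show ?thesis using disj[OF s(1) that(1), of "Suc N"] s(2) that(2) by auto
  qed
  have lab2: "lab w \<in> {1..j}" "w \<in> words (f (lab w)) (Suc N)" if "lab w \<noteq> 0" for w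
  proof -
    have "\<exists>k. k \<in> {1..j} \<and> w \<in> words (f k) (Suc N)" using that by (auto simp: lab_def split: if_splits)
    then obtain k where "k \<in> {1..j}" "w \<in> words (f k) (Suc N)" by blast
    then show "lab w \<in> {1..j}" "w \<in> words (f (lab w)) (Suc N)" using lab1 by simp_all
  qed
  have wX: "words X n = {word x t n | t. True}" for n
    unfolding X by (rule words_orbit_closure[OF xA])
  have fin: "finite (range y)"
    by (rule finite_subset[OF _ finite_words[OF sub, of "Suc N"]]) (auto simp: y_def wX)
  have ywords: "word y t n = word y t' n" if "word x t (n + N) = word x t' (n + N)" for t t' n
  proof (rule word_eqI)
    fix i assume i: "0 \<le> i" "i < int n"
    show "y (t + i) = y (t' + i)"
      using subword_eq[OF that, of "t + i" "Suc N"] i by (simp add: y_def)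
  qed
  have recy: "recurrent y"
    unfolding recurrent_def
  proof (intro allI)
    fix k n
    obtain m where "m \<noteq> k" "word x m (n + N) = word x k (n + N)"
      using rec unfolding recurrent_def by blast
    then show "\<exists>m. m \<noteq> k \<and> word y m n = word y k n" using ywords by blast
  qed
  have long: "\<exists>t. \<forall>i. t \<le> i \<and> i < t + int n \<longrightarrow> lab (y i) = k" if k: "k \<in> {1..j}" for k n
  proof -
    obtain z where z: "z \<in> f k" using fsub[OF k] by blast
    then have "word z 0 (n + N) \<in> words X (n + N)" using fmin(2)[OF k] by (auto intro: word_in_words)
    then obtain t where t: "word x t (n + N) = word z 0 (n + N)" by (auto simp: wX)
    then have tw: "word x t (n + N) \<in> words (f k) (n + N)" using z by (simp add: word_in_words)
    have "lab (y i) = k" if "t \<le> i" "i < t + int n" for i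
      unfolding y_def using that by (intro lab1[OF k] subword_in_words[OF tw]) auto
    then show ?thesis by blast
  qed
  have adj: "lab (y t) = 0 \<or> lab (y (t + 1)) = 0" if ne: "lab (y t) \<noteq> lab (y (t + 1))" for t
  proof (rule ccontr)
    assume "\<not> ?thesis"
    then have nz: "lab (y t) \<noteq> 0" "lab (y (t + 1)) \<noteq> 0" by auto
    define k l where "k = lab (y t)" and "l = lab (y (t + 1))"
    have k: "k \<in> {1..j}" "word x t (Suc N) \<in> words (f k) (Suc N)"
      using lab2[OF nz(1)] unfolding k_def[symmetric] by (simp_all add: y_def)
    have l: "l \<in> {1..j}" "word x (t + 1) (Suc N) \<in> words (f l) (Suc N)"
      using lab2[OF nz(2)] unfolding l_def[symmetric] by (simp_all add: y_def)
    have "word x (t + 1) N \<in> words (f k) N" by (rule subword_in_words[OF k(2)]) auto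
    moreover have "word x (t + 1) N \<in> words (f l) N" by (rule subword_in_words[OF l(2)]) auto
    moreover have "words (f k) N \<inter> words (f l) N = {}"
      using ne by (intro disj[OF k(1) l(1)]) (simp_all add: k_def l_def)
    ultimately show False by blast
  qed
  define c where "c n = card (nonmono_words y lab j n)" for n
  show ?thesis
  proof (rule that[of N c])
    show "\<exists>n\<ge>1. (j + 1) * n + C \<le> c n" for C
      unfolding c_def by (rule nonmono_words_growth(1)[where y = y and lab = lab and j = j, OF fin j recy long adj])
    show "c m + j * (n - m) \<le> c n" if "1 \<le> m" "m \<le> n" for m n
      unfolding c_def by (rule nonmono_words_growth(2)[where y = y and lab = lab and j = j, OF fin j recy long adj that])
    fix n :: nat assume n: "1 \<le> n"
    define Z where "Z = {word x t (n + N) | t. \<forall>k\<in>{1..j}. \<exists>l<n. lab (y (t + int l)) \<noteq> k}"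
    define g where "g w = map (\<lambda>l. take (Suc N) (drop l w)) [0..<n]" for w :: "'a list"
    have g: "g (word x t (n + N)) = word y t n" for t
      by (rule nth_equalityI) (auto simp: g_def y_def drop_word take_word)
    have ZX: "Z \<subseteq> words X (n + N)" by (auto simp: Z_def wX)
    have finX: "finite (words X (n + N))" by (rule finite_words[OF sub])
    then have finZ: "finite Z" using ZX by (rule finite_subset[rotated])
    have "nonmono_words y lab j n \<subseteq> g ` Z"
    proof
      fix w assume "w \<in> nonmono_words y lab j n"
      then obtain t where "w = word y t n" "\<forall>k\<in>{1..j}. \<exists>l<n. lab (y (t + int l)) \<noteq> k"
        unfolding nonmono_words_def by blast
      then have "w = g (word x t (n + N))" "word x t (n + N) \<in> Z" by (auto simp: g Z_def)
      then show "w \<in> g ` Z" by blast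
    qed
    then have cZ: "c n \<le> card Z" unfolding c_def by (rule surj_card_le[OF finZ])
    let ?U = "\<Union>k\<in>{1..j}. words (f k) (n + N)"
    have finW: "finite (words (f k) (n + N))" if "k \<in> {1..j}" for k
      by (rule finite_words[OF fsub(1)[OF that]])
    have finU: "finite ?U" by (rule finite_UN_I) (simp_all only: finW finite_atLeastAtMost)
    have cU: "card ?U = (\<Sum>k\<in>{1..j}. card (words (f k) (n + N)))"
    proof (rule card_UN_disjoint)
      show "\<forall>k\<in>{1..j}. \<forall>l\<in>{1..j}. k \<noteq> l \<longrightarrow> words (f k) (n + N) \<inter> words (f l) (n + N) = {}"
        by (intro ballI impI disj) simp_all
    qed (rule finite_atLeastAtMost, intro ballI finW)
    have "Z \<inter> ?U = {}"
    proof (rule ccontr)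
      assume "Z \<inter> ?U \<noteq> {}"
      then obtain t k where t: "\<forall>k\<in>{1..j}. \<exists>l<n. lab (y (t + int l)) \<noteq> k"
        and k: "k \<in> {1..j}" "word x t (n + N) \<in> words (f k) (n + N)" unfolding Z_def by blast
      obtain l where l: "l < n" "lab (y (t + int l)) \<noteq> k" using t k by blast
      have "lab (y (t + int l)) = k"
        unfolding y_def using l by (intro lab1[OF k(1)] subword_in_words[OF k(2)]) auto
      then show False using l by simp
    qed
    then have "card (Z \<union> ?U) = card Z + card ?U" using finZ finU by (intro card_Un_disjoint)
    moreover have "Z \<union> ?U \<subseteq> words X (n + N)"
    proof -
      have "words (f k) (n + N) \<subseteq> words X (n + N)" if "k \<in> {1..j}" for k
        using fmin(2)[OF that] unfolding words_def by blast
      then show ?thesis using ZX by blast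
    qed
    then have "card (Z \<union> ?U) \<le> complexity X (n + N)"
      unfolding complexity_def by (intro card_mono finX)
    moreover have "i * (n + N) \<le> card ?U"
    proof -
      have "bij_betw f {k \<in> {1..j}. infinite (f k)} {M \<in> PM. infinite M}"
        using f unfolding bij_betw_def by (auto intro: inj_on_subset)
      from bij_betw_same_card[OF this] have "card {k \<in> {1..j}. infinite (f k)} = i"
        by (simp only: PM(3))
      then have "i * (n + N) = (\<Sum>k\<in>{k \<in> {1..j}. infinite (f k)}. n + N)" by simp
      also have "\<dots> \<le> (\<Sum>k\<in>{k \<in> {1..j}. infinite (f k)}. card (words (f k) (n + N)))"
      proof (rule sum_mono)
        fix k assume "k \<in> {k \<in> {1..j}. infinite (f k)}"
        then have "k \<in> {1..j}" "infinite (f k)" by simp_all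
        then show "n + N \<le> card (words (f k) (n + N))"
          using Morse_Hedlund[OF fsub(1), of k "n + N"] by simp
      qed
      also have "\<dots> \<le> (\<Sum>k\<in>{1..j}. card (words (f k) (n + N)))"
        by (rule sum_mono2) auto
      finally show ?thesis by (simp only: cU)
    qed
    ultimately show "i * (n + N) + c n \<le> complexity X (n + N)" using cZ by linarith
  qed
qed

text \<open>The values are finite, so an unbounded sequence stays unbounded after any initial
  segment is dropped.\<close>

lemma limsup_eq_PInfty:
  fixes f :: "nat \<Rightarrow> real"
  assumes "\<And>C. \<exists>n. C \<le> f n"
  shows "limsup (\<lambda>n. ereal (f n)) = \<infinity>"
proof (rule ccontr)
  assume "limsup (\<lambda>n. ereal (f n)) \<noteq> \<infinity>"
  then obtain B where B: "limsup (\<lambda>n. ereal (f n)) < ereal B"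
    by (metis ereal_dense2 ereal_infty_less(1))
  then have "\<forall>\<^sub>F n in sequentially. ereal (f n) < ereal B" by (rule Limsup_lessD)
  then obtain n0 where n0: "\<And>n. n \<ge> n0 \<Longrightarrow> f n < B" by (auto simp: eventually_sequentially)
  define D where "D = Max (insert B (f ` {..n0}))"
  have "f n \<le> D" for n
  proof (cases "n \<ge> n0")
    case True
    have "B \<le> D" unfolding D_def by (intro Max_ge) auto
    then show ?thesis using n0[OF True] by simp
  next
    case False
    then show ?thesis unfolding D_def by (intro Max_ge) auto
  qed
  moreover obtain n where "D + 1 \<le> f n" using assms by blast
  ultimately show False by (smt (verit))
qed

theorem complexity_limits:
  fixes A :: "'a set"
  assumes j: "2 \<le> j" and t: "transitive_subshift A X" "x \<in> X" "recurrent x" "X = orbit_closure A x"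
    and counts: "has_minimal_counts A X j i"
  shows "limsup (\<lambda>n. ereal (real (complexity X n) - real (j + i + 1) * real n)) = \<infinity>"
    and "liminf (\<lambda>n. ereal (real (complexity X n) - real (j + i) * real n)) = \<infinity>"
proof -
  have sub: "subshift A X" using t by (simp add: transitive_subshift_def)
  have xA: "x k \<in> A" for k by (rule subshift_letters[OF sub t(2)])
  obtain N c where c: "\<And>n. 1 \<le> n \<Longrightarrow> i * (n + N) + c n \<le> complexity X (n + N)"
    "\<And>C. \<exists>n\<ge>1. (j + 1) * n + C \<le> c n"
    "\<And>m n. 1 \<le> m \<Longrightarrow> m \<le> n \<Longrightarrow> c m + j * (n - m) \<le> c n"
    by (rule complexity_lower_bound[OF j xA sub t(4,3) counts]) blast
  show "limsup (\<lambda>n. ereal (real (complexity X n) - real (j + i + 1) * real n)) = \<infinity>"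
  proof (rule limsup_eq_PInfty)
    fix C :: real
    \<comment> \<open>The summand \<open>(j + 1) * N\<close> pays for passing from length
      \<open>n\<close> to \<open>n + N\<close>.\<close>
    obtain n where n: "n \<ge> 1" "(j + 1) * n + (nat \<lceil>C\<rceil> + (j + 1) * N) \<le> c n" using c(2) by blast
    have "(j + i + 1) * (n + N) + nat \<lceil>C\<rceil> \<le> complexity X (n + N)"
      using c(1)[OF n(1)] n(2) by (simp add: algebra_simps)
    then have "real ((j + i + 1) * (n + N) + nat \<lceil>C\<rceil>) \<le> real (complexity X (n + N))"
      by (simp only: of_nat_le_iff)
    moreover have "C \<le> real (nat \<lceil>C\<rceil>)" by linarith
    ultimately show "\<exists>n. C \<le> real (complexity X n) - real (j + i + 1) * real n"
      by (intro exI[of _ "n + N"]) (simp add: algebra_simps)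
  qed
  have "filterlim (\<lambda>n. real (complexity X n) - real (j + i) * real n) at_top sequentially"
    unfolding filterlim_at_top eventually_sequentially
  proof
    fix C :: real
    \<comment> \<open>As \<open>c\<close> grows by at least \<open>j\<close> per step, a large
      surplus over \<open>j * m\<close> at one length is kept at all later ones.\<close>
    obtain m where m: "m \<ge> 1" "(j + 1) * m + (nat \<lceil>C\<rceil> + j * N) \<le> c m" using c(2) by blast
    have "C \<le> real (complexity X n') - real (j + i) * real n'" if n': "n' \<ge> m + N" for n'
    proof -
      define n where "n = n' - N"
      have n: "n' = n + N" "n \<ge> m" using n' by (auto simp: n_def)
      have "j * m + j * (n - m) = j * n" using n(2) by (metis add_mult_distrib2 le_add_diff_inverse)
      then have "j * n + nat \<lceil>C\<rceil> + j * N \<le> c n" using m c(3)[OF m(1) n(2)] by (simp add: algebra_simps)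
      then have "(j + i) * n' + nat \<lceil>C\<rceil> \<le> complexity X n'"
        using c(1)[of n] m(1) n by (simp add: algebra_simps)
      then have "real ((j + i) * n' + nat \<lceil>C\<rceil>) \<le> real (complexity X n')"
        by (simp only: of_nat_le_iff)
      moreover have "C \<le> real (nat \<lceil>C\<rceil>)" by linarith
      ultimately show ?thesis by (simp add: algebra_simps)
    qed
    then show "\<exists>N. \<forall>n\<ge>N. C \<le> real (complexity X n) - real (j + i) * real n" by blast
  qed
  then have "((\<lambda>n. ereal (real (complexity X n) - real (j + i) * real n)) \<longlongrightarrow> \<infinity>) sequentially"
    by (simp only: tendsto_PInfty_eq_at_top)
  then show "liminf (\<lambda>n. ereal (real (complexity X n) - real (j + i) * real n)) = \<infinity>"
    by (intro lim_imp_Liminf) simp_all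
qed

section \<open>A Sturmian point\<close>

definition fl :: "int \<Rightarrow> int" where
  "fl m = \<lfloor>of_int m * sqrt 2\<rfloor>"

text \<open>The coding of the rotation by \<open>sqrt 2\<close>. The starting point is moved by one step, because
  from \<open>0\<close> the words before and after the origin would differ in one letter in
  \<open>sturm_square\<close> below.\<close>
definition sturm :: "int \<Rightarrow> nat" where
  "sturm m = nat (fl (m + 2) - fl (m + 1))"

text \<open>Infinite descent on \<open>2 * a^2 = b^2\<close>.\<close>

lemma sqrt2_irrational:
  assumes "0 < d" shows "of_int d * sqrt 2 \<noteq> of_int c"
proof
  assume "of_int d * sqrt 2 = of_int c"
  then have "(of_int d * sqrt 2)\<^sup>2 = (of_int c)\<^sup>2" by simp
  then have "of_int (2 * d\<^sup>2) = (of_int (c\<^sup>2) :: real)" by (simp add: power_mult_distrib)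
  then have eq: "2 * d\<^sup>2 = c\<^sup>2" by (simp only: of_int_eq_iff)
  have no: "\<not> 2 * (int a)\<^sup>2 = (int b)\<^sup>2" if "0 < a" for a b
    using that
  proof (induction a arbitrary: b rule: less_induct)
    case (less a)
    show ?case
    proof
      assume e: "2 * (int a)\<^sup>2 = (int b)\<^sup>2"
      then have "even ((int b)\<^sup>2)" by (metis dvd_triv_left)
      then have "even b" by simp
      then obtain b' where b': "b = 2 * b'" by (rule evenE)
      then have e2: "(int a)\<^sup>2 = 2 * (int b')\<^sup>2" using e by (simp add: power_mult_distrib)
      have b0: "0 < b'"
      proof (rule ccontr)
        assume "\<not> 0 < b'" then have "(int a)\<^sup>2 = 0" using e2 by simp
        then show False using less.prems by simp
      qed
      have "b' < a"
      proof (rule ccontr)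
        assume "\<not> b' < a"
        then have "(int a)\<^sup>2 \<le> (int b')\<^sup>2" by (intro power_mono) auto
        moreover have "0 < (int b')\<^sup>2" using b0 by simp
        ultimately show False using e2 by linarith
      qed
      then show False using less.IH[OF _ b0, of a] e2 by simp
    qed
  qed
  show False using no[of "nat d" "nat \<bar>c\<bar>"] eq assms by simp
qed

lemma frac_sqrt2_pos: "0 < d \<Longrightarrow> 0 < frac (of_int d * sqrt 2)"
proof -
  assume d: "0 < d"
  have "frac (of_int d * sqrt 2) \<noteq> 0"
  proof
    assume "frac (of_int d * sqrt 2) = 0"
    then have "of_int d * sqrt 2 = of_int \<lfloor>of_int d * sqrt 2\<rfloor>" by (simp add: frac_def)
    then show False using sqrt2_irrational[OF d] by blast
  qed
  then show ?thesis using frac_ge_0[of "of_int d * sqrt 2"] by linarith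
qed

lemma sqrt2_bounds: "1.4 < sqrt 2" "sqrt 2 < 1.5"
  by (rule real_less_rsqrt, simp add: power2_eq_square) (rule real_less_lsqrt, simp_all add: power2_eq_square)

text \<open>The odd powers of \<open>sqrt 2 - 1\<close> have the form \<open>a * sqrt 2 - b\<close>.\<close>
lemma frac_sqrt2_small:
  assumes "0 < \<epsilon>" shows "\<exists>a::int. 0 < a \<and> frac (of_int a * sqrt 2) < \<epsilon>"
proof -
  have pow: "\<exists>a b::int. 0 < a \<and> 0 < b \<and> of_int a * sqrt 2 - of_int b = (sqrt 2 - 1) ^ (2 * n + 1)" for n
  proof (induction n)
    case 0 show ?case by (intro exI[of _ 1]) simp
  next
    case (Suc n)
    then obtain a b :: int where ab: "0 < a" "0 < b"
      "of_int a * sqrt 2 - of_int b = (sqrt 2 - 1) ^ (2 * n + 1)" by blast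
    have "(sqrt 2 - 1) ^ (2 * Suc n + 1) = (sqrt 2 - 1)\<^sup>2 * (sqrt 2 - 1) ^ (2 * n + 1)"
      by (simp add: power_add[symmetric] eval_nat_numeral)
    also have "\<dots> = (3 - 2 * sqrt 2) * (of_int a * sqrt 2 - of_int b)"
      by (simp only: ab(3)) (simp add: power2_eq_square algebra_simps)
    also have "\<dots> = of_int (3 * a + 2 * b) * sqrt 2 - of_int (4 * a + 3 * b)"
      by (simp add: algebra_simps)
    finally show ?case using ab by (intro exI[of _ "3 * a + 2 * b"] exI[of _ "4 * a + 3 * b"]) auto
  qed
  obtain n where n: "(sqrt 2 - 1) ^ n < \<epsilon>"
    using real_arch_pow_inv[OF assms, of "sqrt 2 - 1"] sqrt2_bounds by auto
  obtain a b :: int where ab: "0 < a" "of_int a * sqrt 2 - of_int b = (sqrt 2 - 1) ^ (2 * n + 1)"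
    using pow by blast
  have small: "(sqrt 2 - 1) ^ (2 * n + 1) \<le> (sqrt 2 - 1) ^ n"
    using sqrt2_bounds by (intro power_decreasing) auto
  have "0 < (sqrt 2 - 1) ^ (2 * n + 1)" using sqrt2_bounds by (intro zero_less_power) auto
  moreover have "(sqrt 2 - 1) ^ (2 * n + 1) < 1"
    using sqrt2_bounds by (intro power_Suc_less_one[of _ "2 * n", unfolded Suc_eq_plus1]) auto
  ultimately have "0 < of_int a * sqrt 2 - of_int b" "of_int a * sqrt 2 - of_int b < 1"
    by (simp_all only: ab(2))
  then have "frac (of_int a * sqrt 2) = of_int a * sqrt 2 - of_int b"
    by (simp add: frac_unique_iff)
  then show ?thesis using ab n small by (intro exI[of _ a]) auto
qed

lemma fl_add: "fl (m + k) = fl m + \<lfloor>frac (of_int m * sqrt 2) + of_int k * sqrt 2\<rfloor>"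
proof -
  have "of_int (m + k) * sqrt 2 = of_int (fl m) + (frac (of_int m * sqrt 2) + of_int k * sqrt 2)"
    by (simp add: fl_def frac_def algebra_simps)
  then show ?thesis unfolding fl_def[of "m + k"] by (simp only: floor_add_int[symmetric] add.commute) linarith
qed

lemma sturm_range: "sturm m \<in> {1, 2}"
proof -
  have "fl (m + 1 + 1) = fl (m + 1) + \<lfloor>frac (of_int (m + 1) * sqrt 2) + of_int 1 * sqrt 2\<rfloor>"
    by (rule fl_add)
  moreover have "\<lfloor>f + of_int 1 * sqrt 2\<rfloor> \<in> {1, 2}" if "0 \<le> f" "f < 1" for f
    using that sqrt2_bounds by (simp add: floor_eq_iff) linarith
  from this[OF frac_ge_0 frac_lt_1]
  have "\<lfloor>frac (of_int (m + 1) * sqrt 2) + of_int 1 * sqrt 2\<rfloor> \<in> {1, 2}" .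
  ultimately show ?thesis by (auto simp: sturm_def add.commute)
qed

lemma fl_diff: "fl (m + 2) - fl (m + 1) = int (sturm m)"
  using sturm_range[of m] by (auto simp: sturm_def)

text \<open>Choose \<open>a\<close> as a record time of the rotation:
  \<open>frac (a * sqrt 2)\<close> is smaller than at all positive times before \<open>a\<close>.
  Adding it to \<open>k * sqrt 2\<close> with \<open>-a < k \<le> 1\<close> crosses no integer, so
  the floors before \<open>a\<close> are those before \<open>0\<close>, translated.\<close>

lemma sturm_square: "\<exists>a>B. \<forall>m. 0 \<le> m \<and> m < int a \<longrightarrow> sturm (m - int a) = sturm m"
proof -
  define F where "F q = frac (of_int q * sqrt 2)" for q :: int
  \<comment> \<open>Falling below the minimum over \<open>1..B + 1\<close> forces the record time
    beyond \<open>B + 1\<close>.\<close>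
  define \<mu> where "\<mu> = Min (F ` {1..int B + 1})"
  have "0 < \<mu>" unfolding \<mu>_def using frac_sqrt2_pos by (subst Min_gr_iff) (auto simp: F_def)
  obtain q0 :: int where q0: "0 < q0" "F q0 < \<mu>" using frac_sqrt2_small[OF \<open>0 < \<mu>\<close>] by (auto simp: F_def)
  define a where "a = (LEAST a. 0 < a \<and> F (int a) < \<mu>)"
  have "0 < nat q0 \<and> F (int (nat q0)) < \<mu>" using q0 by simp
  then have a: "0 < a \<and> F (int a) < \<mu>" unfolding a_def by (rule LeastI)
  have least: "\<mu> \<le> F q" if "0 < q" "q < int a" for q
  proof (rule ccontr)
    assume "\<not> ?thesis"
    then have "0 < nat q \<and> F (int (nat q)) < \<mu>" using that by simp
    then have "a \<le> nat q" unfolding a_def by (rule Least_le)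
    then show False using that by simp
  qed
  have aB: "a > B + 1"
  proof (rule ccontr)
    assume "\<not> a > B + 1"
    then have "\<mu> \<le> F (int a)" unfolding \<mu>_def using a by (intro Min_le) auto
    then show False using a by simp
  qed
  have rec: "F (int a) < F q" if "0 < q" "q < int a" for q using least[OF that] a by simp
  \<comment> \<open>At the excluded \<open>k = -a\<close> the two fractional parts add up to exactly
    \<open>1\<close>. Thanks to the shifted start in \<open>sturm\<close>, only
    \<open>-a < k \<le> 1\<close> occurs below.\<close>
  have shift: "fl (int a + k) = fl (int a) + fl k" if k: "- int a < k" "k \<le> 1" for k
  proof -
    have fa: "0 \<le> F (int a)" "F (int a) < 1" unfolding F_def by (rule frac_ge_0, rule frac_lt_1)
    have "\<lfloor>F (int a) + of_int k * sqrt 2\<rfloor> = \<lfloor>of_int k * sqrt 2\<rfloor>"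
    proof -
      have "F (int a) + frac (of_int k * sqrt 2) < 1"
      proof -
        consider "k = 1" | "k = 0" | "k < 0" using k by linarith
        then show ?thesis
        proof cases
          case 1
          have "\<lfloor>sqrt 2\<rfloor> = 1" using sqrt2_bounds by (simp add: floor_eq_iff)
          then have f1: "F 1 = sqrt 2 - 1" by (simp add: F_def frac_def)
          have "F (int a) < F 1" using aB by (intro rec) auto
          then show ?thesis using f1 1 sqrt2_bounds by (simp add: F_def)
        next
          case 2 then show ?thesis using fa by simp
        next
          case 3
          have "F (int a) < F (- k)" using 3 k by (intro rec) auto
          moreover have "frac (of_int k * sqrt 2) = 1 - F (- k)"
          proof -
            have "0 < F (- k)" unfolding F_def using 3 by (intro frac_sqrt2_pos) simp
            moreover have "F (- k) < 1" unfolding F_def by (rule frac_lt_1)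
            moreover have i: "of_int (- k) * sqrt 2 - F (- k) \<in> \<int>"
              unfolding F_def frac_def by simp
            moreover have "of_int k * sqrt 2 - (1 - F (- k)) \<in> \<int>"
              using Ints_diff[OF Ints_minus[OF i] Ints_1] by (simp add: algebra_simps)
            ultimately show ?thesis by (simp add: frac_unique_iff)
          qed
          ultimately show ?thesis by simp
        qed
      qed
      moreover have "0 \<le> frac (of_int k * sqrt 2)" by (rule frac_ge_0)
      ultimately show ?thesis using fa by (simp add: frac_def floor_eq_iff) linarith
    qed
    then show ?thesis using fl_add[of "int a" k] by (simp add: F_def fl_def)
  qed
  have "sturm (m - int a) = sturm m" if m: "0 \<le> m" "m < int a" for m
  proof -
    have "fl (int a + (m - int a + 2)) = fl (int a) + fl (m - int a + 2)"
      "fl (int a + (m - int a + 1)) = fl (int a) + fl (m - int a + 1)"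
      by (rule shift; use m in simp)+
    then show ?thesis by (simp add: sturm_def)
  qed
  then show ?thesis using aB by (intro exI[of _ a]) auto
qed

lemma sturm_word_cong:
  assumes "\<And>l. l \<le> n \<Longrightarrow> \<lfloor>frac (of_int (p + 1) * sqrt 2) + of_int (int l) * sqrt 2\<rfloor> =
      \<lfloor>frac (of_int (q + 1) * sqrt 2) + of_int (int l) * sqrt 2\<rfloor>"
  shows "word sturm p n = word sturm q n"
  unfolding word_eq_iff
proof (intro allI impI)
  fix l assume l: "l < n"
  have *: "fl (p + 1 + int l) - fl (p + 1) = fl (q + 1 + int l) - fl (q + 1)" if "l \<le> n" for l
    using assms[OF that] fl_add[of "p + 1" "int l"] fl_add[of "q + 1" "int l"] by simp
  have "fl (p + int l + 2) - fl (p + int l + 1) = fl (q + int l + 2) - fl (q + int l + 1)"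
    using *[of l] *[of "Suc l"] l by (simp add: algebra_simps)
  then show "sturm (p + int l) = sturm (q + int l)" by (simp add: sturm_def)
qed

text \<open>\<open>\<epsilon>\<close> is the room by which the starting angle \<open>\<tau>\<close>
  can grow before one of the \<open>n + 1\<close> floors changes. Steps of \<open>a\<close> advance
  the angle by \<open>\<delta> < \<epsilon>\<close>, so within \<open>K\<close> such steps from any
  \<open>t\<close> the angle falls into \<open>[\<tau>, \<tau> + \<delta>)\<close>.\<close>

lemma sturm_uniformly_recurrent:
  "\<exists>L. \<forall>t. \<exists>q. t \<le> q \<and> q + int n \<le> t + int L \<and> word sturm q n = word sturm p n"
proof -
  define \<tau> where "\<tau> = frac (of_int (p + 1) * sqrt 2)"
  define \<epsilon> where "\<epsilon> = Min ((\<lambda>l. 1 - frac (\<tau> + of_int (int l) * sqrt 2)) ` {..n})"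
  have e0: "0 < \<epsilon>" unfolding \<epsilon>_def by (subst Min_gr_iff) (auto simp: frac_lt_1)
  have e: "\<epsilon> \<le> 1 - frac (\<tau> + of_int (int l) * sqrt 2)" if "l \<le> n" for l
    unfolding \<epsilon>_def using that by (intro Min_le) auto
  have \<tau>: "0 \<le> \<tau>" "\<tau> < 1" unfolding \<tau>_def by (rule frac_ge_0, rule frac_lt_1)
  have "frac \<tau> = \<tau>" using \<tau> by (simp add: frac_eq)
  then have te: "\<tau> + \<epsilon> \<le> 1" using e[of 0] by simp
  obtain a :: int where a: "0 < a" "frac (of_int a * sqrt 2) < \<epsilon>" using frac_sqrt2_small[OF e0] by blast
  define \<delta> where "\<delta> = frac (of_int a * sqrt 2)"
  have d: "0 < \<delta>" "\<delta> < \<epsilon>" using a frac_sqrt2_pos[OF a(1)] by (auto simp: \<delta>_def)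
  define K where "K = \<lceil>1 / \<delta>\<rceil> + 1"
  have "0 < 1 / \<delta>" using d by simp
  then have "0 < \<lceil>1 / \<delta>\<rceil>" by (simp only: zero_less_ceiling)
  then have K: "0 \<le> K" unfolding K_def by linarith
  have "\<exists>q. t \<le> q \<and> q + int n \<le> t + int (nat (K * a) + n) \<and> word sturm q n = word sturm p n" for t
  proof -
    define u where "u = frac (of_int (t + 1) * sqrt 2)"
    have u: "0 \<le> u" "u < 1" unfolding u_def by (rule frac_ge_0, rule frac_lt_1)
    \<comment> \<open>\<open>v\<close> is the forward distance from \<open>u\<close> to
      \<open>\<tau>\<close> on the circle.\<close>
    define v where "v = (if u \<le> \<tau> then \<tau> - u else \<tau> - u + 1)"
    have v: "0 \<le> v" "v < 1" using u \<tau> by (auto simp: v_def)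
    define i where "i = \<lceil>v / \<delta>\<rceil>"
    have "0 \<le> v / \<delta>" using v d by simp
    then have i0: "0 \<le> i" unfolding i_def by linarith
    have "v / \<delta> \<le> of_int i" "of_int i < v / \<delta> + 1" unfolding i_def by linarith+
    then have iv: "v \<le> of_int i * \<delta>" "of_int i * \<delta> < v + \<delta>" using d by (simp_all add: field_simps)
    have "v / \<delta> \<le> 1 / \<delta>" using v d by (simp add: divide_right_mono)
    then have iK: "i \<le> K" unfolding i_def K_def by (smt (verit) ceiling_mono)
    define q where "q = t + i * a"
    define z where "z = u + of_int i * \<delta> - (if u \<le> \<tau> then 0 else 1)"
    have z: "\<tau> \<le> z" "z < \<tau> + \<delta>" using iv by (auto simp: z_def v_def split: if_splits)
    have "of_int (q + 1) * sqrt 2 - z \<in> \<int>"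
    proof -
      have "of_int (q + 1) * sqrt 2 - z = (of_int (t + 1) * sqrt 2 - u)
          + of_int i * (of_int a * sqrt 2 - \<delta>) + (if u \<le> \<tau> then 0 else 1)"
        by (simp add: q_def z_def algebra_simps)
      also have "\<dots> \<in> \<int>"
        by (intro Ints_add Ints_mult) (auto simp: u_def \<delta>_def frac_def)
      finally show ?thesis .
    qed
    then have fz: "frac (of_int (q + 1) * sqrt 2) = z"
      using z \<tau> d te by (intro frac_unique_iff[THEN iffD2]) auto
    have "word sturm p n = word sturm q n"
    proof (rule sturm_word_cong)
      fix l assume l: "l \<le> n"
      define w where "w = \<tau> + of_int (int l) * sqrt 2"
      have 1: "frac w + (z - \<tau>) < 1" using e[OF l] z d by (simp add: w_def)
      have "0 \<le> frac w" by (rule frac_ge_0)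
      then have "\<lfloor>w + (z - \<tau>)\<rfloor> = \<lfloor>w\<rfloor>" using 1 z by (simp add: frac_def floor_eq_iff) linarith
      then show "\<lfloor>frac (of_int (p + 1) * sqrt 2) + of_int (int l) * sqrt 2\<rfloor> =
          \<lfloor>frac (of_int (q + 1) * sqrt 2) + of_int (int l) * sqrt 2\<rfloor>"
        unfolding fz \<tau>_def[symmetric] by (simp add: w_def add.commute)
    qed
    moreover have "0 \<le> i * a" using i0 a by simp
    moreover have "i * a \<le> K * a" using iK a by (intro mult_right_mono) auto
    ultimately show ?thesis
      by (intro exI[of _ q]) (auto simp: q_def)
  qed
  then show ?thesis by blast
qed

text \<open>As the starting point of the rotation increases, the vector of floors increases in every
  coordinate, and each coordinate increases by at most one.\<close>
lemma sturm_count: "card (range (\<lambda>t. word sturm t n)) \<le> n + 1"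
proof -
  define S where "S t = (\<Sum>l\<le>n. \<lfloor>frac (of_int (t + 1) * sqrt 2) + of_int (int l) * sqrt 2\<rfloor>)" for t
  define S0 where "S0 = (\<Sum>l\<le>n. \<lfloor>of_int (int l) * sqrt 2\<rfloor>)"
  have fr: "0 \<le> frac (of_int (t + 1) * sqrt 2)" "frac (of_int (t + 1) * sqrt 2) < 1" for t
    by (rule frac_ge_0, rule frac_lt_1)
  have "S t \<in> {S0..S0 + int n}" for t
  proof -
    have "S0 \<le> S t" unfolding S0_def S_def
      using fr[of t] by (intro sum_mono floor_mono) auto
    have split: "(\<Sum>l\<le>n. f l) = f 0 + (\<Sum>l\<in>{1..n}. f l)" for f :: "nat \<Rightarrow> int"
      by (simp add: atMost_atLeast0 sum.atLeast_Suc_atMost)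
    have "S t \<le> 0 + (\<Sum>l\<in>{1..n}. \<lfloor>of_int (int l) * sqrt 2\<rfloor> + 1)"
      unfolding S_def split
    proof (rule add_mono)
      show "\<lfloor>frac (of_int (t + 1) * sqrt 2) + of_int (int 0) * sqrt 2\<rfloor> \<le> 0"
        using fr(2)[of t] by (simp add: floor_le_iff)
      show "(\<Sum>l\<in>{1..n}. \<lfloor>frac (of_int (t + 1) * sqrt 2) + of_int (int l) * sqrt 2\<rfloor>)
          \<le> (\<Sum>l\<in>{1..n}. \<lfloor>of_int (int l) * sqrt 2\<rfloor> + 1)"
      proof (rule sum_mono)
        fix l
        show "\<lfloor>frac (of_int (t + 1) * sqrt 2) + of_int (int l) * sqrt 2\<rfloor> \<le> \<lfloor>of_int (int l) * sqrt 2\<rfloor> + 1"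
          using fr(2)[of t] by linarith
      qed
    qed
    also have "\<dots> = S0 + int n" unfolding S0_def split by (simp add: sum.distrib)
    finally show ?thesis using \<open>S0 \<le> S t\<close> by simp
  qed
  then have sub: "range S \<subseteq> {S0..S0 + int n}" by blast
  have le: "word sturm t n = word sturm t' n"
    if "S t = S t'" "frac (of_int (t + 1) * sqrt 2) \<le> frac (of_int (t' + 1) * sqrt 2)" for t t'
  proof (rule sturm_word_cong)
    fix l assume "l \<le> n"
    show "\<lfloor>frac (of_int (t + 1) * sqrt 2) + of_int (int l) * sqrt 2\<rfloor> =
        \<lfloor>frac (of_int (t' + 1) * sqrt 2) + of_int (int l) * sqrt 2\<rfloor>"
    proof (rule sum_mono_inv[of _ "{..n}"])
      show "(\<Sum>l\<le>n. \<lfloor>frac (of_int (t + 1) * sqrt 2) + of_int (int l) * sqrt 2\<rfloor>) =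
        (\<Sum>l\<le>n. \<lfloor>frac (of_int (t' + 1) * sqrt 2) + of_int (int l) * sqrt 2\<rfloor>)"
        using that(1) by (simp add: S_def)
      show "\<lfloor>frac (of_int (t + 1) * sqrt 2) + of_int (int l) * sqrt 2\<rfloor> \<le>
        \<lfloor>frac (of_int (t' + 1) * sqrt 2) + of_int (int l) * sqrt 2\<rfloor>" for l
        using that(2) by (intro floor_mono) auto
    qed (use \<open>l \<le> n\<close> in auto)
  qed
  have eq: "word sturm t n = word sturm t' n" if "S t = S t'" for t t'
    using le[OF that] le[OF that[symmetric]]
    by (cases "frac (of_int (t + 1) * sqrt 2) \<le> frac (of_int (t' + 1) * sqrt 2)") auto
  have "range (\<lambda>t. word sturm t n) \<subseteq> (\<lambda>s. word sturm (SOME t. S t = s) n) ` range S"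
  proof
    fix w assume "w \<in> range (\<lambda>t. word sturm t n)"
    then obtain t where t: "w = word sturm t n" by blast
    have "S (SOME t'. S t' = S t) = S t" by (rule someI[of "\<lambda>t'. S t' = S t" t]) simp
    then have "w = word sturm (SOME t'. S t' = S t) n" using t eq by metis
    then show "w \<in> (\<lambda>s. word sturm (SOME t. S t = s) n) ` range S" by blast
  qed
  then have "card (range (\<lambda>t. word sturm t n)) \<le> card (range S)"
    using sub by (intro surj_card_le) (auto intro: finite_subset)
  also have "\<dots> \<le> card {S0..S0 + int n}" using sub by (intro card_mono) auto
  also have "\<dots> = n + 1" by simp
  finally show ?thesis .
qed

text \<open>A period \<open>d\<close> makes \<open>fl\<close> advance by a constant \<open>c\<close>
  over every \<open>d\<close> steps. Then \<open>r * (d * sqrt 2 - c)\<close> is bounded over all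
  \<open>r\<close>, which makes \<open>sqrt 2\<close> rational.\<close>

lemma sturm_not_periodic:
  assumes "0 < d" shows "\<exists>m. sturm (m + d) \<noteq> sturm m"
proof (rule ccontr)
  assume "\<not> ?thesis"
  then have per: "sturm (m + d) = sturm m" for m by blast
  define c where "c = fl (d + 1) - fl 1"
  have step: "fl (m + d) - fl m = c" for m
  proof -
    have s: "fl (m + 1 + d) - fl (m + 1) = fl (m + d) - fl m" for m
      using per[of "m - 1"] fl_diff[of "m - 1"] fl_diff[of "m - 1 + d"] by (simp add: algebra_simps)
    show ?thesis
    proof (induction m rule: int_induct[of _ 1])
      case base then show ?case by (simp add: c_def add.commute)
    next
      case (step1 m) then show ?case using s[of m] by simp
    next
      case (step2 m) then show ?case using s[of "m - 1"] by simp
    qed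
  qed
  have lin: "fl (int r * d) = int r * c" for r
  proof (induction r)
    case (Suc r)
    then show ?case using step[of "int r * d"] by (simp add: algebra_simps)
  qed (simp add: fl_def)
  define \<eta> where "\<eta> = of_int d * sqrt 2 - of_int c"
  have b: "\<bar>of_nat r * \<eta>\<bar> \<le> 1" for r :: nat
  proof -
    have "of_int (fl (int r * d)) \<le> of_int (int r * d) * sqrt 2" "of_int (int r * d) * sqrt 2 < of_int (fl (int r * d)) + 1"
      unfolding fl_def by linarith+
    then show ?thesis unfolding lin by (simp add: \<eta>_def algebra_simps abs_le_iff)
  qed
  have "\<eta> = 0"
  proof (rule ccontr)
    assume "\<eta> \<noteq> 0"
    then obtain r :: nat where "1 < of_nat r * \<bar>\<eta>\<bar>"
      using reals_Archimedean3[of "\<bar>\<eta>\<bar>"] by (metis abs_ge_zero zero_less_abs_iff)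
    then show False using b[of r] by (simp add: abs_mult)
  qed
  then show False using sqrt2_irrational[OF assms, of c] by (simp add: \<eta>_def)
qed

section \<open>Points of low complexity\<close>

definition win :: "nat \<Rightarrow> 'a list \<Rightarrow> 'a list set" where
  "win n w = {take n (drop t w) | t. t + n \<le> length w}"

lemma win_I: "t + n \<le> length w \<Longrightarrow> take n (drop t w) \<in> win n w"
  unfolding win_def by blast

lemma win_E:
  assumes "v \<in> win n w" obtains t where "t + n \<le> length w" "v = take n (drop t w)"
  using assms unfolding win_def by blast

lemma win_eq_image: "win n w = (\<lambda>t. take n (drop t w)) ` {t. t + n \<le> length w}"
  unfolding win_def by blast

lemma finite_win [simp]: "finite (win n w)"
proof -
  have "finite {t. t + n \<le> length w}" by (rule finite_subset[of _ "{..length w}"]) auto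
  then show ?thesis by (simp add: win_eq_image)
qed

lemma card_win: "card (win n w) \<le> length w + 1 - n"
proof -
  have "{t. t + n \<le> length w} \<subseteq> {..<length w + 1 - n}" by auto
  then have "card {t. t + n \<le> length w} \<le> length w + 1 - n" using card_mono[of "{..<length w + 1 - n}"] by fastforce
  moreover have "finite {t. t + n \<le> length w}" by (rule finite_subset[of _ "{..length w}"]) auto
  ultimately show ?thesis unfolding win_eq_image using card_image_le le_trans by blast
qed

lemma win_append_left: "win n v \<subseteq> win n (u @ v)"
proof
  fix x assume "x \<in> win n v"
  then obtain t where "t + n \<le> length v" "x = take n (drop t v)" by (rule win_E)
  then have "x = take n (drop (t + length u) (u @ v))" "t + length u + n \<le> length (u @ v)" by auto
  then show "x \<in> win n (u @ v)" using win_I[of "t + length u" n "u @ v"] by simp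
qed

lemma win_append_right: "win n u \<subseteq> win n (u @ v)"
proof
  fix x assume "x \<in> win n u"
  then obtain t where "t + n \<le> length u" "x = take n (drop t u)" by (rule win_E)
  then have "x = take n (drop t (u @ v))" "t + n \<le> length (u @ v)" by auto
  then show "x \<in> win n (u @ v)" using win_I[of t n "u @ v"] by simp
qed

lemma win_infix: "win n v \<subseteq> win n (u @ v @ w)"
  using win_append_right[of n v w] win_append_left[of n "v @ w" u] by blast

text \<open>A window that starts in \<open>u\<close> sees at most \<open>n - 1\<close> letters of
  \<open>v\<close>.\<close>

lemma win_split_right:
  assumes "1 \<le> n"
  shows "win n (u @ v) \<subseteq> win n (u @ take (n - 1) v) \<union> win n v"
proof
  fix x assume "x \<in> win n (u @ v)"
  then obtain t where t: "t + n \<le> length (u @ v)" "x = take n (drop t (u @ v))" by (rule win_E)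
  show "x \<in> win n (u @ take (n - 1) v) \<union> win n v"
  proof (cases "length u \<le> t")
    case True
    then have "x = take n (drop (t - length u) v)" "t - length u + n \<le> length v" using t by auto
    then show ?thesis using win_I[of "t - length u" n v] by simp
  next
    case False
    have "t + n \<le> length (u @ take (n - 1) v)" using t False assms by simp
    moreover have "x = take n (drop t (u @ take (n - 1) v))"
      using t False by (simp add: min_def)
    ultimately show ?thesis using win_I[of t n "u @ take (n - 1) v"] by simp
  qed
qed

lemma win_split_left:
  assumes "1 \<le> n"
  shows "win n (u @ v) \<subseteq> win n u \<union> win n (drop (length u - (n - 1)) u @ v)"
proof
  fix x assume "x \<in> win n (u @ v)"
  then obtain t where t: "t + n \<le> length (u @ v)" "x = take n (drop t (u @ v))" by (rule win_E)
  show "x \<in> win n u \<union> win n (drop (length u - (n - 1)) u @ v)"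
  proof (cases "t + n \<le> length u")
    case True
    then show ?thesis using t win_I[of t n u] by simp
  next
    case False
    define c where "c = length u - (n - 1)"
    have c: "c \<le> t" "c \<le> length u" using False by (auto simp: c_def)
    have "drop t (u @ v) = drop (t - c) (drop c (u @ v))" using c by simp
    also have "drop c (u @ v) = drop c u @ v" using c by simp
    finally have x: "x = take n (drop (t - c) (drop c u @ v))" using t by simp
    have "t - c + n \<le> length (drop c u @ v)" using t c by simp
    then have "x \<in> win n (drop c u @ v)" unfolding x by (rule win_I)
    then show ?thesis unfolding c_def by blast
  qed
qed

lemma win_word: "win n (word z p m) \<subseteq> range (\<lambda>t. word z t n)"
  by (auto simp: win_def drop_word take_word)

lemma word_in_win: "p \<le> q \<Longrightarrow> q + int n \<le> p + int m \<Longrightarrow> word z q n \<in> win n (word z p m)"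
  using win_I[of "nat (q - p)" n "word z p m"] by (simp add: drop_word take_word)

text \<open>The orbit closures of \<open>Z 0, ..., Z (j - 1)\<close> become the minimal subsystems;
  their alphabets are disjoint and leave \<open>0\<close> for the marker. By \<open>square\<close> a
  block can be cut so that it begins like the right half of \<open>Z k\<close> and ends like its
  left half. Blocks of different stages then look the same near their ends.\<close>

locale mark_system =
  fixes j i :: nat and Z :: "nat \<Rightarrow> int \<Rightarrow> nat" and g :: "nat \<Rightarrow> nat"
  assumes j_ge: "2 \<le> j" and i_le: "i \<le> j"
    and g_mono: "mono g" and g_unbounded: "\<not> bdd_above (range g)"
    and square: "k < j \<Longrightarrow> \<exists>a>B. \<forall>m. 0 \<le> m \<and> m < int a \<longrightarrow> Z k (m - int a) = Z k m"
    and unif_rec: "k < j \<Longrightarrow>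
      \<exists>L. \<forall>t. \<exists>q. t \<le> q \<and> q + int n \<le> t + int L \<and> word (Z k) q n = word (Z k) p n"
    and count_inf: "k < i \<Longrightarrow> card (range (\<lambda>t. word (Z k) t n)) \<le> n + 1"
    and count_fin: "i \<le> k \<Longrightarrow> k < j \<Longrightarrow> card (range (\<lambda>t. word (Z k) t n)) \<le> 1"
    and letters: "k < j \<Longrightarrow> Z k m \<in> {2 * k + 1, 2 * k + 2}"
    and infinite_iff: "k < j \<Longrightarrow> infinite (orbit_closure {..2 * j} (Z k)) \<longleftrightarrow> k < i"
begin

text \<open>\<open>L\<close> is the length of what precedes the block in its stage. The factor
  \<open>3\<close> makes room for the windows of length \<open>length (W L) + 2 * L\<close> in
  \<open>long_factor\<close>, and \<open>L \<le> g a\<close> lets \<open>g\<close> pay for the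
  windows that see the earlier part.\<close>

definition len :: "nat \<Rightarrow> nat \<Rightarrow> nat" where
  "len k L = (SOME a. 3 * L < a \<and> L \<le> g a \<and> (\<forall>m. 0 \<le> m \<and> m < int a \<longrightarrow> Z k (m - int a) = Z k m))"

primrec T :: "nat list \<Rightarrow> nat \<Rightarrow> nat list" where
  "T w 0 = w"
| "T w (Suc k) = T w k @ word (Z k) 0 (len k (length (T w k)))"

text \<open>The lengths of the blocks grow so fast that each exceeds \<open>T\<close> so far, and even the value
  of \<open>g\<close> at each does.\<close>
primrec W :: "nat \<Rightarrow> nat list" where
  "W 0 = [0]"
| "W (Suc s) = T (W s) j @ W s"

definition a :: "nat \<Rightarrow> nat \<Rightarrow> nat" where
  "a s k = len k (length (T (W s) k))"

definition A :: "nat \<Rightarrow> nat \<Rightarrow> nat list" where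
  "A s k = word (Z k) 0 (a s k)"

lemma len:
  assumes "k < j"
  shows "3 * L < len k L" "L \<le> g (len k L)"
    "\<And>m. 0 \<le> m \<Longrightarrow> m < int (len k L) \<Longrightarrow> Z k (m - int (len k L)) = Z k m"
proof -
  obtain B where B: "L \<le> g B" using g_unbounded by (auto simp: bdd_above_def) (meson nat_le_linear)
  obtain a where a: "a > max B (3 * L)" "\<forall>m. 0 \<le> m \<and> m < int a \<longrightarrow> Z k (m - int a) = Z k m"
    using square[OF assms] by blast
  have "g B \<le> g a" using a by (intro monoD[OF g_mono]) auto
  then have "\<exists>a. 3 * L < a \<and> L \<le> g a \<and> (\<forall>m. 0 \<le> m \<and> m < int a \<longrightarrow> Z k (m - int a) = Z k m)"
    using a B by (intro exI[of _ a]) auto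
  from someI_ex[OF this, folded len_def]
  show "3 * L < len k L" "L \<le> g (len k L)"
    "\<And>m. 0 \<le> m \<Longrightarrow> m < int (len k L) \<Longrightarrow> Z k (m - int (len k L)) = Z k m" by auto
qed

lemma a_gt: "k < j \<Longrightarrow> 3 * length (T (W s) k) < a s k"
  and g_a: "k < j \<Longrightarrow> length (T (W s) k) \<le> g (a s k)"
  unfolding a_def by (rule len; assumption)+

lemma length_A [simp]: "length (A s k) = a s k"
  by (simp add: A_def)

lemma T_Suc: "T (W s) (Suc k) = T (W s) k @ A s k"
  by (simp add: A_def a_def)

lemma A_eq: "k < j \<Longrightarrow> A s k = word (Z k) (- int (a s k)) (a s k)"
  unfolding A_def
proof (rule word_eqI)
  fix m assume "k < j" "0 \<le> m" "m < int (a s k)"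
  then show "Z k (0 + m) = Z k (- int (a s k) + m)"
    using len(3)[of k m "length (T (W s) k)"] by (simp add: a_def add.commute)
qed

text \<open>For \<open>k < j\<close>, every block \<open>A s k\<close> starts with
  \<open>pre k m\<close> and, by \<open>square\<close>, ends with \<open>suf k m\<close>, for all
  \<open>m \<le> a s k\<close> and whatever the stage.\<close>

definition pre :: "nat \<Rightarrow> nat \<Rightarrow> nat list" where "pre k m = word (Z k) 0 m"
definition suf :: "nat \<Rightarrow> nat \<Rightarrow> nat list" where "suf k m = word (Z k) (- int m) m"

lemma length_pre [simp]: "length (pre k m) = m" and length_suf [simp]: "length (suf k m) = m"
  by (simp_all add: pre_def suf_def)

lemma take_A: "m \<le> a s k \<Longrightarrow> take m (A s k) = pre k m"
  by (simp add: A_def pre_def take_word)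

lemma drop_A: "k < j \<Longrightarrow> m \<le> a s k \<Longrightarrow> drop (a s k - m) (A s k) = suf k m"
  by (simp add: A_eq suf_def drop_word of_nat_diff)

lemma A_prefix: "a s k \<le> m \<Longrightarrow> pre k m = A s k @ drop (a s k) (pre k m)"
  by (metis A_def append_take_drop_id pre_def take_word)

lemma A_suffix: "k < j \<Longrightarrow> a s k \<le> m \<Longrightarrow> suf k m = take (m - a s k) (suf k m) @ A s k"
proof -
  assume k: "k < j" and m: "a s k \<le> m"
  have "drop (m - a s k) (suf k m) = A s k"
    using k m by (simp add: A_eq suf_def drop_word of_nat_diff)
  then show ?thesis by (metis append_take_drop_id)
qed

text \<open>The tail of stage \<open>s\<close> after its first \<open>j - d\<close> blocks, continued by \<open>n - 1\<close> letters of the next block.\<close>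
primrec R :: "nat \<Rightarrow> nat \<Rightarrow> nat \<Rightarrow> nat list" where
  "R n s 0 = W s @ pre 0 (n - 1)"
| "R n s (Suc d) = A s (j - Suc d) @ R n s d"

lemma T_R: "d \<le> j \<Longrightarrow> T (W s) (j - d) @ R n s d = W (Suc s) @ pre 0 (n - 1)"
proof (induction d)
  case 0 then show ?case by simp
next
  case (Suc d)
  have "T (W s) (j - d) = T (W s) (j - Suc d) @ A s (j - Suc d)"
    using Suc.prems T_Suc[of s "j - Suc d"] by (simp add: Suc_diff_Suc)
  then show ?case using Suc by simp
qed

text \<open>\<open>W s\<close> with all that a window of length \<open>n\<close> meeting it can see,
  when the neighbouring blocks, of indices \<open>j - 1\<close> and \<open>0\<close>, have length at
  least \<open>n - 1\<close>.\<close>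

definition ext :: "nat \<Rightarrow> nat \<Rightarrow> nat list" where
  "ext n s = suf (j - 1) (n - 1) @ W s @ pre 0 (n - 1)"

definition base :: "nat \<Rightarrow> nat \<Rightarrow> nat list set" where
  "base n s = (\<Union>l\<in>{..<j}. range (\<lambda>t. word (Z l) t n)) \<union>
     (\<Union>l\<in>{..<j - 1}. win n (suf l (n - 1) @ pre (Suc l) (n - 1))) \<union> win n (ext n s)"

section \<open>Counting the windows of the construction\<close>

lemma finite_range_words: "k < j \<Longrightarrow> finite (range (\<lambda>t. word (Z k) t n))"
proof (rule finite_subset)
  assume k: "k < j"
  show "range (\<lambda>t. word (Z k) t n) \<subseteq> {w. set w \<subseteq> {2 * k + 1, 2 * k + 2} \<and> length w = n}"
  proof -
    have "\<forall>b\<in>set (word (Z k) t n). b \<in> {2 * k + 1, 2 * k + 2}" for t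
      unfolding Ball_set_word using letters[OF k] by blast
    then show ?thesis by (auto simp del: insert_iff)
  qed
qed (rule finite_lists_length_eq, simp)

lemma finite_base: "finite (base n s)"
  unfolding base_def by (auto intro: finite_range_words)

text \<open>The points \<open>Z l\<close> contribute at most \<open>n + 1\<close> words each for
  \<open>l < i\<close> and one each otherwise, in total \<open>i * n + j\<close>. The
  \<open>j - 1\<close> borders between blocks contribute \<open>n - 1\<close> each, and the
  surroundings of \<open>W s\<close> another \<open>n - 1 + length (W s)\<close>.\<close>

lemma card_base:
  assumes n: "1 \<le> n"
  shows "card (base n s) \<le> (i + j) * n + j + length (W s)"
proof -
  have ranges: "card (\<Union>l\<in>{..<j}. range (\<lambda>t. word (Z l) t n)) \<le> i * n + j"
  proof -
    have "card (\<Union>l\<in>{..<j}. range (\<lambda>t. word (Z l) t n)) \<le> (\<Sum>l\<in>{..<j}. card (range (\<lambda>t. word (Z l) t n)))"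
      by (rule card_UN_le) simp
    also have "\<dots> \<le> (\<Sum>l\<in>{..<j}. (if l < i then n else 0) + 1)"
    proof (rule sum_mono)
      fix l assume "l \<in> {..<j}"
      then show "card (range (\<lambda>t. word (Z l) t n)) \<le> (if l < i then n else 0) + 1"
        using count_inf[of l n] count_fin[of l n] by auto
    qed
    also have "\<dots> = (\<Sum>l\<in>{..<j}. if l < i then n else 0) + j" by (simp only: sum.distrib) simp
    also have "(\<Sum>l\<in>{..<j}. if l < i then n else 0) = i * n"
    proof -
      have "{..<j} \<inter> {l. l < i} = {..<i}" using i_le by auto
      then show ?thesis by (simp add: sum.If_cases)
    qed
    finally show ?thesis .
  qed
  have pairs: "card (\<Union>l\<in>{..<j - 1}. win n (suf l (n - 1) @ pre (Suc l) (n - 1))) \<le> (j - 1) * (n - 1)"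
  proof -
    have "card (\<Union>l\<in>{..<j - 1}. win n (suf l (n - 1) @ pre (Suc l) (n - 1)))
        \<le> (\<Sum>l\<in>{..<j - 1}. card (win n (suf l (n - 1) @ pre (Suc l) (n - 1))))"
      by (rule card_UN_le) simp
    also have "\<dots> \<le> (\<Sum>l\<in>{..<j - 1}. n - 1)"
    proof (rule sum_mono)
      fix l
      show "card (win n (suf l (n - 1) @ pre (Suc l) (n - 1))) \<le> n - 1"
        using card_win[of n "suf l (n - 1) @ pre (Suc l) (n - 1)"] n by simp
    qed
    finally show ?thesis by simp
  qed
  have e: "card (win n (ext n s)) \<le> n - 1 + length (W s)"
    using card_win[of n "ext n s"] n by (simp add: ext_def)
  have "card (base n s) \<le> (i * n + j + (j - 1) * (n - 1)) + (n - 1 + length (W s))"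
    unfolding base_def
    by (rule order.trans[OF card_Un_le add_mono[OF order.trans[OF card_Un_le add_mono[OF ranges pairs]] e]])
  also have "(j - 1) * (n - 1) + (n - 1) = j * (n - 1)"
    using j_ge by (cases j) auto
  then have "(i * n + j + (j - 1) * (n - 1)) + (n - 1 + length (W s)) = i * n + j + j * (n - 1) + length (W s)"
    by simp
  also have "\<dots> \<le> (i + j) * n + j + length (W s)" by (simp add: algebra_simps)
  finally show ?thesis .
qed

text \<open>The tail of a stage is built up from its closing \<open>W r\<close> by adding blocks on
  the left. As these have length at least \<open>n - 1\<close>, a window lies in one block, across
  one border, or around \<open>W r\<close>.\<close>

lemma win_chain:
  assumes n: "1 \<le> n"
    and H1: "\<And>l. l < j \<Longrightarrow> range (\<lambda>t. word (Z l) t n) \<subseteq> H"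
    and H2: "\<And>l. Suc l < j \<Longrightarrow> win n (suf l (n - 1) @ pre (Suc l) (n - 1)) \<subseteq> H"
    and E: "win n (ext n r) \<subseteq> H"
    and d: "d < j" and large: "\<And>l. j - Suc d < l \<Longrightarrow> l < j \<Longrightarrow> n - 1 \<le> a r l"
  shows "win n (suf (j - Suc d) (n - 1) @ R n r d) \<subseteq> H"
  using d large
proof (induction d)
  case 0
  then show ?case using E by (simp add: ext_def)
next
  case (Suc d)
  let ?k = "j - Suc (Suc d)" and ?l = "j - Suc d"
  have kl: "Suc ?k = ?l" "?l < j" using Suc.prems by auto
  have al: "n - 1 \<le> a r ?l" using Suc.prems by auto
  have IH: "win n (suf ?l (n - 1) @ R n r d) \<subseteq> H"
    using Suc.prems by (intro Suc.IH) auto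
  have "take (n - 1) (R n r (Suc d)) = pre ?l (n - 1)" using al by (simp add: take_A)
  then have "win n (suf ?k (n - 1) @ R n r (Suc d)) \<subseteq>
      win n (suf ?k (n - 1) @ pre ?l (n - 1)) \<union> win n (R n r (Suc d))"
    using win_split_right[OF n, of "suf ?k (n - 1)" "R n r (Suc d)"] by (simp only:)
  moreover have "win n (suf ?k (n - 1) @ pre ?l (n - 1)) \<subseteq> H" using H2[of ?k] kl by simp
  moreover have "win n (R n r (Suc d)) \<subseteq> win n (A r ?l) \<union> win n (suf ?l (n - 1) @ R n r d)"
    using win_split_left[OF n, of "A r ?l" "R n r d"] drop_A[OF kl(2) al] by simp
  moreover have "win n (A r ?l) \<subseteq> H" using win_word H1[OF kl(2)] unfolding A_def by blast
  ultimately show ?case using IH by blast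
qed

lemma ext_Suc: "ext n (Suc s) = suf (j - 1) (n - 1) @ W s @ A s 0 @ R n s (j - 1)"
proof -
  have j: "Suc (j - 1) = j" using j_ge by simp
  have "R n s (Suc (j - 1)) = A s (j - Suc (j - 1)) @ R n s (j - 1)" by (rule R.simps(2))
  then have "R n s j = A s 0 @ R n s (j - 1)" by (simp only: j diff_self_eq_0)
  moreover have "W s @ R n s j = W (Suc s) @ pre 0 (n - 1)" using T_R[of j s n] by simp
  ultimately show ?thesis by (simp add: ext_def)
qed

text \<open>\<open>W (Suc r)\<close> starts and ends with \<open>W r\<close>, both times in the
  surroundings \<open>ext n r\<close>, and the long blocks in between show nothing new.\<close>

lemma ext_step:
  assumes n: "1 \<le> n"
    and H1: "\<And>l. l < j \<Longrightarrow> range (\<lambda>t. word (Z l) t n) \<subseteq> H"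
    and H2: "\<And>l. Suc l < j \<Longrightarrow> win n (suf l (n - 1) @ pre (Suc l) (n - 1)) \<subseteq> H"
    and E: "win n (ext n r) \<subseteq> H"
    and large: "\<And>l. l < j \<Longrightarrow> n - 1 \<le> a r l"
  shows "win n (ext n (Suc r)) \<subseteq> H"
proof -
  have j0: "0 < j" using j_ge by simp
  have "take (n - 1) (A r 0 @ R n r (j - 1)) = pre 0 (n - 1)"
    using large[OF j0] by (simp add: take_A)
  then have "win n (ext n (Suc r)) \<subseteq> win n (ext n r) \<union> win n (A r 0 @ R n r (j - 1))"
    using win_split_right[OF n, of "suf (j - 1) (n - 1) @ W r" "A r 0 @ R n r (j - 1)"]
    unfolding ext_Suc by (simp only: ext_def append_assoc)
  moreover have "win n (A r 0 @ R n r (j - 1)) \<subseteq> win n (A r 0) \<union> win n (suf 0 (n - 1) @ R n r (j - 1))"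
    using win_split_left[OF n, of "A r 0" "R n r (j - 1)"] drop_A[OF j0 large[OF j0]] by simp
  moreover have "win n (A r 0) \<subseteq> H" using win_word H1[OF j0] unfolding A_def by blast
  moreover have "win n (suf 0 (n - 1) @ R n r (j - 1)) \<subseteq> H"
    using win_chain[OF n H1 H2 E, of "j - 1"] large j0 by simp
  ultimately show ?thesis using E by blast
qed

lemma a_mono_Suc: "Suc k < j \<Longrightarrow> a s k < a s (Suc k)"
  using a_gt[of "Suc k" s] by (simp add: T_Suc del: T.simps)

lemma a_mono: "k \<le> l \<Longrightarrow> l < j \<Longrightarrow> a s k \<le> a s l"
proof (induction l rule: nat_induct_at_least)
  case (Suc l)
  then show ?case using a_mono_Suc[of l s] by simp
qed simp

lemma length_T_mono: "k \<le> l \<Longrightarrow> length (T w k) \<le> length (T w l)"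
  by (induction l rule: nat_induct_at_least) auto

lemma a_le_W: "k < j \<Longrightarrow> a s k \<le> length (W (Suc s))"
  using length_T_mono[of "Suc k" j "W s"] by (simp add: T_Suc del: T.simps)

lemma a_Suc_stage: "k < j \<Longrightarrow> l < j \<Longrightarrow> a s k < a (Suc s) l"
  using a_le_W[of k s] a_gt[of 0 "Suc s"] a_mono[of 0 l "Suc s"] by simp

lemma a_later: "k < j \<Longrightarrow> l < j \<Longrightarrow> s < r \<Longrightarrow> a s k < a r l"
proof (induction r)
  case (Suc r)
  then show ?case using a_Suc_stage[of k l s] a_Suc_stage[of l l r] by (cases "s = r") auto
qed simp

lemma length_W_ge: "s < length (W s)"
proof (induction s)
  case (Suc s)
  then show ?case using length_T_mono[of 0 j "W s"] by simp
qed simp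

lemma a_ge: "k < j \<Longrightarrow> s < a s k"
  using a_gt[of 0 s] a_mono[of 0 k s] length_W_ge[of s] by simp

lemma win_ext_low:
  assumes n: "1 \<le> n" "n \<le> a s 0" and r: "s \<le> r"
  shows "win n (ext n r) \<subseteq> base n s"
  using r
proof (induction r rule: nat_induct_at_least)
  case base
  then show ?case by (simp add: base_def)
next
  case (Suc r)
  have large: "n - 1 \<le> a r l" if "l < j" for l
  proof (cases "r = s")
    case True then show ?thesis using n a_mono[of 0 l s] that by simp
  next
    case False
    then have "a s 0 < a r l" using Suc that by (intro a_later) auto
    then show ?thesis using n by simp
  qed
  show ?case
  proof (rule ext_step[OF n(1) _ _ Suc.IH large])
    show "range (\<lambda>t. word (Z l) t n) \<subseteq> base n s" if "l < j" for l
      using that unfolding base_def by blast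
    show "win n (suf l (n - 1) @ pre (Suc l) (n - 1)) \<subseteq> base n s" if "Suc l < j" for l
    proof -
      have "l \<in> {..<j - 1}" using that by auto
      then show ?thesis unfolding base_def by blast
    qed
  qed
qed

text \<open>Windows of \<open>ext n (Suc s)\<close> that reach no further than block
  \<open>0\<close> occur around \<open>W s\<close>, because block \<open>0\<close> is a prefix of
  \<open>pre 0 (n - 1)\<close>. Those that start in block \<open>k\<close> or later fall under
  \<open>win_chain\<close>, because block \<open>k\<close> is a suffix of
  \<open>suf k (n - 1)\<close>. Only the start positions in between are new.\<close>

lemma win_ext_high:
  assumes k: "k < j" "a s k < n" and next_block: "\<And>l. k < l \<Longrightarrow> l < j \<Longrightarrow> n \<le> a s l"
    and next_stage: "n \<le> a (Suc s) 0"
  obtains H where "finite H" "card H \<le> (i + j + 1) * n + j + length (T (W s) k)"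
    "\<And>r. s < r \<Longrightarrow> win n (ext n r) \<subseteq> H"
proof -
  have n: "1 \<le> n" using k by simp
  have j0: "0 < j" using j_ge by simp
  \<comment> \<open>Fewer than \<open>n\<close> positions beyond
    \<open>length (T (W s) k) - length (W s)\<close>; the latter difference turns the summand
    \<open>length (W s)\<close> of \<open>card_base\<close> into
    \<open>length (T (W s) k)\<close>.\<close>
  define I where "I = {length (W s) + a s 0..<n - 1 + length (T (W s) k)}"
  define H where "H = base n s \<union> (\<lambda>t. take n (drop t (ext n (Suc s)))) ` I"
  have finH: "finite H" by (simp add: H_def I_def finite_base)
  have Wk: "length (W s) \<le> length (T (W s) k)" using length_T_mono[of 0 k "W s"] by simp
  have "card H \<le> card (base n s) + card ((\<lambda>t. take n (drop t (ext n (Suc s)))) ` I)"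
    unfolding H_def by (rule card_Un_le)
  also have "\<dots> \<le> (i + j) * n + j + length (W s) + card I"
    by (intro add_mono card_base[OF n] card_image_le) (simp add: I_def)
  also have "\<dots> \<le> (i + j + 1) * n + j + length (T (W s) k)"
    using Wk by (simp add: I_def algebra_simps)
  finally have cardH: "card H \<le> (i + j + 1) * n + j + length (T (W s) k)" .
  have H1: "range (\<lambda>t. word (Z l) t n) \<subseteq> H" if "l < j" for l
    using that unfolding H_def base_def by blast
  have H2: "win n (suf l (n - 1) @ pre (Suc l) (n - 1)) \<subseteq> H" if "Suc l < j" for l
  proof -
    have "l \<in> {..<j - 1}" using that by auto
    then show ?thesis unfolding H_def base_def by blast
  qed
  have H3: "win n (ext n s) \<subseteq> H" unfolding H_def base_def by blast
  have a0: "a s 0 \<le> n - 1" using a_mono[of 0 k s] k by simp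
  have first: "win n (ext n (Suc s)) \<subseteq> H"
  proof
    fix x assume "x \<in> win n (ext n (Suc s))"
    then obtain t where t: "t + n \<le> length (ext n (Suc s))" "x = take n (drop t (ext n (Suc s)))"
      by (rule win_E)
    let ?P = "suf (j - 1) (n - 1) @ W s @ A s 0"
    show "x \<in> H"
    proof (cases "t + n \<le> length ?P")
      case True
      have "x = take n (drop t ?P)" using t True by (simp add: ext_Suc del: append_assoc add: append_assoc[symmetric])
      then have "x \<in> win n ?P" using win_I[OF True] by simp
      also have "win n ?P \<subseteq> win n (?P @ drop (a s 0) (pre 0 (n - 1)))" by (rule win_append_right)
      also have "?P @ drop (a s 0) (pre 0 (n - 1)) = ext n s"
        using A_prefix[OF a0] by (simp add: ext_def)
      finally show ?thesis using H3 by blast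
    next
      case False
      define c where "c = n - 1 + length (T (W s) k)"
      show ?thesis
      proof (cases "t < c")
        case True
        then have "t \<in> I" using False n by (simp add: I_def c_def)
        then show ?thesis using t(2) unfolding H_def by blast
      next
        case ge: False
        let ?R = "R n s (j - Suc k)"
        have dk: "j - (j - Suc k) = Suc k" using k by simp
        have split: "ext n (Suc s) = (suf (j - 1) (n - 1) @ T (W s) k) @ A s k @ ?R"
        proof -
          have "T (W s) (Suc k) @ ?R = W (Suc s) @ pre 0 (n - 1)"
            using T_R[of "j - Suc k" s n] dk by simp
          then show ?thesis by (simp add: ext_def T_Suc del: T.simps W.simps)
        qed
        have lc: "length (suf (j - 1) (n - 1) @ T (W s) k) = c" by (simp add: c_def)
        have "x = take n (drop (t - c) (A s k @ ?R))"
          using t(2) ge lc unfolding split by simp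
        moreover have "t - c + n \<le> length (A s k @ ?R)"
          using t(1) ge lc unfolding split by simp
        ultimately have "x \<in> win n (A s k @ ?R)" using win_I by blast
        also have "win n (A s k @ ?R) \<subseteq> win n (take (n - 1 - a s k) (suf k (n - 1)) @ A s k @ ?R)"
          by (rule win_append_left)
        also have "take (n - 1 - a s k) (suf k (n - 1)) @ A s k @ ?R = suf k (n - 1) @ ?R"
          using A_suffix[OF k(1), of s "n - 1"] k(2) by (metis append_assoc le_diff_conv2 n Suc_eq_plus1 Suc_leI)
        also have "suf k (n - 1) @ ?R = suf (j - Suc (j - Suc k)) (n - 1) @ ?R"
          using k by (simp add: Suc_diff_Suc)
        also have "win n \<dots> \<subseteq> H"
        proof (rule win_chain[OF n H1 H2 H3])
          show "j - Suc k < j" using j0 by simp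
          show "n - 1 \<le> a s l" if "j - Suc (j - Suc k) < l" "l < j" for l
          proof -
            have "k < l" using that k by simp
            then show ?thesis using next_block[OF _ that(2)] by simp
          qed
        qed
        finally show ?thesis .
      qed
    qed
  qed
  have "win n (ext n r) \<subseteq> H" if "Suc s \<le> r" for r
    using that
  proof (induction r rule: nat_induct_at_least)
    case base show ?case by (rule first)
  next
    case (Suc r)
    have large: "n - 1 \<le> a r l" if "l < j" for l
    proof (cases "r = Suc s")
      case True then show ?thesis using next_stage a_mono[of 0 l r] that by simp
    next
      case False
      then have "a (Suc s) 0 < a r l" using Suc that by (intro a_later) auto
      then show ?thesis using next_stage by simp
    qed
    show ?case by (rule ext_step[OF n H1 H2 Suc.IH large])
  qed
  then show ?thesis using that[OF finH cardH] by simp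
qed

end

text \<open>A given word of \<open>z\<close> occurs in every window of \<open>z\<close> of some
  length \<open>L\<close>, and all words of length \<open>L\<close> of a point in the orbit closure
  are such windows.\<close>

lemma uniformly_recurrent_minimal:
  assumes A: "finite A" "\<And>m. z m \<in> A"
    and rec: "\<And>p n. \<exists>L. \<forall>t. \<exists>q. t \<le> q \<and> q + int n \<le> t + int L \<and> word z q n = word z p n"
  shows "minimal_subshift A (orbit_closure A z)"
  unfolding minimal_subshift_def
proof (intro conjI ballI)
  show "subshift A (orbit_closure A z)" by (rule subshift_orbit_closure[OF A])
  show "orbit_closure A z \<noteq> {}" using self_mem_orbit_closure[of z A] A by blast
  fix y assume y: "y \<in> orbit_closure A z"
  have yA: "y k \<in> A" for k using y by (rule orbit_closure_subset_full)
  have yz: "\<exists>m. word z m n = word y k n" for k n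
    using y unfolding mem_orbit_closure[of z A, OF A(2)] by blast
  show "orbit_closure A z = orbit_closure A y"
  proof (intro equalityI subsetI)
    fix u assume u: "u \<in> orbit_closure A y"
    have "\<exists>m. word z m n = word u k n" for k n
    proof -
      obtain m where "word y m n = word u k n"
        using u unfolding mem_orbit_closure[of y A, OF yA] by blast
      then show ?thesis using yz[of n m] by simp
    qed
    then show "u \<in> orbit_closure A z" unfolding mem_orbit_closure[of z A, OF A(2)] by blast
  next
    fix u assume u: "u \<in> orbit_closure A z"
    have "\<exists>m. word y m n = word u k n" for k n
    proof -
      obtain p where p: "word z p n = word u k n"
        using u unfolding mem_orbit_closure[of z A, OF A(2)] by blast
      obtain L where L: "\<And>t. \<exists>q. t \<le> q \<and> q + int n \<le> t + int L \<and> word z q n = word z p n"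
        using rec by blast
      obtain t where t: "word z t L = word y 0 L" using yz by blast
      obtain q where q: "t \<le> q" "q + int n \<le> t + int L" "word z q n = word z p n" using L by blast
      have "word y (q - t) n = word z q n" using subword_eq[OF t q(1,2)] by simp
      then show ?thesis using q(3) p by (intro exI[of _ "q - t"]) simp
    qed
    then show "u \<in> orbit_closure A y" unfolding mem_orbit_closure[of y A, OF yA] by blast
  qed
qed

text \<open>If fewer than \<open>L\<close> letters of \<open>u\<close> are visible, \<open>u\<close>
  and \<open>w\<close> together take up less than \<open>n - L\<close> letters of the window, so its
  last \<open>L\<close> letters lie in \<open>v\<close>.\<close>

lemma win_side:
  assumes x: "x \<in> win n (u @ w @ v)" and u: "length u = n - 1" and v: "length v = n - 1"
    and n: "length w + 2 * L \<le> n" "1 \<le> L"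
  shows "(\<exists>c. c + L \<le> n - 1 \<and> take L x = take L (drop c u)) \<or>
    (\<exists>c. c + L \<le> n - 1 \<and> drop (n - L) x = take L (drop c v))"
proof -
  obtain c where c: "c + n \<le> length (u @ w @ v)" "x = take n (drop c (u @ w @ v))"
    using x by (rule win_E)
  show ?thesis
  proof (cases "c + L \<le> n - 1")
    case True
    have "take L x = take L (drop c u)" using c True u n by (simp add: min_def)
    then show ?thesis using True by blast
  next
    case False
    define c' where "c' = c + n - L - (n - 1 + length w)"
    have ge: "n - 1 + length w \<le> c + n - L" using False n by linarith
    have e: "n - L + c = length (u @ w) + c'" using ge u n by (simp add: c'_def)
    have "drop (n - L) x = take (n - (n - L)) (drop (n - L) (drop c (u @ w @ v)))"
      unfolding c(2) by (rule drop_take)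
    also have "drop (n - L) (drop c (u @ w @ v)) = drop (length (u @ w) + c') ((u @ w) @ v)"
      by (simp only: drop_drop e append_assoc)
    also have "\<dots> = drop c' v" by (simp only: drop_append) simp
    also have "n - (n - L) = L" using n by simp
    finally have "drop (n - L) x = take L (drop c' v)" .
    moreover have "c' + L \<le> n - 1" using c(1) ge u v n by (simp add: c'_def)
    ultimately show ?thesis by blast
  qed
qed

section \<open>The limit point and the complexity of its orbit closure\<close>

context mark_system
begin

primrec pos :: "nat \<Rightarrow> int" where
  "pos 0 = 0"
| "pos (Suc s) = (if even s then pos s else pos s - int (length (T (W s) j)))"

definition inI :: "nat \<Rightarrow> int \<Rightarrow> bool" where
  "inI s m \<longleftrightarrow> pos s \<le> m \<and> m < pos s + int (length (W s))"

text \<open>\<open>W s\<close> is placed as the first or the second of its two copies in \<open>W (s + 1)\<close>,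
  alternately, so that the limit extends in both directions.\<close>
definition x :: "int \<Rightarrow> nat" where
  "x m = W (LEAST s. inI s m) ! nat (m - pos (LEAST s. inI s m))"

lemma T_prefix: "\<exists>v. T w k = w @ v"
  by (induction k) auto

lemma inI_Suc:
  assumes "inI s m"
  shows "inI (Suc s) m" "W (Suc s) ! nat (m - pos (Suc s)) = W s ! nat (m - pos s)"
proof -
  obtain v where v: "T (W s) j = W s @ v" using T_prefix by blast
  have m: "0 \<le> m - pos s" "nat (m - pos s) < length (W s)" using assms by (auto simp: inI_def)
  show "inI (Suc s) m" using assms by (auto simp: inI_def v)
  show "W (Suc s) ! nat (m - pos (Suc s)) = W s ! nat (m - pos s)"
  proof (cases "even s")
    case True
    then show ?thesis using m by (simp add: v nth_append)
  next
    case False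
    have "nat (m - (pos s - int (length (T (W s) j)))) = length (T (W s) j) + nat (m - pos s)"
      using m by simp
    then show ?thesis using False by simp
  qed
qed

text \<open>Consecutive stages agree where both are defined (\<open>inI_Suc\<close>), so any stage
  covering \<open>m\<close> gives the same letter as the least one.\<close>

lemma x_eq: assumes "inI s m" shows "x m = W s ! nat (m - pos s)"
proof -
  define s0 where "s0 = (LEAST s. inI s m)"
  have s0: "inI s0 m" "s0 \<le> s" unfolding s0_def using assms by (auto intro: LeastI Least_le)
  have "inI r m \<and> W r ! nat (m - pos r) = W s0 ! nat (m - pos s0)" if "s0 \<le> r" for r
    using that
  proof (induction r rule: nat_induct_at_least)
    case base then show ?case using s0 by simp
  next
    case (Suc r) then show ?case using inI_Suc[of r m] by simp
  qed
  from this[OF s0(2)] show ?thesis by (simp add: x_def s0_def)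
qed

lemma word_x_W: "word x (pos s) (length (W s)) = W s"
proof (rule nth_equalityI)
  fix l assume "l < length (word x (pos s) (length (W s)))"
  then have l: "l < length (W s)" by simp
  then have "inI s (pos s + int l)" by (simp add: inI_def)
  from x_eq[OF this] show "word x (pos s) (length (W s)) ! l = W s ! l" using l by simp
qed simp

lemma length_W_Suc: "length (W (Suc s)) = length (T (W s) j) + length (W s)" "1 \<le> length (T (W s) j)"
  using length_T_mono[of 0 j "W s"] length_W_ge[of s] by auto

text \<open>One even and one odd stage together extend the interval by at least one letter on each
  side.\<close>

lemma pos_cover: "pos (2 * N) \<le> - int N \<and> int N < pos (2 * N) + int (length (W (2 * N)))"
proof (induction N)
  case (Suc N)
  have p1: "pos (Suc (2 * N)) = pos (2 * N)" by simp
  have p2: "pos (Suc (Suc (2 * N))) = pos (Suc (2 * N)) - int (length (T (W (Suc (2 * N))) j))" by simp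
  show ?case
    using Suc p1 p2 length_W_Suc[of "2 * N"] length_W_Suc[of "Suc (2 * N)"] by (simp del: pos.simps W.simps)
qed simp

lemma word_x_win:
  obtains s where "s0 \<le> s" "word x t n \<in> win n (W s)" "pos s \<le> t" "t + int n \<le> pos s + int (length (W s))"
proof -
  define N where "N = nat \<bar>t\<bar> + n + s0"
  have p: "pos (2 * N) \<le> t" "t + int n \<le> pos (2 * N) + int (length (W (2 * N)))"
  proof -
    have "int N = \<bar>t\<bar> + int n + int s0" by (simp add: N_def)
    then show "pos (2 * N) \<le> t" "t + int n \<le> pos (2 * N) + int (length (W (2 * N)))"
      using pos_cover[of N] by linarith+
  qed
  then have "word x t n \<in> win n (word x (pos (2 * N)) (length (W (2 * N))))" by (intro word_in_win)
  then show ?thesis using p by (intro that[of "2 * N"]) (auto simp: word_x_W N_def)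
qed

lemma word_x_ext:
  obtains r where "s0 \<le> r" "word x t n \<in> win n (ext n r)"
proof -
  obtain s where s: "s0 \<le> s" "word x t n \<in> win n (W s)" by (rule word_x_win)
  have "win n (W s) \<subseteq> win n (ext n s)" unfolding ext_def by (rule win_infix)
  then show ?thesis using s that by blast
qed

abbreviation Al :: "nat set" where "Al \<equiv> {..2 * j}"

lemma Z_Al: "k < j \<Longrightarrow> Z k m \<in> Al"
  using letters[of k m] by auto

lemma set_T: "set w \<subseteq> Al \<Longrightarrow> k \<le> j \<Longrightarrow> set (T w k) \<subseteq> Al"
proof (induction k)
  case (Suc k)
  have "\<forall>b\<in>set (word (Z k) 0 m). b \<in> Al" for m
    unfolding Ball_set_word using Z_Al[of k] Suc.prems by simp
  then show ?case using Suc by auto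
qed simp

lemma set_W: "set (W s) \<subseteq> Al"
  by (induction s) (simp_all add: set_T)

lemma x_Al: "x m \<in> Al"
proof -
  obtain s where s: "pos s \<le> m" "m + int 1 \<le> pos s + int (length (W s))" by (rule word_x_win[of 0 m 1])
  then have "inI s m" by (simp add: inI_def)
  from x_eq[OF this] have "x m \<in> set (W s)" using s by auto
  then show ?thesis using set_W by blast
qed

lemma recurrent_x: "recurrent x"
  unfolding recurrent_def
proof (intro allI)
  fix k n
  obtain s where s: "pos s \<le> k" "k + int n \<le> pos s + int (length (W s))" by (rule word_x_win[of 0 k n])
  let ?d = "int (length (T (W s) j))"
  obtain v where v: "T (W s) j = W s @ v" using T_prefix by blast
  have W1: "word x (pos (Suc s)) (length (W s)) = W s"
  proof -
    have "word x (pos (Suc s)) (length (W s)) = take (length (W s)) (word x (pos (Suc s)) (length (W (Suc s))))"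
      by (rule take_word[symmetric]) (simp add: v)
    also have "\<dots> = W s" unfolding word_x_W by (simp add: v)
    finally show ?thesis .
  qed
  have W2: "word x (pos (Suc s) + ?d) (length (W s)) = W s"
  proof -
    have "drop (length (T (W s) j)) (word x (pos (Suc s)) (length (W (Suc s)))) = W s"
      unfolding word_x_W by simp
    then show ?thesis by (simp add: drop_word)
  qed
  have d: "?d > 0" using length_W_Suc(2)[of s] by linarith
  \<comment> \<open>The copy of \<open>W s\<close> in \<open>W (Suc s)\<close> other than the one at
    \<open>pos s\<close>.\<close>
  define p where "p = (if even s then pos (Suc s) + ?d else pos (Suc s))"
  have p: "p \<noteq> pos s" "word x p (length (W s)) = word x (pos s) (length (W s))"
    using d W1 W2 by (auto simp: p_def word_x_W)
  have "word x (p + (k - pos s)) n = word x k n"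
    using subword_eq[OF p(2), of "p + (k - pos s)" n] s by simp
  then show "\<exists>m. m \<noteq> k \<and> word x m n = word x k n" using p by (intro exI[of _ "p + (k - pos s)"]) auto
qed

abbreviation XX :: "(int \<Rightarrow> nat) set" where "XX \<equiv> orbit_closure Al x"

lemma words_XX: "words XX n = range (\<lambda>t. word x t n)"
  using words_orbit_closure[of x Al n, OF x_Al] by auto

lemma subshift_XX: "subshift Al XX"
  by (rule subshift_orbit_closure) (simp_all only: x_Al finite_atMost)

lemma transitive_XX: "transitive_subshift Al XX" "x \<in> XX"
  using subshift_XX self_mem_orbit_closure[of x Al, OF x_Al] unfolding transitive_subshift_def by auto

lemma complexity_low:
  assumes "1 \<le> n" "n \<le> a s 0"
  shows "complexity XX n \<le> (i + j) * n + j + length (W s)"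
proof -
  have "words XX n \<subseteq> base n s"
  proof
    fix w assume "w \<in> words XX n"
    then obtain t where t: "w = word x t n" by (auto simp: words_XX)
    obtain r where "s \<le> r" "word x t n \<in> win n (ext n r)" by (rule word_x_ext)
    then show "w \<in> base n s" using win_ext_low[OF assms, of r] t by blast
  qed
  then have "complexity XX n \<le> card (base n s)"
    unfolding complexity_def by (intro card_mono finite_base)
  then show ?thesis using card_base[OF assms(1), of s] by linarith
qed

text \<open>\<open>s\<close> is the last stage whose first block is shorter than \<open>n\<close>,
  and \<open>k\<close> the last such block in it. The error \<open>length (T (W s) k)\<close> is at
  most \<open>g (a s k)\<close>, hence at most \<open>g n\<close>.\<close>

lemma complexity_high:
  assumes n: "a 0 0 < n"
  shows "complexity XX n \<le> (i + j + 1) * n + j + g n"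
proof -
  have j0: "0 < j" using j_ge by simp
  define S where "S = {s. a s 0 < n}"
  have "S \<subseteq> {..n}" using a_ge[OF j0] by (auto simp: S_def intro: less_imp_le less_trans)
  then have finS: "finite S" by (rule finite_subset) simp
  define s where "s = Max S"
  have "s \<in> S" unfolding s_def using finS n by (intro Max_in) (auto simp: S_def)
  then have s: "a s 0 < n" by (simp add: S_def)
  have next_stage: "n \<le> a (Suc s) 0"
  proof (rule ccontr)
    assume "\<not> n \<le> a (Suc s) 0"
    then have "Suc s \<in> S" by (simp add: S_def)
    then have "Suc s \<le> s" unfolding s_def using finS by (intro Max_ge)
    then show False by simp
  qed
  define K where "K = {k. k < j \<and> a s k < n}"
  have finK: "finite K" by (rule finite_subset[of _ "{..j}"]) (auto simp: K_def)
  define k where "k = Max K"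
  have "k \<in> K" unfolding k_def using finK s j0 by (intro Max_in) (auto simp: K_def)
  then have k: "k < j" "a s k < n" by (auto simp: K_def)
  have next_block: "n \<le> a s l" if "k < l" "l < j" for l
  proof (rule ccontr)
    assume "\<not> n \<le> a s l"
    then have "l \<in> K" using that by (simp add: K_def)
    then have "l \<le> k" unfolding k_def using finK by (intro Max_ge)
    then show False using that by simp
  qed
  obtain H where H: "finite H" "card H \<le> (i + j + 1) * n + j + length (T (W s) k)"
    "\<And>r. s < r \<Longrightarrow> win n (ext n r) \<subseteq> H" by (rule win_ext_high[OF k next_block next_stage]) blast+
  have "words XX n \<subseteq> H"
  proof
    fix w assume "w \<in> words XX n"
    then obtain t where t: "w = word x t n" by (auto simp: words_XX)
    obtain r where r: "Suc s \<le> r" "word x t n \<in> win n (ext n r)" by (rule word_x_ext)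
    then show "w \<in> H" using H(3)[of r] t by auto
  qed
  then have "complexity XX n \<le> card H" unfolding complexity_def by (intro card_mono H(1))
  moreover have "length (T (W s) k) \<le> g n"
    using g_a[OF k(1), of s] monoD[OF g_mono, of "a s k" n] k(2) by simp
  ultimately show ?thesis using H(2) by linarith
qed

section \<open>The minimal subsystems of the orbit closure\<close>

definition MM :: "nat \<Rightarrow> (int \<Rightarrow> nat) set" where
  "MM k = orbit_closure Al (Z k)"

lemma mem_MM: "k < j \<Longrightarrow> u \<in> MM k \<longleftrightarrow> (\<forall>t n. \<exists>m. word (Z k) m n = word u t n)"
  unfolding MM_def by (rule mem_orbit_closure) (rule Z_Al)

lemma mem_XX: "u \<in> XX \<longleftrightarrow> (\<forall>t n. \<exists>m. word x m n = word u t n)"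
  by (rule mem_orbit_closure) (rule x_Al)

lemma MM_minimal: "k < j \<Longrightarrow> minimal_subshift Al (MM k)"
  unfolding MM_def by (intro uniformly_recurrent_minimal Z_Al unif_rec) auto

lemma Z_in_MM: "k < j \<Longrightarrow> Z k \<in> MM k"
  unfolding MM_def by (rule self_mem_orbit_closure) (rule Z_Al)

text \<open>By uniform recurrence the word occurs within \<open>[0, L)\<close>, and stage number
  \<open>L\<close> already has a block of index \<open>k\<close> longer than
  \<open>L\<close>.\<close>

lemma Z_word_in_x:
  assumes k: "k < j" shows "\<exists>m. word x m n = word (Z k) p n"
proof -
  obtain L where L: "\<And>t. \<exists>q. t \<le> q \<and> q + int n \<le> t + int L \<and> word (Z k) q n = word (Z k) p n"
    using unif_rec[OF k] by blast
  obtain q where q: "0 \<le> q" "q + int n \<le> 0 + int L" "word (Z k) q n = word (Z k) p n" using L by blast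
  have "L \<le> a L k" using a_ge[OF k, of L] by simp
  define c where "c = length (T (W L) k)"
  obtain v where "W (Suc L) = (T (W L) k @ A L k) @ v"
  proof -
    have "\<exists>v. T (W L) l = T (W L) (Suc k) @ v" if "Suc k \<le> l" for l
      using that by (induction l rule: nat_induct_at_least) auto
    then obtain v where "T (W L) j = T (W L) (Suc k) @ v" using k by (meson Suc_leI)
    then show ?thesis using that[of "v @ W L"] T_Suc[of L k] by simp
  qed
  then have "take (a L k) (drop c (word x (pos (Suc L)) (length (W (Suc L))))) = A L k"
    unfolding word_x_W by (simp add: c_def)
  moreover have "c + a L k \<le> length (W (Suc L))"
    using \<open>W (Suc L) = _\<close> by (simp add: c_def del: W.simps)
  ultimately have A: "word x (pos (Suc L) + int c) (a L k) = word (Z k) 0 (a L k)"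
    by (simp add: drop_word take_word A_def)
  have "word x (pos (Suc L) + int c + q) n = word (Z k) q n"
    using subword_eq[OF A, of "pos (Suc L) + int c + q" n] q \<open>L \<le> a L k\<close> by simp
  then show ?thesis using q(3) by (intro exI[of _ "pos (Suc L) + int c + q"]) simp
qed

lemma x_not_in_MM: "k < j \<Longrightarrow> x \<notin> MM k"
proof
  assume k: "k < j" and "x \<in> MM k"
  then have "\<exists>m. word (Z k) m 1 = word x 0 1" by (simp only: mem_MM)
  then obtain m where "Z k m = x 0" by (auto simp: word_eq_iff)
  moreover have "x 0 = 0" using word_x_W[of 0] by (simp add: word_def)
  ultimately show False using letters[OF k, of m] by auto
qed

lemma MM_proper: assumes k: "k < j" shows "MM k \<subset> XX"
proof -
  have "MM k \<subseteq> XX"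
  proof
    fix u assume u: "u \<in> MM k"
    have "\<exists>m. word x m n = word u t n" for t n
    proof -
      obtain p where "word (Z k) p n = word u t n" using u unfolding mem_MM[OF k] by blast
      then show ?thesis using Z_word_in_x[OF k, of n p] by simp
    qed
    then show "u \<in> XX" unfolding mem_XX by blast
  qed
  then show ?thesis using x_not_in_MM[OF k] transitive_XX(2) by blast
qed

text \<open>With \<open>n = length (W L) + 2 * L\<close>, every window of length \<open>n\<close> in
  \<open>x\<close> lies in \<open>base n L\<close>. By \<open>win_side\<close>, neither a border
  between two blocks nor a copy of \<open>W L\<close> can keep \<open>L\<close> letters of a block
  from being visible at one end.\<close>

lemma long_factor:
  assumes L: "1 \<le> L"
  shows "\<exists>n. \<forall>t. \<exists>k<j. \<exists>q p. t \<le> q \<and> q + int L \<le> t + int n \<and> word x q L = word (Z k) p L"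
proof -
  have j0: "0 < j" using j_ge by simp
  define n where "n = length (W L) + 2 * L"
  have n: "1 \<le> n" "n \<le> a L 0" "2 * L \<le> n"
    using length_W_ge[of L] a_gt[OF j0, of L] L by (auto simp: n_def)
  have "\<exists>k<j. \<exists>q p. t \<le> q \<and> q + int L \<le> t + int n \<and> word x q L = word (Z k) p L" for t
  proof -
    have lo: "word x t L = take L (word x t n)" using n by (simp add: take_word)
    have hi: "word x (t + int (n - L)) L = drop (n - L) (word x t n)" using n by (simp add: drop_word)
    have side: ?thesis
      if w: "word x t n \<in> win n (suf k (n - 1) @ w @ pre l (n - 1))" "k < j" "l < j" "length w + 2 * L \<le> n" for k l w
      using win_side[OF w(1) length_suf length_pre w(4) L]
    proof (elim disjE exE conjE)
      fix c assume c: "c + L \<le> n - 1" "take L (word x t n) = take L (drop c (suf k (n - 1)))"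
      have "word x t L = word (Z k) (- int (n - 1) + int c) L"
        unfolding lo c(2) using c(1) by (simp add: suf_def drop_word take_word)
      moreover have "t + int L \<le> t + int n" using n by simp
      ultimately show ?thesis using w(2) by blast
    next
      fix c assume c: "c + L \<le> n - 1" "drop (n - L) (word x t n) = take L (drop c (pre l (n - 1)))"
      have "word x (t + int (n - L)) L = word (Z l) (int c) L"
        unfolding hi c(2) using c(1) by (simp add: pre_def drop_word take_word)
      moreover have "t \<le> t + int (n - L)" "t + int (n - L) + int L \<le> t + int n" using n by simp_all
      ultimately show ?thesis using w(3) by blast
    qed
    obtain r where r: "L \<le> r" "word x t n \<in> win n (ext n r)" by (rule word_x_ext)
    then have "word x t n \<in> base n L" using win_ext_low[OF n(1,2) r(1)] by blast
    then consider l p where "l < j" "word x t n = word (Z l) p n"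
      | l where "Suc l < j" "word x t n \<in> win n (suf l (n - 1) @ pre (Suc l) (n - 1))"
      | "word x t n \<in> win n (ext n L)"
      unfolding base_def by fastforce
    then show ?thesis
    proof cases
      case 1
      have "word x t L = word (Z l) p L" unfolding lo 1 using n by (simp add: take_word)
      moreover have "t + int L \<le> t + int n" using n by simp
      ultimately show ?thesis using 1(1) by blast
    next
      case 2
      then show ?thesis using side[of l "[]" "Suc l"] n by simp
    next
      case 3
      then show ?thesis using side[of "j - 1" "W L" 0] j0 by (simp add: ext_def n_def)
    qed
  qed
  then show ?thesis by blast
qed

text \<open>A point \<open>y\<close> of \<open>M\<close> contains arbitrarily long words of the
  \<open>Z k\<close>; as there are finitely many \<open>k\<close>, one of them serves for all
  lengths. By uniform recurrence \<open>y\<close> then contains every word of this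
  \<open>Z k\<close>, so \<open>Z k\<close> lies in \<open>M\<close>.\<close>

lemma minimal_is_MM:
  assumes M: "minimal_subshift Al M" "M \<subset> XX"
  shows "\<exists>k<j. M = MM k"
proof -
  obtain y where y: "y \<in> M" using M by (auto simp: minimal_subshift_def)
  have My: "M = orbit_closure Al u" if "u \<in> M" for u using M that by (simp add: minimal_subshift_def)
  have yA: "y t \<in> Al" for t using y orbit_closure_subset_full[of y Al y t] My[OF y] by simp
  have long: "\<exists>k<j. \<exists>q p. word y q L = word (Z k) p L" if L: "1 \<le> L" for L
  proof -
    obtain n where n: "\<And>t. \<exists>k<j. \<exists>q p. t \<le> q \<and> q + int L \<le> t + int n \<and> word x q L = word (Z k) p L"
      using long_factor[OF L] by blast
    have "y \<in> XX" using y M by blast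
    then obtain t where t: "word x t n = word y 0 n" unfolding mem_XX by blast
    obtain k q p where k: "k < j" "t \<le> q" "q + int L \<le> t + int n" "word x q L = word (Z k) p L" using n by blast
    have "word y (q - t) L = word x q L" using subword_eq[OF t k(2,3)] by simp
    then show ?thesis using k by (intro exI[of _ k] conjI exI[of _ "q - t"] exI[of _ p]) auto
  qed
  have "\<exists>k<j. \<forall>L. \<exists>q p. word y q L = word (Z k) p L"
  proof (rule ccontr)
    assume "\<not> ?thesis"
    then have "\<forall>k. \<exists>L. k < j \<longrightarrow> (\<forall>q p. word y q L \<noteq> word (Z k) p L)" by blast
    from choice[OF this] obtain f where f: "\<And>k q p. k < j \<Longrightarrow> word y q (f k) \<noteq> word (Z k) p (f k)" by blast
    define L where "L = Suc (Max (f ` {..<j}))"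
    obtain k q p where k: "k < j" "word y q L = word (Z k) p L" using long[of L] by (auto simp: L_def)
    have "f k \<le> Max (f ` {..<j})" using k by (intro Max_ge) auto
    then have "f k \<le> L" by (simp add: L_def)
    then have "word y q (f k) = word (Z k) p (f k)"
      using arg_cong[OF k(2), of "take (f k)"] by (simp add: take_word)
    then show False using f[OF k(1)] by blast
  qed
  then obtain k where k: "k < j" "\<And>L. \<exists>q p. word y q L = word (Z k) p L" by blast
  have "\<exists>m. word y m n = word (Z k) p n" for p n
  proof -
    obtain L where L: "\<And>t. \<exists>q. t \<le> q \<and> q + int n \<le> t + int L \<and> word (Z k) q n = word (Z k) p n"
      using unif_rec[OF k(1)] by blast
    obtain q p' where q: "word y q L = word (Z k) p' L" using k(2) by blast
    obtain q' where q': "p' \<le> q'" "q' + int n \<le> p' + int L" "word (Z k) q' n = word (Z k) p n" using L by blast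
    have "word y (q + (q' - p')) n = word (Z k) q' n"
      using subword_eq[OF q[symmetric] q'(1,2)] by simp
    then show ?thesis using q'(3) by (intro exI[of _ "q + (q' - p')"]) simp
  qed
  then have "Z k \<in> orbit_closure Al y" unfolding mem_orbit_closure[of y Al, OF yA] by blast
  then have "Z k \<in> M" using My[OF y] by simp
  then show ?thesis using My k(1) unfolding MM_def by blast
qed

lemma minimal_subsystems: "proper_minimal_subsystems Al XX = MM ` {..<j}"
proof (intro equalityI subsetI)
  fix M assume "M \<in> proper_minimal_subsystems Al XX"
  then have "minimal_subshift Al M" "M \<subset> XX"
    unfolding proper_minimal_subsystems_def by simp_all
  then obtain k where "k < j" "M = MM k" using minimal_is_MM by blast
  then show "M \<in> MM ` {..<j}" by simp
next
  fix M assume "M \<in> MM ` {..<j}"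
  then obtain k where k: "k < j" "M = MM k" by (elim imageE) (simp only: lessThan_iff)
  show "M \<in> proper_minimal_subsystems Al XX"
    unfolding proper_minimal_subsystems_def mem_Collect_eq k(2)
    by (rule conjI[OF MM_proper[OF k(1)] MM_minimal[OF k(1)]])
qed

lemma inj_MM: "inj_on MM {..<j}"
proof (rule inj_onI)
  fix k l assume kl: "k \<in> {..<j}" "l \<in> {..<j}" "MM k = MM l"
  then have "Z k \<in> MM l" using Z_in_MM[of k] by simp
  moreover have "l < j" using kl by simp
  ultimately have "\<forall>t n. \<exists>m. word (Z l) m n = word (Z k) t n" by (intro mem_MM[THEN iffD1])
  then have "\<exists>m. word (Z l) m 1 = word (Z k) 0 1" by blast
  then obtain m where "Z l m = Z k 0" by (auto simp: word_eq_iff)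
  then show "k = l" using letters[of l m] letters[of k 0] kl by auto
qed

lemma counts: "has_minimal_counts Al XX j i"
  unfolding has_minimal_counts_def minimal_subsystems
proof (intro conjI)
  show "finite (MM ` {..<j})" by simp
  show "card (MM ` {..<j}) = j" using card_image[OF inj_MM] by simp
  have "{M \<in> MM ` {..<j}. infinite M} = MM ` {..<i}"
  proof (intro equalityI subsetI)
    fix M assume "M \<in> {M \<in> MM ` {..<j}. infinite M}"
    then obtain k where "M = MM k" "k < j" "infinite (MM k)" by blast
    then show "M \<in> MM ` {..<i}" using infinite_iff[of k] by (simp add: MM_def)
  next
    fix M assume "M \<in> MM ` {..<i}"
    then obtain k where "M = MM k" "k < i" by blast
    then show "M \<in> {M \<in> MM ` {..<j}. infinite M}" using infinite_iff[of k] i_le by (simp add: MM_def)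
  qed
  moreover have "inj_on MM {..<i}" by (rule inj_on_subset[OF inj_MM]) (use i_le in auto)
  ultimately show "card {M \<in> MM ` {..<j}. infinite M} = i" by (simp add: card_image)
qed

lemma sharp_limsup:
  "limsup (\<lambda>n. ereal (real (complexity XX n) - (real (j + i + 1) * real n + real (g n)))) \<noteq> \<infinity>"
proof -
  have "\<forall>\<^sub>F n in sequentially. ereal (real (complexity XX n) - (real (j + i + 1) * real n + real (g n))) \<le> ereal (real j)"
    unfolding eventually_sequentially
  proof (intro exI allI impI)
    fix n assume "Suc (a 0 0) \<le> n"
    then have "complexity XX n \<le> (i + j + 1) * n + j + g n" by (intro complexity_high) simp
    then have "real (complexity XX n) \<le> real ((i + j + 1) * n + j + g n)" by (simp only: of_nat_le_iff)
    then show "ereal (real (complexity XX n) - (real (j + i + 1) * real n + real (g n))) \<le> ereal (real j)"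
      by (simp add: algebra_simps)
  qed
  then have "limsup (\<lambda>n. ereal (real (complexity XX n) - (real (j + i + 1) * real n + real (g n)))) \<le> ereal (real j)"
    by (rule Limsup_bounded)
  then show ?thesis by auto
qed

text \<open>At the lengths \<open>n = a s 0\<close> all blocks outside the copies of
  \<open>W s\<close> have length at least \<open>n\<close>, and
  \<open>length (W s) \<le> g n\<close>.\<close>

lemma sharp_liminf:
  "liminf (\<lambda>n. ereal (real (complexity XX n) - (real (j + i) * real n + real (g n)))) \<noteq> \<infinity>"
proof
  have j0: "0 < j" using j_ge by simp
  assume "liminf (\<lambda>n. ereal (real (complexity XX n) - (real (j + i) * real n + real (g n)))) = \<infinity>"
  then have "ereal (real j) < liminf (\<lambda>n. ereal (real (complexity XX n) - (real (j + i) * real n + real (g n))))"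
    by simp
  then have "\<forall>\<^sub>F n in sequentially. ereal (real j) < ereal (real (complexity XX n) - (real (j + i) * real n + real (g n)))"
    by (rule less_LiminfD)
  then obtain s where s: "\<And>n. s \<le> n \<Longrightarrow> real j < real (complexity XX n) - (real (j + i) * real n + real (g n))"
    by (auto simp: eventually_sequentially)
  define n where "n = a s 0"
  have n: "s \<le> n" "1 \<le> n" using a_ge[OF j0, of s] by (auto simp: n_def)
  have "complexity XX n \<le> (i + j) * n + j + length (W s)"
    using n by (intro complexity_low) (auto simp: n_def)
  also have "\<dots> \<le> (i + j) * n + j + g n" using g_a[OF j0, of s] by (simp add: n_def)
  finally have "real (complexity XX n) \<le> real ((i + j) * n + j + g n)" by (simp only: of_nat_le_iff)
  then show False using s[OF n(1)] by (simp add: algebra_simps)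
qed

end

section \<open>Sturmian and constant points as building blocks\<close>

lemma infinite_sturm_orbit:
  assumes "\<And>m. 2 * k + sturm m \<in> A"
  shows "infinite (orbit_closure A (\<lambda>m. 2 * k + sturm m))"
proof
  let ?z = "\<lambda>m. 2 * k + sturm m"
  assume fin: "finite (orbit_closure A ?z)"
  define f where "f d = (\<lambda>m. ?z (m + int d))" for d :: nat
  have "range f \<subseteq> orbit_closure A ?z"
  proof
    fix u assume "u \<in> range f"
    then obtain d where d: "u = f d" by blast
    have "word ?z (t + int d) n = word u t n" for t n
      by (simp add: word_eq_iff d f_def algebra_simps)
    then show "u \<in> orbit_closure A ?z" unfolding mem_orbit_closure[of ?z A, OF assms] by blast
  qed
  then have "finite (range f)" using fin by (rule finite_subset)
  then have "\<not> inj f" using finite_imageD infinite_UNIV_nat by blast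
  then obtain d e where de: "d < e" "f d = f e"
    unfolding inj_def by (metis linorder_neqE_nat)
  have "sturm (m + int (e - d)) = sturm m" for m
    using fun_cong[OF de(2), of "m - int d"] de(1) by (simp add: f_def of_nat_diff algebra_simps)
  then show False using sturm_not_periodic[of "int (e - d)"] de(1) by auto
qed

lemma finite_constant_orbit: "finite (orbit_closure A (\<lambda>_. c))"
proof -
  have "orbit_closure A (\<lambda>_. c) \<subseteq> {\<lambda>_. c}"
  proof
    fix u assume u: "u \<in> orbit_closure A (\<lambda>_. c)"
    have "u t = c" for t
    proof -
      define C where "C = {z. (\<forall>i. z i \<in> A) \<and> word z t 1 = word u t 1}"
      have "u \<in> full_shift A closure_of orbit (\<lambda>_. c)" using u by (simp add: orbit_closure_def)
      then obtain z where "z \<in> orbit (\<lambda>_. c)" "word z t 1 = word u t 1"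
        unfolding full_shift_closure_of by blast
      then show ?thesis by (auto simp: orbit_def word_eq_iff)
    qed
    then show "u \<in> {\<lambda>_. c}" by auto
  qed
  then show ?thesis by (rule finite_subset) simp
qed

lemma mark_system_sturm:
  assumes "2 \<le> j" "i \<le> j" "mono g" "\<not> bdd_above (range g)"
  shows "mark_system j i (\<lambda>k m. if k < i then 2 * k + sturm m else 2 * k + 1) g"
proof
  fix k B n p m
  let ?Z = "\<lambda>k m. if k < i then 2 * k + sturm m else 2 * k + 1"
  have sturm_word: "word (?Z k) t n = map ((+) (2 * k)) (word sturm t n)" if "k < i" for t n
    using that by (auto simp: word_def)
  show "\<exists>a>B. \<forall>m. 0 \<le> m \<and> m < int a \<longrightarrow> ?Z k (m - int a) = ?Z k m"
  proof (cases "k < i")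
    case True then show ?thesis using sturm_square[of B] by simp
  next
    case False then show ?thesis by (intro exI[of _ "Suc B"]) simp
  qed
  show "\<exists>L. \<forall>t. \<exists>q. t \<le> q \<and> q + int n \<le> t + int L \<and> word (?Z k) q n = word (?Z k) p n"
  proof (cases "k < i")
    case True
    obtain L where "\<And>t. \<exists>q. t \<le> q \<and> q + int n \<le> t + int L \<and> word sturm q n = word sturm p n"
      using sturm_uniformly_recurrent by blast
    then show ?thesis unfolding sturm_word[OF True] by metis
  next
    case False
    then show ?thesis by (intro exI[of _ n]) (auto simp: word_def)
  qed
  show "card (range (\<lambda>t. word (?Z k) t n)) \<le> n + 1" if "k < i"
  proof -
    have "range (\<lambda>t. word (?Z k) t n) = map ((+) (2 * k)) ` range (\<lambda>t. word sturm t n)"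
      unfolding sturm_word[OF that] by (simp add: image_image)
    moreover have "finite (range (\<lambda>t. word sturm t n))"
    proof (rule finite_subset)
      have "\<forall>b\<in>set (word sturm t n). b \<in> {1, 2}" for t
        unfolding Ball_set_word using sturm_range by blast
      then show "range (\<lambda>t. word sturm t n) \<subseteq> {w. set w \<subseteq> {1, 2} \<and> length w = n}"
        by (auto simp del: insert_iff)
    qed (rule finite_lists_length_eq, simp)
    ultimately show ?thesis using card_image_le sturm_count[of n] le_trans by metis
  qed
  show "card (range (\<lambda>t. word (?Z k) t n)) \<le> 1" if "i \<le> k"
    using that by (simp add: word_def)
  show "?Z k m \<in> {2 * k + 1, 2 * k + 2}" using sturm_range[of m] by auto
  show "infinite (orbit_closure {..2 * j} (?Z k)) \<longleftrightarrow> k < i" if "k < j"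
  proof (cases "k < i")
    case True
    have "2 * k + sturm m \<in> {..2 * j}" for m using sturm_range[of m] that by auto
    from infinite_sturm_orbit[OF this] show ?thesis using True by simp
  next
    case False
    then show ?thesis using finite_constant_orbit by simp
  qed
qed (use assms in auto)

text \<open>One subshift serves both bounds: the estimate for the upper limit holds at all large
  lengths, the one for the lower limit along the lengths \<open>a s 0\<close>.\<close>

theorem sharpness:
  fixes g :: "nat \<Rightarrow> nat"
  assumes "2 \<le> j" "i \<le> j" "mono g" "\<not> bdd_above (range g)"
  shows "\<exists>(A :: nat set) X x.
      transitive_subshift A X \<and> x \<in> X \<and> recurrent x \<and> X = orbit_closure A x \<and>
      has_minimal_counts A X j i \<and>
      limsup (\<lambda>n. ereal (real (complexity X n) - (real (j + i + 1) * real n + real (g n)))) \<noteq> \<infinity> \<and>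
      liminf (\<lambda>n. ereal (real (complexity X n) - (real (j + i) * real n + real (g n)))) \<noteq> \<infinity>"
proof -
  interpret mark_system j i "\<lambda>k m. if k < i then 2 * k + sturm m else 2 * k + 1" g
    by (rule mark_system_sturm[OF assms])
  show ?thesis
    using transitive_XX recurrent_x counts sharp_limsup sharp_liminf
    by (intro exI[of _ Al] exI[of _ XX] exI[of _ x] conjI) (rule refl | assumption)+
qed

theorem theorem1p2:
  fixes j i :: nat
  assumes "j \<ge> 2" and "i \<le> j"
  shows
    "(\<forall>(A :: 'a set) X x.
        transitive_subshift A X \<and> x \<in> X \<and> recurrent x \<and> X = orbit_closure A x \<and>
        has_minimal_counts A X j i \<longrightarrow>
          limsup (\<lambda>n. ereal (real (complexity X n) - real (j + i + 1) * real n)) = \<infinity> \<and>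
          liminf (\<lambda>n. ereal (real (complexity X n) - real (j + i) * real n)) = \<infinity>)
     \<and>
     (\<forall>g :: nat \<Rightarrow> nat. mono g \<and> \<not> bdd_above (range g) \<longrightarrow>
        (\<exists>(A :: nat set) X x.
           transitive_subshift A X \<and> x \<in> X \<and> recurrent x \<and> X = orbit_closure A x \<and>
           has_minimal_counts A X j i \<and>
           limsup (\<lambda>n. ereal (real (complexity X n) - (real (j + i + 1) * real n + real (g n)))) \<noteq> \<infinity>)
        \<and>
        (\<exists>(A :: nat set) X x.
           transitive_subshift A X \<and> x \<in> X \<and> recurrent x \<and> X = orbit_closure A x \<and>
           has_minimal_counts A X j i \<and>
           liminf (\<lambda>n. ereal (real (complexity X n) - (real (j + i) * real n + real (g n)))) \<noteq> \<infinity>))"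
proof (intro conjI allI impI)
  fix A :: "'a set" and X x
  assume h: "transitive_subshift A X \<and> x \<in> X \<and> recurrent x \<and> X = orbit_closure A x \<and>
    has_minimal_counts A X j i"
  then have t: "transitive_subshift A X" and x: "x \<in> X" and r: "recurrent x"
    and X: "X = orbit_closure A x" and c: "has_minimal_counts A X j i" by blast+
  show "limsup (\<lambda>n. ereal (real (complexity X n) - real (j + i + 1) * real n)) = \<infinity>"
    by (rule complexity_limits(1)[OF assms(1) t x r X c])
  show "liminf (\<lambda>n. ereal (real (complexity X n) - real (j + i) * real n)) = \<infinity>"
    by (rule complexity_limits(2)[OF assms(1) t x r X c])
next
  fix g :: "nat \<Rightarrow> nat" assume "mono g \<and> \<not> bdd_above (range g)"
  then have g: "mono g" "\<not> bdd_above (range g)" by blast+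
  from sharpness[OF assms g] obtain A :: "nat set" and X x where
    *: "transitive_subshift A X" "x \<in> X" "recurrent x" "X = orbit_closure A x" "has_minimal_counts A X j i"
    "limsup (\<lambda>n. ereal (real (complexity X n) - (real (j + i + 1) * real n + real (g n)))) \<noteq> \<infinity>"
    "liminf (\<lambda>n. ereal (real (complexity X n) - (real (j + i) * real n + real (g n)))) \<noteq> \<infinity>"
    by (elim exE conjE) (rule that)
  show "\<exists>(A :: nat set) X x.
      transitive_subshift A X \<and> x \<in> X \<and> recurrent x \<and> X = orbit_closure A x \<and>
      has_minimal_counts A X j i \<and>
      limsup (\<lambda>n. ereal (real (complexity X n) - (real (j + i + 1) * real n + real (g n)))) \<noteq> \<infinity>"
    by (intro exI[of _ A] exI[of _ X] exI[of _ x] conjI) (rule *)+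
  show "\<exists>(A :: nat set) X x.
      transitive_subshift A X \<and> x \<in> X \<and> recurrent x \<and> X = orbit_closure A x \<and>
      has_minimal_counts A X j i \<and>
      liminf (\<lambda>n. ereal (real (complexity X n) - (real (j + i) * real n + real (g n)))) \<noteq> \<infinity>"
    by (intro exI[of _ A] exI[of _ X] exI[of _ x] conjI) (rule *)+
qed

end
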